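(* Any tropical curve in $\mathbb{R}^n$ with vertices of valence at most $4$ has a Lagrangian lift in $T^*T^n$ which is immersed away from a discrete set of isolated conical singular points, which project to the $4$-valent vertices under projection $T^*T^n\to\mathbb{R}^n$ to the cotangent fiber.
   Context: A tropical curve $W\subset\mathbb{R}^n$ is a collection of $1$-dimensional rational convex polyhedral domains $\{W_s\}$ (edges, rays) with weights $w_s\in\mathbb{Z}_{>0}$ such that any intersection $W_s\cap W_t$ is empty or a boundary point of both, and at each boundary point $v$ the balancing condition $\sum_{s\colon v\in W_s}w_su_s=0$ holds, where $u_s$ is the primitive integral vector tangent to $W_s$ at $v$. $T^*T^n=T^n\times\mathbb{R}^n=T^*\mathbb{R}^n/T^*_{\mathbb{Z}}\mathbb{R}^n$. For an edge $W_s$, its periodized conormal bundle is $N^*W_s/N^*_{\mathbb{Z}}W_s\subset T^*T^n$, the product of $W_s$ with the subtorus $T^{n-1}\subset T^n$ annihilating its direction. A Lagrangian lift of $W$ is a (possibly immersed or singular) Lagrangian submanifold of $T^*T^n$ whose image under projection to the cotangent fiber $\mathbb{R}^n$ is contained in a small neighborhood of $W$, and which over the edges, away from a small neighborhood of the vertices, is modelled on the periodized conormal bundles to the edges (counted with the multiplicities dictated by the weights). A conical singular point is a point near which the Lagrangian coincides, in a Darboux chart, with a cone $C\subset\mathbb{C}^n$ (with $tC=C$ for all $t>0$) that is Lagrangian and smooth away from its singular locus. *)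

theory Defs
  imports "HOL-Analysis.Analysis"
begin

section \<open>Smooth maps\<close>

text \<open>Meant for open sets \<open>S\<close>, where the Frechet derivative is unique.\<close>

primrec Ck_on :: "nat \<Rightarrow> 'a::real_normed_vector set \<Rightarrow> ('a \<Rightarrow> 'b::real_normed_vector) \<Rightarrow> bool" where
  "Ck_on 0 S f \<longleftrightarrow> continuous_on S f"
| "Ck_on (Suc k) S f \<longleftrightarrow>
     (\<forall>x\<in>S. f differentiable (at x)) \<and> (\<forall>v. Ck_on k S (\<lambda>x. frechet_derivative f (at x) v))"

definition smooth_on :: "'a::real_normed_vector set \<Rightarrow> ('a \<Rightarrow> 'b::real_normed_vector) \<Rightarrow> bool" where
  "smooth_on S f \<longleftrightarrow> (\<forall>k. Ck_on k S f)"


section \<open>Abstract smooth manifolds of dimension \<open>CARD('n)\<close>\<close>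

text \<open>An atlas is a set of pairs (domain, coordinate map).\<close>

type_synonym ('m, 'n) atlas = "('m set \<times> ('m \<Rightarrow> real^'n)) set"

definition smooth_manifold :: "'m topology \<Rightarrow> ('m, 'n::finite) atlas \<Rightarrow> bool" where
  "smooth_manifold T \<A> \<longleftrightarrow>
     Hausdorff_space T \<and> second_countable T \<and>
     (\<Union>(D, \<phi>)\<in>\<A>. D) = topspace T \<and>
     (\<forall>(D, \<phi>)\<in>\<A>. openin T D \<and> open (\<phi> ` D) \<and>
        homeomorphic_map (subtopology T D) (top_of_set (\<phi> ` D)) \<phi>) \<and>
     (\<forall>(D, \<phi>)\<in>\<A>. \<forall>(D', \<phi>')\<in>\<A>. smooth_on (\<phi> ` (D \<inter> D')) (\<phi>' \<circ> inv_into D \<phi>))"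


section \<open>Tropical curves in \<open>\<real>\<^sup>n\<close>\<close>

definition integral_vec :: "real^'n::finite \<Rightarrow> bool" where
  "integral_vec a \<longleftrightarrow> (\<forall>i. a $ i \<in> \<int>)"

definition primitive_vec :: "real^'n::finite \<Rightarrow> bool" where
  "primitive_vec u \<longleftrightarrow> integral_vec u \<and> Gcd (range (\<lambda>i. \<lfloor>u $ i\<rfloor>)) = (1::int)"

text \<open>Half-spaces have integral normals but arbitrary real offsets, so that edges have rational
  slope while vertices may have irrational coordinates.\<close>

definition rational_polyhedral_domain :: "(real^'n::finite) set \<Rightarrow> bool" where
  "rational_polyhedral_domain S \<longleftrightarrow>
     (\<exists>F. finite F \<and> S = \<Inter>F \<and> (\<forall>H\<in>F. \<exists>a c. integral_vec a \<and> H = {x. a \<bullet> x \<le> c}))"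

text \<open>The primitive integral vector at the boundary point \<open>v\<close> pointing into the convex
  one-dimensional domain \<open>S\<close>.\<close>

definition edge_dir :: "real^'n::finite \<Rightarrow> (real^'n) set \<Rightarrow> real^'n" where
  "edge_dir v S = (THE u. primitive_vec u \<and> (\<exists>t>0. v + t *\<^sub>R u \<in> S))"

definition vertices :: "(real^'n::finite) set set \<Rightarrow> (real^'n) set" where
  "vertices E = (\<Union>S\<in>E. rel_frontier S)"

definition valence :: "(real^'n::finite) set set \<Rightarrow> real^'n \<Rightarrow> nat" where
  "valence E v = card {S\<in>E. v \<in> S}"

text \<open>Collections of edges may be infinite but are locally finite. A domain without boundary
  points (a full line) is allowed as an edge.\<close>

definition tropical_curve :: "(real^'n::finite) set set \<Rightarrow> ((real^'n) set \<Rightarrow> nat) \<Rightarrow> bool" where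
  "tropical_curve E w \<longleftrightarrow>
     locally_finite_in euclidean E \<and>
     (\<forall>S\<in>E. rational_polyhedral_domain S \<and> aff_dim S = 1 \<and> w S > 0) \<and>
     (\<forall>S\<in>E. \<forall>S'\<in>E. S \<noteq> S' \<longrightarrow>
        S \<inter> S' = {} \<or> (\<exists>v. S \<inter> S' = {v} \<and> v \<in> rel_frontier S \<and> v \<in> rel_frontier S')) \<and>
     (\<forall>v\<in>vertices E. (\<Sum>S | S \<in> E \<and> v \<in> S. real (w S) *\<^sub>R edge_dir v S) = 0)"


section \<open>The symplectic manifold \<open>T\<^sup>*T\<^sup>n\<close>\<close>

text \<open>\<open>T\<^sup>*\<real>\<^sup>n\<close>, and also \<open>\<complex>\<^sup>n\<close> with \<open>z = x + i y\<close> written \<open>(x, y)\<close>, is \<open>\<real>\<^sup>n \<times> \<real>\<^sup>n\<close> with the standard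
  symplectic form.\<close>

definition symp :: "(real^'n::finite) \<times> (real^'n) \<Rightarrow> (real^'n) \<times> (real^'n) \<Rightarrow> real" where
  "symp a b = fst a \<bullet> snd b - snd a \<bullet> fst b"

text \<open>\<open>T\<^sup>n = \<real>\<^sup>n / \<int>\<^sup>n\<close> is realised as the product of unit circles in \<open>\<complex>\<^sup>n\<close>; the quotient map below
  carries the smooth and symplectic structure of \<open>T\<^sup>*T\<^sup>n\<close>. The projection to \<open>\<real>\<^sup>n\<close> is \<open>snd\<close>.\<close>

definition quot :: "(real^'n::finite) \<times> (real^'n) \<Rightarrow> (complex^'n) \<times> (real^'n)" where
  "quot x = ((\<chi> j. cis (2 * pi * fst x $ j)), snd x)"

definition cotorus :: "((complex^'n::finite) \<times> (real^'n)) set" where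
  "cotorus = range quot"

definition periodized_conormal :: "(real^'n::finite) set \<Rightarrow> ((complex^'n) \<times> (real^'n)) set" where
  "periodized_conormal S = quot ` {(q, p). p \<in> S \<and> (\<forall>x\<in>S. \<forall>y\<in>S. q \<bullet> (x - y) = 0)}"


section \<open>Immersed Lagrangians\<close>

definition lagrangian_immersion_on ::
  "(real^'n::finite) set \<Rightarrow> (real^'n \<Rightarrow> (real^'n) \<times> (real^'n)) \<Rightarrow> bool" where
  "lagrangian_immersion_on B F \<longleftrightarrow>
     open B \<and> smooth_on B F \<and>
     (\<forall>x\<in>B. inj (frechet_derivative F (at x)) \<and>
        (\<forall>a b. symp (frechet_derivative F (at x) a) (frechet_derivative F (at x) b) = 0))"

text \<open>A map into \<open>T\<^sup>*T\<^sup>n\<close> is a Lagrangian immersion if in every chart it lifts locally to a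
  Lagrangian immersion into \<open>\<real>\<^sup>n \<times> \<real>\<^sup>n\<close>.\<close>

definition lagrangian_immersion ::
  "('m, 'n::finite) atlas \<Rightarrow> ('m \<Rightarrow> (complex^'n) \<times> (real^'n)) \<Rightarrow> bool" where
  "lagrangian_immersion \<A> f \<longleftrightarrow>
     (\<forall>(D, \<phi>)\<in>\<A>. \<forall>x\<in>D. \<exists>B F. \<phi> x \<in> B \<and> B \<subseteq> \<phi> ` D \<and> lagrangian_immersion_on B F \<and>
        (\<forall>y\<in>D. \<phi> y \<in> B \<longrightarrow> f y = quot (F (\<phi> y))))"

definition lag_support ::
  "'m topology \<Rightarrow> ('m \<Rightarrow> 'b) \<Rightarrow> 'b set \<Rightarrow> 'b set" where
  "lag_support T f \<Sigma> = f ` topspace T \<union> \<Sigma>"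

text \<open>A closed Lagrangian without boundary, immersed away from the closed set \<open>\<Sigma>\<close>. Properness
  of \<open>f\<close> into the complement of \<open>\<Sigma>\<close> excludes boundaries and loose ends.\<close>

definition singular_lagrangian ::
  "'m topology \<Rightarrow> ('m, 'n::finite) atlas \<Rightarrow> ('m \<Rightarrow> (complex^'n) \<times> (real^'n)) \<Rightarrow>
   ((complex^'n) \<times> (real^'n)) set \<Rightarrow> bool" where
  "singular_lagrangian T \<A> f \<Sigma> \<longleftrightarrow>
     smooth_manifold T \<A> \<and> lagrangian_immersion \<A> f \<and>
     closed \<Sigma> \<and> \<Sigma> \<subseteq> cotorus \<and> \<Sigma> \<subseteq> closure (f ` topspace T) \<and>
     proper_map T (top_of_set (cotorus - \<Sigma>)) f"


section \<open>Lagrangian lifts\<close>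

text \<open>Here \<open>U\<close> is a neighbourhood of the curve and \<open>V\<close> one of its vertices. Outside \<open>closure V\<close>
  the Lagrangian consists exactly of \<open>w S\<close> sheets over each edge \<open>S\<close>, each of them a copy of the
  periodized conormal bundle.\<close>

definition lagrangian_lift ::
  "(real^'n::finite) set set \<Rightarrow> ((real^'n) set \<Rightarrow> nat) \<Rightarrow> (real^'n) set \<Rightarrow> (real^'n) set \<Rightarrow>
   'm topology \<Rightarrow> ('m, 'n) atlas \<Rightarrow> ('m \<Rightarrow> (complex^'n) \<times> (real^'n)) \<Rightarrow>
   ((complex^'n) \<times> (real^'n)) set \<Rightarrow> bool" where
  "lagrangian_lift E w U V T \<A> f \<Sigma> \<longleftrightarrow>
     singular_lagrangian T \<A> f \<Sigma> \<and>
     snd ` lag_support T f \<Sigma> \<subseteq> U \<and>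
     snd ` \<Sigma> \<subseteq> closure V \<and>
     (\<forall>x\<in>topspace T. snd (f x) \<in> \<Union>E \<union> closure V) \<and>
     (\<forall>S\<in>E. \<exists>P :: nat \<Rightarrow> 'm set.
        disjoint_family_on P {..<w S} \<and>
        (\<Union>k<w S. P k) = {x \<in> topspace T. snd (f x) \<in> S - closure V} \<and>
        (\<forall>k<w S. openin T (P k) \<and>
           homeomorphic_map (subtopology T (P k))
             (top_of_set {z \<in> periodized_conormal S. snd z \<notin> closure V}) f))"


section \<open>Conical singular points\<close>

definition smooth_lagrangian_at ::
  "((real^'n::finite) \<times> (real^'n)) set \<Rightarrow> (real^'n) \<times> (real^'n) \<Rightarrow> bool" where
  "smooth_lagrangian_at C x \<longleftrightarrow>
     (\<exists>N B F G. open N \<and> x \<in> N \<and> lagrangian_immersion_on B F \<and> homeomorphism B (C \<inter> N) F G)"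

definition singular_locus ::
  "((real^'n::finite) \<times> (real^'n)) set \<Rightarrow> ((real^'n) \<times> (real^'n)) set" where
  "singular_locus C = {x \<in> C. \<not> smooth_lagrangian_at C x}"

text \<open>Density of the smooth locus rules out lower-dimensional cones such as \<open>{0}\<close>.\<close>

definition lagrangian_cone :: "((real^'n::finite) \<times> (real^'n)) set \<Rightarrow> bool" where
  "lagrangian_cone C \<longleftrightarrow>
     (\<forall>t>0. (\<lambda>x. t *\<^sub>R x) ` C = C) \<and> C \<subseteq> closure (C - singular_locus C)"

text \<open>An injective map preserving the symplectic forms is a diffeomorphism onto an open set, by
  nondegeneracy and the inverse function theorem.\<close>

definition darboux_chart ::
  "((complex^'n::finite) \<times> (real^'n)) set \<Rightarrow>
   ((complex^'n) \<times> (real^'n) \<Rightarrow> (real^'n) \<times> (real^'n)) \<Rightarrow> bool" where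
  "darboux_chart N \<psi> \<longleftrightarrow>
     openin (top_of_set cotorus) N \<and> inj_on \<psi> N \<and>
     smooth_on (quot -` N) (\<psi> \<circ> quot) \<and>
     (\<forall>x\<in>quot -` N. \<forall>a b.
        symp (frechet_derivative (\<psi> \<circ> quot) (at x) a) (frechet_derivative (\<psi> \<circ> quot) (at x) b)
          = symp a b)"

text \<open>The singular point is isolated: the apex is the whole singular locus of the cone.\<close>

definition isolated_conical_point ::
  "((complex^'n::finite) \<times> (real^'n)) set \<Rightarrow> (complex^'n) \<times> (real^'n) \<Rightarrow> bool" where
  "isolated_conical_point L z \<longleftrightarrow>
     (\<exists>N \<psi> C. darboux_chart N \<psi> \<and> z \<in> N \<and> \<psi> z = 0 \<and>
        lagrangian_cone C \<and> singular_locus C = {0} \<and> \<psi> ` (L \<inter> N) = C \<inter> \<psi> ` N)"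

end

theory Submission
  imports Defs "HOL-Complex_Analysis.Complex_Analysis"
begin

text \<open>Near a 2-valent vertex the lift is a tube over a curve, near a 3-valent one it is a Lagrangian
  pair of pants \<open>e\<^bsup>a + 2\<pi>i\<theta>\<^sub>2\<^esup> + e\<^bsup>b - 2\<pi>i\<theta>\<^sub>1\<^esup> = 1\<close> whose legs are cut off to exact conormals, scaled
  down to fit into a small ball. At a 4-valent vertex the balanced quadruple of edges is split into
  two balanced triples by a common edge and its opposite, and the two corresponding pairs of pants,
  placed at the same vertex, are joined by a tube over an S-shaped curve. The result is immersed, so
  the set \<open>\<Sigma>\<close> of conical points can be taken to be empty. A leg along \<open>w u\<close> with \<open>u\<close> primitive
  consists of \<open>w\<close> parallel conormals of \<open>u\<close>; these are translated onto each other before they leave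
  the ball.\<close>

section \<open>Smooth maps\<close>

text \<open>All pieces are described by membership, as sets of triples of a label, q and p, so
  gluing two of them means that they coincide over an overlap. Charts and transition maps enter only
  once, when the assembled set is turned into an immersed manifold. The label does double duty: it
  separates sheets that cross in T*T^n, and its boundedness makes the projection proper. The
  obstacle at a 4-valent vertex is that the two auxiliary legs point in opposite directions f and
  -f, so neither runs into the other and the joining curve has to turn back twice. It stays immersed
  because q \<bullet> f makes one full turn meanwhile, which also restores the phase modulo 1.
  Phases are the other obstacle: the third leg of a pair of pants has phase 1/2, and a weight w
  spreads a leg over the phases (c + k) / w, while all sheets over the edges have phase 0. The
  corrections are made along rays, where every curve in the (q \<bullet> u, p)-cylinder gives a
  Lagrangian tube, so no area constraint arises.\<close>

lemma Ck_on_subset: "Ck_on k S f \<Longrightarrow> T \<subseteq> S \<Longrightarrow> Ck_on k T f"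
  by (induction k arbitrary: f) (auto intro: continuous_on_subset)

lemma smooth_on_subset: "smooth_on S f \<Longrightarrow> T \<subseteq> S \<Longrightarrow> smooth_on T f"
  unfolding smooth_on_def by (blast intro: Ck_on_subset)

lemma Ck_on_Suc_imp: "Ck_on (Suc k) S f \<Longrightarrow> Ck_on k S f"
proof (induction k arbitrary: f)
  case 0
  then show ?case
    by (metis Ck_on.simps differentiable_at_withinI differentiable_imp_continuous_on differentiable_on_def)
next
  case (Suc k)
  then show ?case by auto
qed

lemma Ck_on_Suc_has_derivative:
  "Ck_on (Suc k) S f \<Longrightarrow> x \<in> S \<Longrightarrow> (f has_derivative frechet_derivative f (at x)) (at x)"
  by (simp flip: frechet_derivative_works)

lemma smooth_on_differentiable: "smooth_on S f \<Longrightarrow> x \<in> S \<Longrightarrow> f differentiable (at x)"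
  unfolding smooth_on_def using Ck_on.simps(2) by blast

lemma smooth_on_continuous_on: "smooth_on S f \<Longrightarrow> continuous_on S f"
  unfolding smooth_on_def using Ck_on.simps(1) by blast

lemma smooth_on_frechet_derivative:
  "smooth_on S f \<Longrightarrow> smooth_on S (\<lambda>x. frechet_derivative f (at x) v)"
  unfolding smooth_on_def using Ck_on.simps(2) by blast

lemma has_derivative_frechet_eq: "(f has_derivative f') (at x) \<Longrightarrow> frechet_derivative f (at x) v = f' v"
  using frechet_derivative_at by metis

lemma smooth_on_has_derivative:
  "smooth_on S f \<Longrightarrow> x \<in> S \<Longrightarrow> (f has_derivative frechet_derivative f (at x)) (at x)"
  using smooth_on_differentiable frechet_derivative_works by blast

text \<open>Membership in \<open>Ck_on\<close> is a germ-local property, for arbitrary \<open>S\<close>, because derivatives are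
  taken with respect to the full neighbourhood filter.\<close>

lemma Ck_on_local:
  assumes "\<And>x. x \<in> S \<Longrightarrow> \<exists>U g. open U \<and> x \<in> U \<and> Ck_on k U g \<and> (\<forall>y\<in>U. g y = f y)"
  shows "Ck_on k S f"
  using assms
proof (induction k arbitrary: f)
  case 0
  have "continuous (at x) f" if "x \<in> S" for x
  proof -
    obtain U g where U: "open U" "x \<in> U" "continuous_on U g" "\<forall>y\<in>U. g y = f y"
      using 0[OF \<open>x \<in> S\<close>] by auto
    then have "continuous_on U f" by (metis continuous_on_cong)
    then show ?thesis using U continuous_on_eq_continuous_at by blast
  qed
  then show ?case by (simp add: continuous_at_imp_continuous_on)
next
  case (Suc k)
  have *: "f differentiable (at x) \<and> (\<forall>v. \<exists>U g. open U \<and> x \<in> U \<and> Ck_on k U g \<and>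
       (\<forall>y\<in>U. g y = frechet_derivative f (at y) v))" if "x \<in> S" for x
  proof -
    obtain U g where U: "open U" "x \<in> U" "Ck_on (Suc k) U g" "\<forall>y\<in>U. g y = f y"
      using Suc.prems[OF \<open>x \<in> S\<close>] by auto
    have d: "(f has_derivative frechet_derivative g (at y)) (at y)" if "y \<in> U" for y
    proof -
      have "g differentiable (at y)" using U(3) that by auto
      then have "(g has_derivative frechet_derivative g (at y)) (at y)"
        using frechet_derivative_works by blast
      then show ?thesis
        by (rule has_derivative_transform_within_open[OF _ U(1) that]) (use U(4) in auto)
    qed
    have "f differentiable (at x)" using d[OF U(2)] by (auto simp: differentiable_def)
    moreover have "frechet_derivative g (at y) v = frechet_derivative f (at y) v" if "y \<in> U" for y v
      using has_derivative_frechet_eq[OF d[OF that]] by metis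
    moreover have "Ck_on k U (\<lambda>y. frechet_derivative g (at y) v)" for v
      using U(3) by auto
    ultimately show ?thesis using U(1,2) by (metis (no_types, lifting))
  qed
  have "Ck_on k S (\<lambda>x. frechet_derivative f (at x) v)" for v
    by (rule Suc.IH) (use * in blast)
  then show ?case using * by simp
qed

lemma smooth_on_local:
  assumes "\<And>x. x \<in> S \<Longrightarrow> \<exists>U g. open U \<and> x \<in> U \<and> smooth_on U g \<and> (\<forall>y\<in>U. g y = f y)"
  shows "smooth_on S f"
  unfolding smooth_on_def
proof (intro allI Ck_on_local)
  fix k x assume "x \<in> S"
  then obtain U g where "open U" "x \<in> U" "smooth_on U g" "\<forall>y\<in>U. g y = f y"
    using assms by blast
  then show "\<exists>U g. open U \<and> x \<in> U \<and> Ck_on k U g \<and> (\<forall>y\<in>U. g y = f y)"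
    unfolding smooth_on_def by blast
qed

lemma Ck_on_cong:
  "open S \<Longrightarrow> (\<And>x. x \<in> S \<Longrightarrow> f x = g x) \<Longrightarrow> Ck_on k S g \<Longrightarrow> Ck_on k S f"
  by (rule Ck_on_local) metis

lemma smooth_on_cong:
  "open S \<Longrightarrow> (\<And>x. x \<in> S \<Longrightarrow> f x = g x) \<Longrightarrow> smooth_on S g \<Longrightarrow> smooth_on S f"
  unfolding smooth_on_def by (blast intro: Ck_on_cong)

lemma Ck_on_SucI:
  assumes "open S" "\<And>x. x \<in> S \<Longrightarrow> (f has_derivative f' x) (at x)" "\<And>v. Ck_on k S (\<lambda>x. f' x v)"
  shows "Ck_on (Suc k) S f"
  using assms
  by (auto simp: differentiable_def intro!: Ck_on_cong[OF assms(1) _ assms(3)] has_derivative_frechet_eq)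

lemma Ck_on_const: "Ck_on k S (\<lambda>_. c)"
proof (induction k arbitrary: c)
  case (Suc k)
  then show ?case by (auto simp: frechet_derivative_const)
qed auto

lemma smooth_on_const [intro!]: "smooth_on S (\<lambda>_. c)"
  by (simp add: smooth_on_def Ck_on_const)

lemma smooth_on_bounded_linear:
  assumes "bounded_linear L" shows "smooth_on S L"
proof -
  have "Ck_on k S L" for k
  proof (cases k)
    case 0
    then show ?thesis using assms by (simp add: linear_continuous_on)
  next
    case (Suc j)
    have "frechet_derivative L (at x) v = L v" for x v
      by (rule has_derivative_frechet_eq[OF bounded_linear_imp_has_derivative[OF assms]])
    then show ?thesis
      using Suc bounded_linear_imp_has_derivative[OF assms] by (auto simp: differentiable_def Ck_on_const)
  qed
  then show ?thesis by (simp add: smooth_on_def)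
qed

lemma Ck_on_linear_comp:
  assumes "bounded_linear L" "open S"
  shows "Ck_on k S f \<Longrightarrow> Ck_on k S (\<lambda>x. L (f x))"
proof (induction k arbitrary: f)
  case 0
  then show ?case
    using bounded_linear.continuous_on[OF assms(1)] by auto
next
  case (Suc k)
  show ?case
  proof (rule Ck_on_SucI[OF assms(2)])
    fix x assume "x \<in> S"
    then have "(f has_derivative frechet_derivative f (at x)) (at x)"
      using Ck_on_Suc_has_derivative[OF Suc.prems] by blast
    then show "((\<lambda>x. L (f x)) has_derivative (\<lambda>v. L (frechet_derivative f (at x) v))) (at x)"
      by (rule bounded_linear.has_derivative[OF assms(1)])
  qed (use Suc in auto)
qed

lemma smooth_on_linear_comp:
  "bounded_linear L \<Longrightarrow> open S \<Longrightarrow> smooth_on S f \<Longrightarrow> smooth_on S (\<lambda>x. L (f x))"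
  unfolding smooth_on_def by (blast intro: Ck_on_linear_comp)

lemma Ck_on_add:
  assumes "open S"
  shows "Ck_on k S f \<Longrightarrow> Ck_on k S g \<Longrightarrow> Ck_on k S (\<lambda>x. f x + g x)"
proof (induction k arbitrary: f g)
  case 0
  then show ?case by (auto intro: continuous_on_add)
next
  case (Suc k)
  show ?case
  proof (rule Ck_on_SucI[OF assms(1)])
    fix x assume "x \<in> S"
    then show "((\<lambda>x. f x + g x) has_derivative
        (\<lambda>v. frechet_derivative f (at x) v + frechet_derivative g (at x) v)) (at x)"
      by (intro has_derivative_add Suc.prems[THEN Ck_on_Suc_has_derivative])
  qed (use Suc in auto)
qed

lemma smooth_on_add:
  "open S \<Longrightarrow> smooth_on S f \<Longrightarrow> smooth_on S g \<Longrightarrow> smooth_on S (\<lambda>x. f x + g x)"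
  unfolding smooth_on_def by (blast intro: Ck_on_add)

lemma smooth_on_uminus: "open S \<Longrightarrow> smooth_on S f \<Longrightarrow> smooth_on S (\<lambda>x. - f x)"
  by (rule smooth_on_linear_comp) (auto intro: bounded_linear_minus bounded_linear_ident)

lemma smooth_on_diff:
  "open S \<Longrightarrow> smooth_on S f \<Longrightarrow> smooth_on S g \<Longrightarrow> smooth_on S (\<lambda>x. f x - g x)"
  using smooth_on_add[of S f "\<lambda>x. - g x"] smooth_on_uminus by auto

lemma Ck_on_scaleR:
  assumes "open S"
  shows "Ck_on k S f \<Longrightarrow> Ck_on k S g \<Longrightarrow> Ck_on k S (\<lambda>x. f x *\<^sub>R g x)"
proof (induction k arbitrary: f g)
  case 0
  then show ?case by (auto intro: continuous_on_scaleR)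
next
  case (Suc k)
  note f = Ck_on_Suc_imp[OF Suc.prems(1)] and g = Ck_on_Suc_imp[OF Suc.prems(2)]
  show ?case
  proof (rule Ck_on_SucI[OF assms(1)])
    fix x assume "x \<in> S"
    then show "((\<lambda>x. f x *\<^sub>R g x) has_derivative
        (\<lambda>v. f x *\<^sub>R frechet_derivative g (at x) v + frechet_derivative f (at x) v *\<^sub>R g x)) (at x)"
      by (intro has_derivative_scaleR Suc.prems[THEN Ck_on_Suc_has_derivative])
  next
    fix v show "Ck_on k S (\<lambda>x. f x *\<^sub>R frechet_derivative g (at x) v + frechet_derivative f (at x) v *\<^sub>R g x)"
      using Suc.prems f g by (intro Ck_on_add[OF assms] Suc.IH) auto
  qed
qed

lemma smooth_on_scaleR:
  "open S \<Longrightarrow> smooth_on S f \<Longrightarrow> smooth_on S g \<Longrightarrow> smooth_on S (\<lambda>x. f x *\<^sub>R g x)"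
  unfolding smooth_on_def by (blast intro: Ck_on_scaleR)

lemma smooth_on_mult:
  fixes f g :: "'a::real_normed_vector \<Rightarrow> real"
  shows "open S \<Longrightarrow> smooth_on S f \<Longrightarrow> smooth_on S g \<Longrightarrow> smooth_on S (\<lambda>x. f x * g x)"
  using smooth_on_scaleR[of S f g] by simp

lemma Ck_on_inverse:
  fixes f :: "'a::real_normed_vector \<Rightarrow> real"
  assumes "open S" "\<And>x. x \<in> S \<Longrightarrow> f x \<noteq> 0"
  shows "Ck_on k S f \<Longrightarrow> Ck_on k S (\<lambda>x. inverse (f x))"
proof (induction k)
  case 0
  then show ?case using assms by (auto intro: continuous_on_inverse)
next
  case (Suc k)
  note i = Suc.IH[OF Ck_on_Suc_imp[OF Suc.prems]]
  show ?case
  proof (rule Ck_on_SucI[OF assms(1)])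
    fix x assume x: "x \<in> S"
    have "(f has_derivative frechet_derivative f (at x)) (at x)"
      by (rule Ck_on_Suc_has_derivative[OF Suc.prems x])
    then show "((\<lambda>x. inverse (f x)) has_derivative
        (\<lambda>v. inverse (f x) *\<^sub>R (inverse (f x) *\<^sub>R ((-1) *\<^sub>R frechet_derivative f (at x) v)))) (at x)"
      using assms(2)[OF x] by (auto intro!: derivative_eq_intros simp: algebra_simps)
  next
    fix v show "Ck_on k S (\<lambda>x. inverse (f x) *\<^sub>R (inverse (f x) *\<^sub>R ((-1) *\<^sub>R frechet_derivative f (at x) v)))"
      using Suc.prems i by (intro Ck_on_scaleR[OF assms(1)] Ck_on_const) auto
  qed
qed

lemma smooth_on_inverse:
  fixes f :: "'a::real_normed_vector \<Rightarrow> real"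
  shows "open S \<Longrightarrow> (\<And>x. x \<in> S \<Longrightarrow> f x \<noteq> 0) \<Longrightarrow> smooth_on S f \<Longrightarrow> smooth_on S (\<lambda>x. inverse (f x))"
  unfolding smooth_on_def by (blast intro: Ck_on_inverse)

lemma Ck_on_sum:
  assumes "open S" "finite I" "\<And>i. i \<in> I \<Longrightarrow> Ck_on k S (f i)"
  shows "Ck_on k S (\<lambda>x. \<Sum>i\<in>I. f i x)"
  using assms(2,3)
  by (induction I rule: finite_induct) (auto intro!: Ck_on_add assms(1) Ck_on_const)

lemma Ck_on_compose:
  fixes f :: "'a::real_normed_vector \<Rightarrow> 'b::euclidean_space" and g :: "'b \<Rightarrow> 'c::real_normed_vector"
  assumes "open S" "f ` S \<subseteq> T"
  shows "Ck_on k S f \<Longrightarrow> Ck_on k T g \<Longrightarrow> Ck_on k S (\<lambda>x. g (f x))"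
proof (induction k arbitrary: g)
  case 0
  then show ?case using assms(2) by (auto intro: continuous_on_compose2)
next
  case (Suc k)
  note f = Ck_on_Suc_imp[OF Suc.prems(1)]
  let ?f' = "\<lambda>x. frechet_derivative f (at x)" and ?g' = "\<lambda>x. frechet_derivative g (at x)"
  show ?case
  proof (rule Ck_on_SucI[OF assms(1)])
    fix x assume x: "x \<in> S"
    have f': "(f has_derivative ?f' x) (at x)"
      by (rule Ck_on_Suc_has_derivative[OF Suc.prems(1) x])
    have g': "(g has_derivative ?g' (f x)) (at (f x))"
      using Ck_on_Suc_has_derivative[OF Suc.prems(2)] x assms(2) by blast
    interpret g': bounded_linear "?g' (f x)" using g' by (rule has_derivative_bounded_linear)
    \<comment> \<open>\<open>Ck_on\<close> speaks of derivatives in one fixed direction, but here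
      the direction \<open>?f' x v\<close> varies with x. Expanding it in the basis leaves fixed
      directions i with scalar coefficients.\<close>
    have *: "?g' (f x) w = (\<Sum>i\<in>Basis. (w \<bullet> i) *\<^sub>R ?g' (f x) i)" for w
      by (subst (1) euclidean_representation[of w, symmetric]) (simp add: g'.sum g'.scaleR)
    have "((\<lambda>x. g (f x)) has_derivative (\<lambda>v. ?g' (f x) (?f' x v))) (at x)"
      using has_derivative_compose[OF f' g'] by simp
    then show "((\<lambda>x. g (f x)) has_derivative (\<lambda>v. \<Sum>i\<in>Basis. (?f' x v \<bullet> i) *\<^sub>R ?g' (f x) i)) (at x)"
      by (subst (asm) *)
  next
    fix v
    show "Ck_on k S (\<lambda>x. \<Sum>i\<in>Basis. (?f' x v \<bullet> i) *\<^sub>R ?g' (f x) i)"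
    proof (intro Ck_on_sum[OF assms(1)] Ck_on_scaleR[OF assms(1)] finite_Basis)
      fix i :: 'b assume "i \<in> Basis"
      show "Ck_on k S (\<lambda>x. ?f' x v \<bullet> i)"
        using Suc.prems(1) by (intro Ck_on_linear_comp[OF bounded_linear_inner_left assms(1)]) auto
      show "Ck_on k S (\<lambda>x. ?g' (f x) i)"
        using Suc.prems(2) by (intro Suc.IH[OF f]) auto
    qed
  qed
qed

lemma smooth_on_compose:
  fixes f :: "'a::real_normed_vector \<Rightarrow> 'b::euclidean_space" and g :: "'b \<Rightarrow> 'c::real_normed_vector"
  shows "open S \<Longrightarrow> f ` S \<subseteq> T \<Longrightarrow> smooth_on S f \<Longrightarrow> smooth_on T g \<Longrightarrow> smooth_on S (\<lambda>x. g (f x))"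
  unfolding smooth_on_def by (blast intro: Ck_on_compose)

lemma smooth_on_Pair:
  assumes "open S" "smooth_on S f" "smooth_on S g" shows "smooth_on S (\<lambda>x. (f x, g x))"
proof -
  have "smooth_on S (\<lambda>x. (f x, 0) + (0, g x))"
    using assms
    by (intro smooth_on_add smooth_on_linear_comp[of "\<lambda>x. (x, 0)"] smooth_on_linear_comp[of "\<lambda>x. (0, x)"])
      (auto intro!: bounded_linear_Pair bounded_linear_ident bounded_linear_zero)
  then show ?thesis by simp
qed

text \<open>The real derivative in direction v is multiplication of v by \<open>deriv f x\<close>,
  and \<open>deriv f\<close> is holomorphic again, so the induction closes.\<close>

lemma smooth_on_holomorphic:
  assumes "open S" "f holomorphic_on S" shows "smooth_on S f"
proof -
  have "Ck_on k S f" for k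
    using assms(2)
  proof (induction k arbitrary: f)
    case 0
    then show ?case by (auto intro: holomorphic_on_imp_continuous_on)
  next
    case (Suc k)
    show ?case
    proof (rule Ck_on_SucI[OF assms(1)])
      fix x assume "x \<in> S"
      then show "(f has_derivative (\<lambda>v. deriv f x * v)) (at x)"
        using holomorphic_derivI[OF Suc.prems assms(1)] by (simp add: has_field_derivative_def)
    next
      fix v show "Ck_on k S (\<lambda>x. deriv f x * v)"
        by (rule Ck_on_linear_comp[OF bounded_linear_mult_left assms(1) Suc.IH[OF holomorphic_deriv[OF Suc.prems assms(1)]]])
    qed
  qed
  then show ?thesis by (simp add: smooth_on_def)
qed

section \<open>Smooth cut-off functions on the line\<close>

definition flat_exp :: "nat \<Rightarrow> real \<Rightarrow> real" where
  "flat_exp m x = (if x > 0 then exp (- 1 / x) / x ^ m else 0)"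

lemma flat_exp_tendsto_0: "(flat_exp m \<longlongrightarrow> 0) (at 0)"
proof -
  have "((\<lambda>x. exp (- 1 / x) / x ^ m) \<longlongrightarrow> (0::real)) (at_right 0)"
  proof -
    have "((\<lambda>y::real. y ^ m / exp y) \<longlongrightarrow> 0) at_top" by (rule tendsto_power_div_exp_0)
    then have "((\<lambda>x. (inverse x) ^ m / exp (inverse x)) \<longlongrightarrow> (0::real)) (at_right 0)"
      using filterlim_compose filterlim_inverse_at_top_right by blast
    then show ?thesis
      by (simp add: exp_minus divide_simps inverse_eq_divide mult.commute flip: power_inverse)
  qed
  then have r: "(flat_exp m \<longlongrightarrow> 0) (at_right 0)"
    by (rule tendsto_cong[THEN iffD1, rotated]) (auto simp: eventually_at_right_field flat_exp_def intro!: exI[of _ 1])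
  have l: "(flat_exp m \<longlongrightarrow> 0) (at_left 0)"
    by (rule tendsto_eventually) (auto simp: eventually_at_left_field flat_exp_def intro!: exI[of _ "-1"])
  show ?thesis using l r by (simp add: filterlim_split_at)
qed

text \<open>This is why the denominators x ^ m are carried along: up to linear combinations the
  family is closed under differentiation, at 0 as well.\<close>

lemma flat_exp_has_derivative:
  "(flat_exp m has_real_derivative (flat_exp (m + 2) x - m * flat_exp (m + 1) x)) (at x)"
proof -
  consider "x > 0" | "x < 0" | "x = 0" by linarith
  then show ?thesis
  proof cases
    case 1
    have "((\<lambda>x. exp (- 1 / x) / x ^ m) has_real_derivative (flat_exp (m + 2) x - m * flat_exp (m + 1) x)) (at x)"
      using 1 power_minus_mult[of m x]
      by (cases "m = 0") (auto intro!: derivative_eq_intros simp: flat_exp_def field_simps power2_eq_square)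
    then show ?thesis
      by (rule has_field_derivative_transform_within_open[of _ _ _ "{0<..}"]) (use 1 in \<open>auto simp: flat_exp_def\<close>)
  next
    case 2
    have "((\<lambda>x. 0) has_real_derivative (flat_exp (m + 2) x - m * flat_exp (m + 1) x)) (at x)"
      using 2 by (auto simp: flat_exp_def)
    then show ?thesis
      by (rule has_field_derivative_transform_within_open[of _ _ _ "{..<0}"]) (use 2 in \<open>auto simp: flat_exp_def\<close>)
  next
    case 3
    \<comment> \<open>The difference quotient at 0 is the next member of the family, whose limit is
      already known.\<close>
    have "(\<lambda>h. (flat_exp m (0 + h) - flat_exp m 0) / h) = flat_exp (m + 1)"
      by (auto simp: flat_exp_def fun_eq_iff)
    then have "(flat_exp m has_real_derivative 0) (at 0)"
      using flat_exp_tendsto_0[of "m + 1"] by (simp add: DERIV_def)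
    then show ?thesis using 3 by (simp add: flat_exp_def)
  qed
qed

lemma smooth_on_flat_exp: "smooth_on UNIV (flat_exp m)"
proof -
  have "Ck_on k UNIV (flat_exp m)" for k
  proof (induction k arbitrary: m)
    case 0
    then show ?case
      by (simp add: continuous_at_imp_continuous_on DERIV_isCont[OF flat_exp_has_derivative])
  next
    case (Suc k)
    show ?case
    proof (rule Ck_on_SucI[OF open_UNIV])
      fix x
      show "(flat_exp m has_derivative
          (\<lambda>v. v *\<^sub>R (flat_exp (m + 2) x + (- real m) *\<^sub>R flat_exp (m + 1) x))) (at x)"
        using flat_exp_has_derivative[of m x] unfolding has_field_derivative_def
        by (rule has_derivative_eq_rhs) (simp add: fun_eq_iff algebra_simps)
    next
      fix v show "Ck_on k UNIV (\<lambda>x. v *\<^sub>R (flat_exp (m + 2) x + (- real m) *\<^sub>R flat_exp (m + 1) x))"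
        by (intro Ck_on_scaleR Ck_on_add Ck_on_const Suc.IH open_UNIV)
    qed
  qed
  then show ?thesis by (simp add: smooth_on_def)
qed

definition smooth_step :: "real \<Rightarrow> real" where
  "smooth_step x = flat_exp 0 x * inverse (flat_exp 0 x + flat_exp 0 (1 - x))"

lemma smooth_step_0: "x \<le> 0 \<Longrightarrow> smooth_step x = 0"
  by (simp add: smooth_step_def flat_exp_def)

lemma smooth_step_1: "x \<ge> 1 \<Longrightarrow> smooth_step x = 1"
  by (simp add: smooth_step_def flat_exp_def)

lemma flat_exp_sum_pos: "flat_exp 0 x + flat_exp 0 (1 - x) > 0"
  by (auto simp: flat_exp_def add_pos_pos)

lemma smooth_on_step: "smooth_on UNIV smooth_step"
proof -
  have "smooth_on UNIV (\<lambda>x. flat_exp 0 (1 - x))"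
    by (rule smooth_on_compose[OF open_UNIV _ _ smooth_on_flat_exp])
      (auto intro!: smooth_on_diff smooth_on_bounded_linear[OF bounded_linear_ident])
  then show ?thesis
    unfolding smooth_step_def using flat_exp_sum_pos
    by (intro smooth_on_mult smooth_on_inverse smooth_on_add smooth_on_flat_exp open_UNIV)
      (auto simp: less_le)
qed

section \<open>Locally graph-like Lagrangian sets\<close>

text \<open>Sheets are separated by an additional real coordinate, so that an immersed Lagrangian becomes
  an embedded subset of \<open>\<real> \<times> \<real>\<^sup>n \<times> \<real>\<^sup>n\<close>. The affine left inverse \<open>\<Lambda>\<close> makes every chart
  an immersion and makes all transition maps smooth.\<close>

definition lag_chart ::
  "(real^'n::finite) set \<Rightarrow> (real^'n \<Rightarrow> (real^'n) \<times> (real^'n)) \<Rightarrow> (real^'n \<Rightarrow> real) \<Rightarrow>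
   ((real^'n) \<times> (real^'n) \<Rightarrow> real^'n) \<Rightarrow> real^'n \<Rightarrow> bool" where
  "lag_chart B F lb \<Lambda> c \<longleftrightarrow>
     open B \<and> smooth_on B F \<and> continuous_on B lb \<and> bounded_linear \<Lambda> \<and>
     (\<forall>\<xi>\<in>B. \<Lambda> (F \<xi>) + c = \<xi>) \<and>
     (\<forall>\<xi>\<in>B. \<forall>a b. symp (frechet_derivative F (at \<xi>) a) (frechet_derivative F (at \<xi>) b) = 0)"

definition lag_graph :: "(real \<times> (real^'n::finite) \<times> (real^'n)) set \<Rightarrow> bool" where
  "lag_graph Y \<longleftrightarrow> (\<exists>B F lb \<Lambda> c. lag_chart B F lb \<Lambda> c \<and> Y = (\<lambda>\<xi>. (lb \<xi>, F \<xi>)) ` B)"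

text \<open>The first alternative is included so that a set with this property at every point is closed.\<close>

definition local_lag ::
  "(real \<times> (real^'n::finite) \<times> (real^'n)) set \<Rightarrow> real \<times> (real^'n) \<times> (real^'n) \<Rightarrow> bool" where
  "local_lag Y x \<longleftrightarrow>
     (\<exists>N. open N \<and> x \<in> N \<and> (Y \<inter> N = {} \<or> x \<in> Y \<and> lag_graph (Y \<inter> N)))"

lemma lag_chart_subset:
  "lag_chart B F lb \<Lambda> c \<Longrightarrow> open B' \<Longrightarrow> B' \<subseteq> B \<Longrightarrow> lag_chart B' F lb \<Lambda> c"
  unfolding lag_chart_def by (meson smooth_on_subset continuous_on_subset subsetD)

lemma lag_chart_image_Int:
  assumes "lag_chart B F lb \<Lambda> c" "open N"
  defines "B' \<equiv> {\<xi>\<in>B. (lb \<xi>, F \<xi>) \<in> N}"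
  shows "lag_chart B' F lb \<Lambda> c" "(\<lambda>\<xi>. (lb \<xi>, F \<xi>)) ` B' = (\<lambda>\<xi>. (lb \<xi>, F \<xi>)) ` B \<inter> N"
proof -
  have "continuous_on B (\<lambda>\<xi>. (lb \<xi>, F \<xi>))"
    using assms(1) smooth_on_continuous_on[of B F] unfolding lag_chart_def
    by (auto intro: continuous_on_Pair)
  moreover have "open B" using assms(1) by (simp add: lag_chart_def)
  ultimately have "open ((\<lambda>\<xi>. (lb \<xi>, F \<xi>)) -` N \<inter> B)"
    using \<open>open N\<close> continuous_on_open_vimage by blast
  moreover have "B' = (\<lambda>\<xi>. (lb \<xi>, F \<xi>)) -` N \<inter> B" by (auto simp: B'_def)
  ultimately have "open B'" by simp
  then show "lag_chart B' F lb \<Lambda> c"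
    by (rule lag_chart_subset[OF assms(1)]) (auto simp: B'_def)
qed (auto simp: B'_def)

lemma lag_graph_Int: "lag_graph Y \<Longrightarrow> open N \<Longrightarrow> lag_graph (Y \<inter> N)"
  unfolding lag_graph_def by (elim exE conjE) (use lag_chart_image_Int in blast)

text \<open>The gluing rule: a set patched together from pieces is checked near each point against
  the one piece that it equals there.\<close>

lemma local_lag_cong:
  assumes "local_lag Y' x" "open U" "x \<in> U" "Y \<inter> U = Y' \<inter> U"
  shows "local_lag Y x"
proof -
  obtain N where N: "open N" "x \<in> N" "Y' \<inter> N = {} \<or> x \<in> Y' \<and> lag_graph (Y' \<inter> N)"
    using assms(1) by (auto simp: local_lag_def)
  have eq: "Y \<inter> (N \<inter> U) = Y' \<inter> N \<inter> U"
  proof -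
    have "Y \<inter> (N \<inter> U) = (Y \<inter> U) \<inter> N" by blast
    also have "\<dots> = (Y' \<inter> U) \<inter> N" by (simp only: assms(4))
    finally show ?thesis by blast
  qed
  have "Y \<inter> (N \<inter> U) = {} \<or> x \<in> Y \<and> lag_graph (Y \<inter> (N \<inter> U))"
    using N(3)
  proof
    assume a: "x \<in> Y' \<and> lag_graph (Y' \<inter> N)"
    then have "lag_graph (Y \<inter> (N \<inter> U))" unfolding eq by (intro lag_graph_Int[OF _ assms(2)]) blast
    moreover have "x \<in> Y" using a assms(3,4) by (metis IntD1 IntI)
    ultimately show ?thesis by simp
  qed (simp add: eq)
  moreover have "open (N \<inter> U)" "x \<in> N \<inter> U" using N(1,2) assms(2,3) by auto
  ultimately show ?thesis unfolding local_lag_def by meson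
qed

lemma local_lag_empty: "open U \<Longrightarrow> x \<in> U \<Longrightarrow> Y \<inter> U = {} \<Longrightarrow> local_lag Y x"
  unfolding local_lag_def by blast

lemma local_lag_outside: "closed Y \<Longrightarrow> x \<notin> Y \<Longrightarrow> local_lag Y x"
  by (rule local_lag_empty[of "- Y"]) (simp_all add: open_Compl)

lemma local_lag_outsideD:
  assumes "local_lag Y x" "x \<notin> Y" shows "\<exists>U. open U \<and> x \<in> U \<and> Y \<inter> U = {}"
  using assms unfolding local_lag_def by blast

lemma local_lag_closed:
  assumes "\<And>x. local_lag Y x" shows "closed Y"
proof -
  have "\<exists>U. open U \<and> x \<in> U \<and> U \<subseteq> - Y" if "x \<notin> Y" for x
    using local_lag_outsideD[OF assms that] by (elim ex_forward) blast
  then have "open (- Y)" by (subst open_subopen) blast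
  then show ?thesis by (simp add: closed_def)
qed

text \<open>A piece that misses x has a whole neighbourhood of x missing it, by the first
  alternative of \<open>local_lag\<close>. Finitely many such neighbourhoods intersect in one where
  at most one piece survives.\<close>

lemma local_lag_UN:
  assumes "finite K" "\<And>k. k \<in> K \<Longrightarrow> local_lag (Y k) x"
    and "\<And>j k. j \<in> K \<Longrightarrow> k \<in> K \<Longrightarrow> j \<noteq> k \<Longrightarrow> x \<notin> Y j \<or> x \<notin> Y k"
  shows "local_lag (\<Union>k\<in>K. Y k) x"
proof -
  define K0 where "K0 = {k\<in>K. x \<notin> Y k}"
  have "\<exists>U. open U \<and> x \<in> U \<and> Y k \<inter> U = {}" if "k \<in> K0" for k
    by (rule local_lag_outsideD) (use that assms(2) in \<open>auto simp: K0_def\<close>)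
  then obtain U where U: "\<And>k. k \<in> K0 \<Longrightarrow> open (U k) \<and> x \<in> U k \<and> Y k \<inter> U k = {}" by metis
  define W where "W = (\<Inter>k\<in>K0. U k)"
  have W: "open W" "x \<in> W" "\<And>k. k \<in> K0 \<Longrightarrow> Y k \<inter> W = {}"
    using U assms(1) by (auto simp: W_def K0_def intro!: open_INT)
  show ?thesis
  proof (cases "K0 = K")
    case True
    then show ?thesis using W by (intro local_lag_empty[of W]) auto
  next
    case False
    then obtain k where k: "k \<in> K" "x \<in> Y k" by (auto simp: K0_def)
    have "K = insert k K0" using k assms(3) by (auto simp: K0_def)
    then have "(\<Union>k\<in>K. Y k) \<inter> W = Y k \<inter> W" using W(3) by auto
    then show ?thesis using local_lag_cong[OF assms(2)[OF k(1)] W(1,2)] by blast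
  qed
qed

lemma lag_graphI:
  fixes F :: "real^'n::finite \<Rightarrow> (real^'n) \<times> (real^'n)"
  assumes "open B" "smooth_on B F" "continuous_on B lb" "bounded_linear \<Lambda>"
    and "\<And>\<xi>. \<xi> \<in> B \<Longrightarrow> \<Lambda> (F \<xi>) + c = \<xi>"
    and "\<And>\<xi>. \<xi> \<in> B \<Longrightarrow> (F has_derivative F' \<xi>) (at \<xi>)"
    and "\<And>\<xi> a b. \<xi> \<in> B \<Longrightarrow> symp (F' \<xi> a) (F' \<xi> b) = 0"
    and "Y = (\<lambda>\<xi>. (lb \<xi>, F \<xi>)) ` B"
  shows "lag_graph Y"
proof -
  have "lag_chart B F lb \<Lambda> c"
    unfolding lag_chart_def using assms has_derivative_frechet_eq[OF assms(6)] by simp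
  then show ?thesis unfolding lag_graph_def using assms(8) by blast
qed

text \<open>The choice \<open>e = -1\<close> is an antisymplectic reflection, and scaling \<open>p\<close> is conformally symplectic.\<close>

lemma local_lag_transform:
  fixes \<sigma> v :: "real^'n::finite" and h :: "real^'n \<Rightarrow> real"
  assumes "local_lag Y (l, q, p)" "\<epsilon> \<noteq> 0" "e = 1 \<or> e = (-1::real)" "continuous_on UNIV h"
  shows "local_lag ((\<lambda>(l, q, p). (l + h p, e *\<^sub>R q + \<sigma>, \<epsilon> *\<^sub>R p + v)) ` Y)
           (l + h p, e *\<^sub>R q + \<sigma>, \<epsilon> *\<^sub>R p + v)"
proof -
  define \<Phi> :: "real \<times> (real^'n) \<times> (real^'n) \<Rightarrow> real \<times> (real^'n) \<times> (real^'n)"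
    where "\<Phi> = (\<lambda>(l, q, p). (l + h p, e *\<^sub>R q + \<sigma>, \<epsilon> *\<^sub>R p + v))"
  define \<Psi> :: "real \<times> (real^'n) \<times> (real^'n) \<Rightarrow> real \<times> (real^'n) \<times> (real^'n)"
    where "\<Psi> = (\<lambda>(l, q, p). (l - h ((1/\<epsilon>) *\<^sub>R (p - v)), e *\<^sub>R (q - \<sigma>), (1/\<epsilon>) *\<^sub>R (p - v)))"
  have ee: "e * e = 1" using assms(3) by auto
  have \<Psi>\<Phi>: "\<Psi> (\<Phi> x) = x" for x
    using assms(2) ee by (simp add: \<Phi>_def \<Psi>_def split: prod.splits)
  have \<Phi>\<Psi>: "\<Phi> (\<Psi> x) = x" for x
    using assms(2) ee by (simp add: \<Phi>_def \<Psi>_def split: prod.splits)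
  have h_comp: "continuous_on S (\<lambda>x. h (f x))" if "continuous_on S f" for f :: "'z::topological_space \<Rightarrow> _" and S
    using assms(4) that by (rule continuous_on_compose2) auto
  have c\<Psi>: "continuous_on UNIV \<Psi>"
    unfolding \<Psi>_def case_prod_beta by (intro continuous_intros h_comp)
  have img: "\<Phi> ` A = \<Psi> -` A" for A
  proof (intro equalityI subsetI)
    fix x assume "x \<in> \<Psi> -` A"
    then have "\<Phi> (\<Psi> x) \<in> \<Phi> ` A" by blast
    then show "x \<in> \<Phi> ` A" by (simp only: \<Phi>\<Psi>)
  qed (use \<Psi>\<Phi> in force)
  obtain N where N: "open N" "(l, q, p) \<in> N" "Y \<inter> N = {} \<or> (l, q, p) \<in> Y \<and> lag_graph (Y \<inter> N)"
    using assms(1) by (auto simp: local_lag_def)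
  have oN: "open (\<Phi> ` N)"
    unfolding img using c\<Psi> N(1) continuous_on_open_vimage[of UNIV \<Psi>] by auto
  have int: "\<Phi> ` Y \<inter> \<Phi> ` N = \<Phi> ` (Y \<inter> N)" unfolding img by auto
  have "lag_graph (\<Phi> ` (Y \<inter> N))" if gr: "lag_graph (Y \<inter> N)"
  proof -
    obtain B F lb \<Lambda> c where ch: "lag_chart B F lb \<Lambda> c" and eq: "Y \<inter> N = (\<lambda>\<xi>. (lb \<xi>, F \<xi>)) ` B"
      using gr unfolding lag_graph_def by blast
    have B: "open B" and smF: "smooth_on B F" and bl: "bounded_linear \<Lambda>"
      and inv: "\<And>\<xi>. \<xi> \<in> B \<Longrightarrow> \<Lambda> (F \<xi>) + c = \<xi>"
      using ch by (auto simp: lag_chart_def)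
    \<comment> \<open>\<open>L\<close> is the linear part of the map and \<open>L'\<close> its
      inverse. The new affine left inverse is \<open>\<Lambda>\<close> after \<open>L'\<close>, its
      constant corrected by the image of the translation (\<sigma>, v).\<close>
    define L :: "(real^'n) \<times> (real^'n) \<Rightarrow> (real^'n) \<times> (real^'n)" where "L = (\<lambda>(q, p). (e *\<^sub>R q, \<epsilon> *\<^sub>R p))"
    define L' :: "(real^'n) \<times> (real^'n) \<Rightarrow> (real^'n) \<times> (real^'n)" where "L' = (\<lambda>(q, p). (e *\<^sub>R q, (1/\<epsilon>) *\<^sub>R p))"
    have L: "bounded_linear L" and L': "bounded_linear L'"
      unfolding L_def L'_def case_prod_beta
      by (intro bounded_linear_Pair bounded_linear_scaleR_right[THEN bounded_linear_compose]
          bounded_linear_fst bounded_linear_snd)+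
    have L'L: "L' (L z) = z" for z using assms(2) ee by (simp add: L_def L'_def split: prod.splits)
    interpret bl: bounded_linear \<Lambda> by (rule bl)
    interpret L': bounded_linear L' by (rule L')
    show ?thesis
    proof (rule lag_graphI[where B = B and F = "\<lambda>\<xi>. L (F \<xi>) + (\<sigma>, v)" and lb = "\<lambda>\<xi>. lb \<xi> + h (snd (F \<xi>))"
          and \<Lambda> = "\<lambda>z. \<Lambda> (L' z)" and c = "c - \<Lambda> (L' (\<sigma>, v))"
          and F' = "\<lambda>\<xi> a. L (frechet_derivative F (at \<xi>) a)"])
      show "smooth_on B (\<lambda>\<xi>. L (F \<xi>) + (\<sigma>, v))"
        by (intro smooth_on_add smooth_on_linear_comp[OF L] B smF smooth_on_const)
      show "continuous_on B (\<lambda>\<xi>. lb \<xi> + h (snd (F \<xi>)))"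
        using ch smooth_on_continuous_on[OF smF] by (intro continuous_intros h_comp) (auto simp: lag_chart_def)
      show "bounded_linear (\<lambda>z. \<Lambda> (L' z))" by (rule bounded_linear_compose[OF bl L'])
      show "\<Lambda> (L' (L (F \<xi>) + (\<sigma>, v))) + (c - \<Lambda> (L' (\<sigma>, v))) = \<xi>" if "\<xi> \<in> B" for \<xi>
        using inv[OF that] by (simp add: L'.add bl.add L'L)
      show "((\<lambda>\<xi>. L (F \<xi>) + (\<sigma>, v)) has_derivative (\<lambda>a. L (frechet_derivative F (at \<xi>) a))) (at \<xi>)"
        if "\<xi> \<in> B" for \<xi>
        using bounded_linear.has_derivative[OF L smooth_on_has_derivative[OF smF that]]
        by (auto intro: has_derivative_add_const)
      show "symp (L (frechet_derivative F (at \<xi>) a)) (L (frechet_derivative F (at \<xi>) b)) = 0"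
        if "\<xi> \<in> B" for \<xi> a b
      proof -
        have "symp (L x) (L y) = e * \<epsilon> * symp x y" for x y
          by (simp add: symp_def L_def case_prod_beta algebra_simps)
        moreover have "symp (frechet_derivative F (at \<xi>) a) (frechet_derivative F (at \<xi>) b) = 0"
          using ch that by (auto simp: lag_chart_def)
        ultimately show ?thesis by simp
      qed
      show "\<Phi> ` (Y \<inter> N) = (\<lambda>\<xi>. (lb \<xi> + h (snd (F \<xi>)), L (F \<xi>) + (\<sigma>, v))) ` B"
        unfolding eq image_image by (rule image_cong) (auto simp: \<Phi>_def L_def case_prod_beta)
    qed (rule B)
  qed
  then have "local_lag (\<Phi> ` Y) (\<Phi> (l, q, p))"
    unfolding local_lag_def using N oN int by (intro exI[of _ "\<Phi> ` N"]) auto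
  then show ?thesis by (simp add: \<Phi>_def)
qed

lemma local_lag_transform_all:
  fixes \<sigma> v :: "real^'n::finite" and h :: "real^'n \<Rightarrow> real"
  assumes "\<And>x. local_lag Y x" "\<epsilon> \<noteq> 0" "e = 1 \<or> e = (-1::real)" "continuous_on UNIV h"
  shows "local_lag ((\<lambda>(l, q, p). (l + h p, e *\<^sub>R q + \<sigma>, \<epsilon> *\<^sub>R p + v)) ` Y) x"
proof -
  obtain l q p where x: "x = (l, q, p)" by (cases x)
  have "e * e = 1" using assms(3) by auto
  then show ?thesis
    using local_lag_transform[where l = "l - h ((1/\<epsilon>) *\<^sub>R (p - v))" and q = "e *\<^sub>R (q - \<sigma>)"
        and p = "(1/\<epsilon>) *\<^sub>R (p - v)" and \<sigma> = \<sigma> and v = v, OF assms(1) assms(2-4)]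
      assms(2) by (simp add: x)
qed

text \<open>Moving \<open>q\<close> along the dual vector \<open>A'\<close> replaces its coordinate \<open>q \<bullet> A\<close> by the parameter \<open>t\<close>,
  which turns the set into a graph.\<close>

lemma lag_graph_param:
  fixes A A' B :: "real^'n::finite" and X W Y lb :: "real \<times> real \<Rightarrow> real"
  assumes A': "A' \<bullet> A = 1" "A' \<bullet> B = 0" and D: "open D"
    and sm: "smooth_on D X" "smooth_on D W" "smooth_on D Y" and lb: "continuous_on D lb"
    and left: "\<And>z. z \<in> D \<Longrightarrow> \<mu> * X z + \<nu> * W z + \<gamma> = fst z"
    and iso: "\<And>z h k. z \<in> D \<Longrightarrow>
       frechet_derivative X (at z) h * frechet_derivative W (at z) k
       - frechet_derivative X (at z) k * frechet_derivative W (at z) h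
       + snd h * frechet_derivative Y (at z) k - snd k * frechet_derivative Y (at z) h = 0"
  shows "lag_graph {(lb (t, q \<bullet> B), q, W (t, q \<bullet> B) *\<^sub>R A + Y (t, q \<bullet> B) *\<^sub>R B) | t q.
           (t, q \<bullet> B) \<in> D \<and> q \<bullet> A = X (t, q \<bullet> B)}"
proof -
  define z where "z = (\<lambda>\<xi>::real^'n. (\<xi> \<bullet> A, \<xi> \<bullet> B))"
  have z: "bounded_linear z"
    unfolding z_def by (intro bounded_linear_Pair bounded_linear_inner_left)
  define S where "S = z -` D"
  have S: "open S"
    unfolding S_def using z D by (simp add: linear_continuous_on open_vimage)
  have comp: "smooth_on S (\<lambda>\<xi>. f (z \<xi>))" if "smooth_on D f" for f :: "real \<times> real \<Rightarrow> real"
    by (rule smooth_on_compose[OF S _ smooth_on_bounded_linear[OF z] that]) (auto simp: S_def)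
  have lin: "smooth_on S (\<lambda>\<xi>::real^'n. \<xi> \<bullet> a)" for a
    by (rule smooth_on_bounded_linear[OF bounded_linear_inner_left])
  define F where "F = (\<lambda>\<xi>. (\<xi> + (X (z \<xi>) - \<xi> \<bullet> A) *\<^sub>R A', W (z \<xi>) *\<^sub>R A + Y (z \<xi>) *\<^sub>R B))"
  define X' where "X' = (\<lambda>\<xi> \<eta>. frechet_derivative X (at (z \<xi>)) (z \<eta>))"
  define W' where "W' = (\<lambda>\<xi> \<eta>. frechet_derivative W (at (z \<xi>)) (z \<eta>))"
  define Y' where "Y' = (\<lambda>\<xi> \<eta>. frechet_derivative Y (at (z \<xi>)) (z \<eta>))"
  have der: "((\<lambda>\<xi>. f (z \<xi>)) has_derivative (\<lambda>\<eta>. frechet_derivative f (at (z \<xi>)) (z \<eta>))) (at \<xi>)"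
    if "smooth_on D f" "\<xi> \<in> S" for f :: "real \<times> real \<Rightarrow> real" and \<xi>
    using has_derivative_compose[OF bounded_linear_imp_has_derivative[OF z]
        smooth_on_has_derivative[OF that(1)]] that(2) by (auto simp: S_def)
  have AA': "A \<bullet> A' = 1" "B \<bullet> A' = 0" using A' by (auto simp: inner_commute)
  \<comment> \<open>Along \<open>F\<close> one has fst x \<bullet> A = X and snd x \<bullet> A' = W,
    because A' annihilates B. So the bracket in \<open>\<Lambda>\<close> equals t - \<gamma> - X by
    \<open>left\<close>, and \<open>c\<close> supplies the missing \<gamma>.\<close>
  show ?thesis
  proof (rule lag_graphI[where B = S and F = F and lb = "\<lambda>\<xi>. lb (z \<xi>)" and c = "\<gamma> *\<^sub>R A'"
        and \<Lambda> = "\<lambda>x. fst x + (\<mu> * (fst x \<bullet> A) + \<nu> * (snd x \<bullet> A') - fst x \<bullet> A) *\<^sub>R A'"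
        and F' = "\<lambda>\<xi> \<eta>. (\<eta> + (X' \<xi> \<eta> - \<eta> \<bullet> A) *\<^sub>R A', W' \<xi> \<eta> *\<^sub>R A + Y' \<xi> \<eta> *\<^sub>R B)"])
    show "smooth_on S F"
      unfolding F_def
      by (intro smooth_on_Pair smooth_on_add smooth_on_scaleR smooth_on_diff S comp sm lin
          smooth_on_const smooth_on_bounded_linear[OF bounded_linear_ident])
    have "continuous_on S (\<lambda>\<xi>. z \<xi>)" by (rule linear_continuous_on[OF z])
    then show "continuous_on S (\<lambda>\<xi>. lb (z \<xi>))"
      by (rule continuous_on_compose2[OF lb]) (auto simp: S_def)
    show "bounded_linear (\<lambda>x. fst x + (\<mu> * (fst x \<bullet> A) + \<nu> * (snd x \<bullet> A') - fst x \<bullet> A) *\<^sub>R A')"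
      by (intro bounded_linear_add bounded_linear_sub bounded_linear_fst
          bounded_linear_scaleR_left[THEN bounded_linear_compose]
          bounded_linear_mult_right[THEN bounded_linear_compose]
          bounded_linear_inner_left[THEN bounded_linear_compose] bounded_linear_snd)
    show "fst (F \<xi>) + (\<mu> * (fst (F \<xi>) \<bullet> A) + \<nu> * (snd (F \<xi>) \<bullet> A') - fst (F \<xi>) \<bullet> A) *\<^sub>R A' + \<gamma> *\<^sub>R A' = \<xi>"
      if "\<xi> \<in> S" for \<xi>
    proof -
      have "\<mu> * X (z \<xi>) + \<nu> * W (z \<xi>) + \<gamma> = \<xi> \<bullet> A" using left[of "z \<xi>"] that by (simp add: S_def z_def)
      then have g: "\<gamma> = \<xi> \<bullet> A - \<mu> * X (z \<xi>) - \<nu> * W (z \<xi>)" by simp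
      show ?thesis by (simp add: F_def inner_add_left A' AA' g flip: scaleR_left_distrib)
    qed
    show "(F has_derivative (\<lambda>\<eta>. (\<eta> + (X' \<xi> \<eta> - \<eta> \<bullet> A) *\<^sub>R A', W' \<xi> \<eta> *\<^sub>R A + Y' \<xi> \<eta> *\<^sub>R B))) (at \<xi>)"
      if "\<xi> \<in> S" for \<xi>
      unfolding F_def X'_def W'_def Y'_def
      by (intro has_derivative_Pair has_derivative_add has_derivative_scaleR_left has_derivative_diff
          has_derivative_ident has_derivative_inner_left der sm that)
    show "symp (a + (X' \<xi> a - a \<bullet> A) *\<^sub>R A', W' \<xi> a *\<^sub>R A + Y' \<xi> a *\<^sub>R B)
            (b + (X' \<xi> b - b \<bullet> A) *\<^sub>R A', W' \<xi> b *\<^sub>R A + Y' \<xi> b *\<^sub>R B) = 0" if "\<xi> \<in> S" for \<xi> a b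
      using iso[of "z \<xi>" "z a" "z b"] that
      by (simp add: S_def X'_def W'_def Y'_def symp_def inner_add_left inner_add_right A' AA'
          inner_commute[of A] inner_commute[of B] z_def algebra_simps)
    show "{(lb (t, q \<bullet> B), q, W (t, q \<bullet> B) *\<^sub>R A + Y (t, q \<bullet> B) *\<^sub>R B) | t q.
           (t, q \<bullet> B) \<in> D \<and> q \<bullet> A = X (t, q \<bullet> B)} = (\<lambda>\<xi>. (lb (z \<xi>), F \<xi>)) ` S"
    proof (intro equalityI subsetI)
      fix x assume "x \<in> {(lb (t, q \<bullet> B), q, W (t, q \<bullet> B) *\<^sub>R A + Y (t, q \<bullet> B) *\<^sub>R B) | t q.
           (t, q \<bullet> B) \<in> D \<and> q \<bullet> A = X (t, q \<bullet> B)}"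
      then obtain t q where tq: "x = (lb (t, q \<bullet> B), q, W (t, q \<bullet> B) *\<^sub>R A + Y (t, q \<bullet> B) *\<^sub>R B)"
        "(t, q \<bullet> B) \<in> D" "q \<bullet> A = X (t, q \<bullet> B)" by blast
      define \<xi> where "\<xi> = q + (t - q \<bullet> A) *\<^sub>R A'"
      have z\<xi>: "z \<xi> = (t, q \<bullet> B)" by (simp add: z_def \<xi>_def inner_add_left A')
      then have "\<xi> \<in> S" using tq by (simp add: S_def)
      moreover have "\<xi> \<bullet> A = t" using z\<xi> by (simp add: z_def)
      then have "x = (lb (z \<xi>), F \<xi>)" unfolding F_def z\<xi> by (simp add: tq(1) \<xi>_def tq(3) flip: scaleR_left_distrib)
      ultimately show "x \<in> (\<lambda>\<xi>. (lb (z \<xi>), F \<xi>)) ` S" by blast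
    next
      fix x assume "x \<in> (\<lambda>\<xi>. (lb (z \<xi>), F \<xi>)) ` S"
      then obtain \<xi> where \<xi>: "\<xi> \<in> S" "x = (lb (z \<xi>), F \<xi>)" by blast
      define q where "q = fst (F \<xi>)"
      have q: "q \<bullet> B = \<xi> \<bullet> B" "q \<bullet> A = X (z \<xi>)" by (simp_all add: q_def F_def inner_add_left A')
      then have "z \<xi> = (\<xi> \<bullet> A, q \<bullet> B)" by (simp add: z_def)
      then show "x \<in> {(lb (t, q \<bullet> B), q, W (t, q \<bullet> B) *\<^sub>R A + Y (t, q \<bullet> B) *\<^sub>R B) | t q.
           (t, q \<bullet> B) \<in> D \<and> q \<bullet> A = X (t, q \<bullet> B)}"
        using \<xi> q by (auto simp: S_def q_def F_def intro!: exI[of _ "\<xi> \<bullet> A"] exI[of _ "q"])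
    qed
  qed (rule S)
qed

text \<open>Here q \<bullet> A is prescribed modulo 1 only. The continuous \<tau> recovers t from an
  ambient point, so that membership becomes a condition on a continuous function G: a first entry in
  \<int>, the others 0. Off the set the negation is open; on the set the integer m is locally fixed,
  which reduces to \<open>lag_graph_param\<close> with X + m in place of X. The assumption
  \<open>iso\<close> is dX dW + d\<theta>2 dY = 0 as 2-forms, the pullback of the symplectic
  form.\<close>

lemma local_lag_param:
  fixes A A' B q0 p0 :: "real^'n::finite" and X W Y lb :: "real \<times> real \<Rightarrow> real"
    and \<tau> :: "real \<times> (real^'n) \<times> (real^'n) \<Rightarrow> real"
  assumes A': "A' \<bullet> A = 1" "A' \<bullet> B = 0" and D: "open D"
    and sm: "smooth_on D X" "smooth_on D W" "smooth_on D Y" and lb: "continuous_on D lb"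
    and left: "\<And>z. z \<in> D \<Longrightarrow> \<mu> * X z + \<nu> * W z + \<gamma> = fst z"
    and iso: "\<And>z h k. z \<in> D \<Longrightarrow>
       frechet_derivative X (at z) h * frechet_derivative W (at z) k
       - frechet_derivative X (at z) k * frechet_derivative W (at z) h
       + snd h * frechet_derivative Y (at z) k - snd k * frechet_derivative Y (at z) h = 0"
    and \<tau>: "continuous_on UNIV \<tau>"
    and \<tau>_eq: "\<And>t q. (t, q \<bullet> B) \<in> D \<Longrightarrow>
       \<tau> (lb (t, q \<bullet> B), q, W (t, q \<bullet> B) *\<^sub>R A + Y (t, q \<bullet> B) *\<^sub>R B) = t"
    and x0: "(\<tau> (l0, q0, p0), q0 \<bullet> B) \<in> D"
  shows "local_lag {(lb (t, q \<bullet> B), q, W (t, q \<bullet> B) *\<^sub>R A + Y (t, q \<bullet> B) *\<^sub>R B) | t q.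
           (t, q \<bullet> B) \<in> D \<and> q \<bullet> A - X (t, q \<bullet> B) \<in> \<int>} (l0, q0, p0)"
    (is "local_lag ?S _")
proof -
  define z where "z = (\<lambda>x::real \<times> (real^'n) \<times> (real^'n). (\<tau> x, fst (snd x) \<bullet> B))"
  have zc: "continuous_on UNIV z" unfolding z_def by (intro continuous_intros \<tau>)
  define N where "N = z -` D"
  have N: "open N" unfolding N_def using zc D by (simp add: open_vimage)
  have comp: "continuous_on N (\<lambda>x. f (z x))" if "continuous_on D f" for f :: "real \<times> real \<Rightarrow> real"
    by (rule continuous_on_compose2[OF that continuous_on_subset[OF zc]]) (auto simp: N_def)
  define G where "G = (\<lambda>x. (fst (snd x) \<bullet> A - X (z x), fst x - lb (z x),
      snd (snd x) - (W (z x) *\<^sub>R A + Y (z x) *\<^sub>R B)))"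
  have G: "continuous_on N G"
    unfolding G_def by (intro continuous_intros comp smooth_on_continuous_on sm lb)
  have mem: "x \<in> ?S \<longleftrightarrow> G x \<in> \<int> \<times> {0} \<times> {0}" if "x \<in> N" for x
  proof
    assume "x \<in> ?S"
    then obtain t q where x: "x = (lb (t, q \<bullet> B), q, W (t, q \<bullet> B) *\<^sub>R A + Y (t, q \<bullet> B) *\<^sub>R B)"
        "(t, q \<bullet> B) \<in> D" "q \<bullet> A - X (t, q \<bullet> B) \<in> \<int>" by blast
    then have "z x = (t, q \<bullet> B)" using \<tau>_eq[OF x(2)] by (simp add: z_def)
    then show "G x \<in> \<int> \<times> {0} \<times> {0}" using x by (simp add: G_def)
  next
    assume "G x \<in> \<int> \<times> {0} \<times> {0}"
    then show "x \<in> ?S"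
      using that by (cases x) (auto simp: G_def z_def N_def intro!: exI[of _ "\<tau> x"] exI[of _ "fst (snd x)"])
  qed
  let ?x = "(l0, q0, p0)"
  have xN: "?x \<in> N" using x0 by (simp add: N_def z_def)
  show ?thesis
  proof (cases "?x \<in> ?S")
    case False
    have "closed (\<int> \<times> {0} \<times> {0} :: (real \<times> real \<times> (real^'n)) set)" by (intro closed_Times closed_Ints) auto
    then have "open (G -` (- (\<int> \<times> {0} \<times> {0})) \<inter> N)"
      using continuous_on_open_vimage[OF N] G by (metis open_Compl)
    moreover have "?x \<in> G -` (- (\<int> \<times> {0} \<times> {0})) \<inter> N" using False mem[OF xN] xN by blast
    moreover have "?S \<inter> (G -` (- (\<int> \<times> {0} \<times> {0})) \<inter> N) = {}" using mem by blast
    ultimately show ?thesis by (rule local_lag_empty)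
  next
    case True
    then obtain m where m: "m \<in> \<int>" "fst (G ?x) = m" using mem[OF xN] by auto
    \<comment> \<open>The open ball of radius 1 around the integer m contains no other integer, so
      on \<open>N'\<close> integrality of the difference means equality with m.\<close>
    define N' where "N' = (fst \<circ> G) -` ball m 1 \<inter> N"
    have N': "open N'" unfolding N'_def
      using continuous_on_open_vimage[OF N] G by (metis continuous_on_fst open_ball comp_apply continuous_on_cong)
    have xN': "?x \<in> N'" using xN m by (simp add: N'_def)
    let ?T = "{(lb (t, q \<bullet> B), q, W (t, q \<bullet> B) *\<^sub>R A + Y (t, q \<bullet> B) *\<^sub>R B) | t q.
           (t, q \<bullet> B) \<in> D \<and> q \<bullet> A = X (t, q \<bullet> B) + m}"
    have Xm: "frechet_derivative (\<lambda>z. X z + m) (at z) h = frechet_derivative X (at z) h" if "z \<in> D" for z h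
      by (rule has_derivative_frechet_eq)
        (intro has_derivative_add_const smooth_on_has_derivative[OF sm(1) that])
    have "lag_graph ?T"
    proof (rule lag_graph_param[where X = "\<lambda>z. X z + m" and \<gamma> = "\<gamma> - \<mu> * m", OF A' D _ sm(2,3) lb])
      show "smooth_on D (\<lambda>z. X z + m)" by (intro smooth_on_add D sm smooth_on_const)
      show "\<mu> * (X z + m) + \<nu> * W z + (\<gamma> - \<mu> * m) = fst z" if "z \<in> D" for z
        using left[OF that] by (simp add: algebra_simps)
    qed (simp add: Xm iso)
    then have "lag_graph (?T \<inter> N')" using N' by (rule lag_graph_Int)
    moreover have "?T \<inter> N' = ?S \<inter> N'"
    proof (intro equalityI subsetI IntI)
      fix x assume "x \<in> ?T \<inter> N'"
      then obtain t q where tq: "x = (lb (t, q \<bullet> B), q, W (t, q \<bullet> B) *\<^sub>R A + Y (t, q \<bullet> B) *\<^sub>R B)"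
        "(t, q \<bullet> B) \<in> D" "q \<bullet> A = X (t, q \<bullet> B) + m" by blast
      then have "q \<bullet> A - X (t, q \<bullet> B) \<in> \<int>" using m(1) by simp
      then show "x \<in> ?S" using tq by blast
    next
      fix x assume x: "x \<in> ?S \<inter> N'"
      then obtain t q where tq: "x = (lb (t, q \<bullet> B), q, W (t, q \<bullet> B) *\<^sub>R A + Y (t, q \<bullet> B) *\<^sub>R B)"
        "(t, q \<bullet> B) \<in> D" "q \<bullet> A - X (t, q \<bullet> B) \<in> \<int>" by blast
      then have "z x = (t, q \<bullet> B)" using \<tau>_eq[OF tq(2)] by (simp add: z_def)
      then have "dist m (q \<bullet> A - X (t, q \<bullet> B)) < 1" using x tq by (simp add: N'_def G_def)
      then have "\<bar>(q \<bullet> A - X (t, q \<bullet> B)) - m\<bar> < 1" by (simp add: dist_real_def abs_minus_commute)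
      then have "(q \<bullet> A - X (t, q \<bullet> B)) - m = 0"
        using tq(3) m(1) by (meson Ints_diff Ints_nonzero_abs_less1)
      then show "x \<in> ?T" using tq by (auto simp: algebra_simps)
    qed auto
    ultimately show ?thesis unfolding local_lag_def using N' xN' True by auto
  qed
qed

section \<open>The Lagrangian pair of pants\<close>

text \<open>The plane without the ray [1, \<infinity>), where the principal branch of ln (1 - t) is
  holomorphic. It is starlike about 0, which is what provides primitives.\<close>

definition slit_plane :: "complex set" where
  "slit_plane = {t. 1 - t \<notin> \<real>\<^sub>\<le>\<^sub>0}"

lemma open_slit_plane: "open slit_plane"
proof -
  have "slit_plane = (\<lambda>t. 1 - t) -` (- \<real>\<^sub>\<le>\<^sub>0)" by (auto simp: slit_plane_def)
  moreover have "open \<dots>"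
    by (intro open_vimage open_Compl closed_nonpos_Reals_complex continuous_intros)
  ultimately show ?thesis by simp
qed

lemma ln_slit_holomorphic: "(\<lambda>t. Ln (1 - t)) holomorphic_on slit_plane"
  by (auto intro!: holomorphic_intros simp: slit_plane_def)

lemma starlike_slit_plane: "starlike slit_plane"
proof -
  have "closed_segment 0 t \<subseteq> slit_plane" if t: "t \<in> slit_plane" for t
  proof
    fix x assume "x \<in> closed_segment 0 t"
    then obtain u where u: "0 \<le> u" "u \<le> 1" "x = u *\<^sub>R t" by (auto simp: in_segment)
    have "x \<in> slit_plane" if "Im t \<noteq> 0" "u > 0"
      using that u by (auto simp: slit_plane_def complex_nonpos_Reals_iff)
    moreover have "x \<in> slit_plane" if "Im t = 0"
    proof -
      have "Re t < 1" using t that by (auto simp: slit_plane_def complex_nonpos_Reals_iff)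
      then have "u * Re t < 1"
        using u(1,2) mult_left_le_one_le[of "Re t" u] mult_nonneg_nonpos[of u "Re t"]
        by (cases "Re t \<ge> 0") auto
      then show ?thesis using u that by (auto simp: slit_plane_def complex_nonpos_Reals_iff)
    qed
    moreover have "x \<in> slit_plane" if "u = 0" using u that by (auto simp: slit_plane_def)
    ultimately show "x \<in> slit_plane" using u(1) by fastforce
  qed
  moreover have "0 \<in> slit_plane" by (auto simp: slit_plane_def)
  ultimately show ?thesis unfolding starlike_def by blast
qed

text \<open>The integrand has a removable singularity at 0, and its holomorphic extension has a
  primitive on the starlike domain.\<close>

lemma dilog_exists: "\<exists>L. \<forall>t\<in>slit_plane. t \<noteq> 0 \<longrightarrow> (L has_field_derivative Ln (1 - t) / t) (at t)"
proof -
  let ?g = "\<lambda>z. if z = 0 then deriv (\<lambda>t. Ln (1 - t)) 0 else (Ln (1 - z) - Ln (1 - 0)) / (z - 0)"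
  have h: "?g holomorphic_on slit_plane"
    by (rule pole_lemma_open[OF ln_slit_holomorphic open_slit_plane])
  obtain L where "\<forall>t\<in>slit_plane. (L has_field_derivative ?g t) (at t)"
    using holomorphic_starlike_primitive[OF holomorphic_on_imp_continuous_on[OF h] starlike_slit_plane
        open_slit_plane finite.emptyI] h open_slit_plane
    by (auto simp: holomorphic_on_open field_differentiable_def)
  then show ?thesis by (intro exI[of _ L]) force
qed

text \<open>With the usual sign convention this is minus the dilogarithm.\<close>

definition dilog :: "complex \<Rightarrow> complex" where
  "dilog = (SOME L. \<forall>t\<in>slit_plane. t \<noteq> 0 \<longrightarrow> (L has_field_derivative Ln (1 - t) / t) (at t))"

lemma dilog_derivative:
  "t \<in> slit_plane \<Longrightarrow> t \<noteq> 0 \<Longrightarrow> (dilog has_field_derivative Ln (1 - t) / t) (at t)"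
  unfolding dilog_def using someI_ex[OF dilog_exists] by blast

definition strip :: "complex set" where
  "strip = exp -` slit_plane"

text \<open>Writing s = a + 2 \<pi> i \<theta>2, the equation of the curve reads b - 2 \<pi> i
  \<theta>1 = \<open>leg_K s\<close> modulo 2 \<pi> i, and \<open>leg_H\<close> is a primitive of
  \<open>leg_K\<close> in the variable s.\<close>

definition leg_K :: "complex \<Rightarrow> complex" where "leg_K s = Ln (1 - exp s)"
definition leg_H :: "complex \<Rightarrow> complex" where "leg_H s = dilog (exp s)"

lemma open_strip: "open strip"
  unfolding strip_def by (intro open_vimage open_slit_plane continuous_intros)

lemma leg_K_holomorphic: "leg_K holomorphic_on strip"
  unfolding leg_K_def by (auto intro!: holomorphic_intros simp: strip_def slit_plane_def)

lemma leg_H_derivative: "s \<in> strip \<Longrightarrow> (leg_H has_field_derivative leg_K s) (at s)"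
  unfolding leg_H_def leg_K_def strip_def
  by (rule DERIV_cong[OF DERIV_chain2[OF dilog_derivative DERIV_exp]]) auto

lemma leg_H_holomorphic: "leg_H holomorphic_on strip"
  using leg_H_derivative open_strip by (auto simp: holomorphic_on_open)

definition cplx_coord :: "real \<times> real \<Rightarrow> complex" where
  "cplx_coord z = Complex (fst z) (2 * pi * snd z)"

lemma bounded_linear_cplx_coord: "bounded_linear cplx_coord"
proof -
  have "bounded_linear (\<lambda>z::real \<times> real. of_real (fst z) + \<i> * of_real (2 * pi * snd z))"
    by (intro bounded_linear_add bounded_linear_mult_right[THEN bounded_linear_compose]
        bounded_linear_of_real[THEN bounded_linear_compose] bounded_linear_fst bounded_linear_snd)
  moreover have "cplx_coord = (\<lambda>z. of_real (fst z) + \<i> * of_real (2 * pi * snd z))"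
    by (auto simp: cplx_coord_def complex_eq_iff)
  ultimately show ?thesis by simp
qed

definition leg_dom :: "(real \<times> real) set" where
  "leg_dom = cplx_coord -` strip"

lemma open_leg_dom: "open leg_dom"
  unfolding leg_dom_def
  by (intro open_vimage open_strip linear_continuous_on bounded_linear_cplx_coord)

lemma leg_dom_neg: "a < 0 \<Longrightarrow> (a, \<theta>) \<in> leg_dom"
proof -
  assume "a < 0"
  then have "Re (exp (cplx_coord (a, \<theta>))) < 1"
    using complex_Re_le_cmod[of "exp (cplx_coord (a, \<theta>))"]
    by (simp only: norm_exp_eq_Re) (simp add: cplx_coord_def order_le_less_trans)
  then show ?thesis by (auto simp: leg_dom_def strip_def slit_plane_def complex_nonpos_Reals_iff)
qed

text \<open>The curve \<open>e\<^bsup>a + 2\<pi>i\<theta>\<^sub>2\<^esup> + e\<^bsup>b - 2\<pi>i\<theta>\<^sub>1\<^esup> = 1\<close> is holomorphic for a complex structure whose holomorphic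
  area form has the symplectic form as its imaginary part, hence it is Lagrangian. It is the graph
  of the differential of \<open>Im leg_H / 2\<pi>\<close>, and multiplying this potential by the cut-off \<open>\<kappa>\<close>
  straightens the leg \<open>a \<rightarrow> -\<infinity>\<close>.\<close>

definition leg_Y :: "(real \<Rightarrow> real) \<Rightarrow> real \<times> real \<Rightarrow> real" where
  "leg_Y \<kappa> z = \<kappa> (fst z) * Re (leg_K (cplx_coord z))"

text \<open>For the potential \<Phi> = \<kappa> Im \<open>leg_H\<close> / 2 \<pi> as a function of a
  and \<theta>2, \<open>leg_Y\<close> is the derivative in \<theta>2 and \<open>leg_X\<close> is
  minus the derivative in a.\<close>

definition leg_X :: "(real \<Rightarrow> real) \<Rightarrow> real \<times> real \<Rightarrow> real" where
  "leg_X \<kappa> z = - (1 / (2 * pi)) * (\<kappa> (fst z) * Im (leg_K (cplx_coord z))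
     + frechet_derivative \<kappa> (at (fst z)) 1 * Im (leg_H (cplx_coord z)))"

context
  fixes \<kappa> :: "real \<Rightarrow> real"
  assumes \<kappa>: "smooth_on UNIV \<kappa>"
begin

lemma smooth_on_Re_Im_holomorphic:
  assumes "f holomorphic_on strip"
  shows "smooth_on leg_dom (\<lambda>z. Re (f (cplx_coord z)))" "smooth_on leg_dom (\<lambda>z. Im (f (cplx_coord z)))"
proof -
  have "smooth_on leg_dom (\<lambda>z. f (cplx_coord z))"
    by (rule smooth_on_compose[OF open_leg_dom _ smooth_on_bounded_linear[OF bounded_linear_cplx_coord]
          smooth_on_holomorphic[OF open_strip assms]]) (auto simp: leg_dom_def)
  then show "smooth_on leg_dom (\<lambda>z. Re (f (cplx_coord z)))" "smooth_on leg_dom (\<lambda>z. Im (f (cplx_coord z)))"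
    by (auto intro: smooth_on_linear_comp[OF bounded_linear_Re open_leg_dom]
        smooth_on_linear_comp[OF bounded_linear_Im open_leg_dom])
qed

lemma smooth_on_fst_comp: "smooth_on UNIV g \<Longrightarrow> open D \<Longrightarrow> smooth_on D (\<lambda>z::real \<times> real. g (fst z) :: real)"
  by (rule smooth_on_compose[where T = UNIV]) (auto intro: smooth_on_bounded_linear bounded_linear_fst)

lemma smooth_leg_Y: "smooth_on leg_dom (leg_Y \<kappa>)"
  unfolding leg_Y_def
  by (intro smooth_on_mult open_leg_dom smooth_on_fst_comp \<kappa>
      smooth_on_Re_Im_holomorphic leg_K_holomorphic)

lemma smooth_leg_X: "smooth_on leg_dom (leg_X \<kappa>)"
  unfolding leg_X_def
  by (intro smooth_on_mult smooth_on_add open_leg_dom smooth_on_const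
      smooth_on_fst_comp[OF \<kappa>] smooth_on_fst_comp[OF smooth_on_frechet_derivative[OF \<kappa>]]
      smooth_on_Re_Im_holomorphic leg_K_holomorphic leg_H_holomorphic)

text \<open>Isotropy of such a graph is the equality of the two mixed second derivatives of the
  potential, which both come out of \<open>leg_K\<close>, its derivative and the derivatives of
  \<kappa>.\<close>

lemma leg_isotropic:
  assumes z: "z \<in> leg_dom"
  shows "frechet_derivative (leg_X \<kappa>) (at z) h * frechet_derivative fst (at z) k
       - frechet_derivative (leg_X \<kappa>) (at z) k * frechet_derivative fst (at z) h
       + snd h * frechet_derivative (leg_Y \<kappa>) (at z) k - snd k * frechet_derivative (leg_Y \<kappa>) (at z) h = 0"
proof -
  let ?s = "cplx_coord z"
  have s: "?s \<in> strip" using z by (simp add: leg_dom_def)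
  define \<kappa>1 where "\<kappa>1 = (\<lambda>a. frechet_derivative \<kappa> (at a) 1)"
  have \<kappa>1_eq: "frechet_derivative \<kappa> (at a) 1 = \<kappa>1 a" for a by (simp add: \<kappa>1_def)
  define \<kappa>2 where "\<kappa>2 = frechet_derivative \<kappa>1 (at (fst z)) 1"
  have d1: "(\<kappa> has_real_derivative \<kappa>1 a) (at a)" for a
    using smooth_on_has_derivative[OF \<kappa>, of a] unfolding \<kappa>1_def
    by (metis (no_types, lifting) UNIV_I frechet_derivative_at has_derivative_imp_has_field_derivative
        has_derivative_bounded_linear linear_simps(5) mult.right_neutral real_scaleR_def)
  have d2: "(\<kappa>1 has_real_derivative \<kappa>2) (at (fst z))"
    using smooth_on_has_derivative[OF smooth_on_frechet_derivative[OF \<kappa>, of 1], of "fst z"]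
    unfolding \<kappa>2_def \<kappa>1_def
    by (metis (no_types, lifting) UNIV_I frechet_derivative_at has_derivative_imp_has_field_derivative
        has_derivative_bounded_linear linear_simps(5) mult.right_neutral real_scaleR_def)
  have f1: "((\<lambda>z. \<kappa> (fst z)) has_derivative (\<lambda>h. \<kappa>1 (fst z) * fst h)) (at z)"
    using has_derivative_compose[OF bounded_linear_imp_has_derivative[OF bounded_linear_fst, of "at z"]
        d1[of "fst z", unfolded has_field_derivative_def]] by simp
  have f2: "((\<lambda>z. \<kappa>1 (fst z)) has_derivative (\<lambda>h. \<kappa>2 * fst h)) (at z)"
    using has_derivative_compose[OF bounded_linear_imp_has_derivative[OF bounded_linear_fst, of "at z"]
        d2[unfolded has_field_derivative_def]] by simp
  let ?K = "leg_K ?s" and ?K' = "deriv leg_K ?s"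
  have c: "((\<lambda>z. f (cplx_coord z)) has_derivative (\<lambda>h. f' * cplx_coord h)) (at z)"
    if "(f has_field_derivative f') (at ?s)" for f f'
    using has_derivative_compose[OF bounded_linear_imp_has_derivative[OF bounded_linear_cplx_coord, of "at z"]
        that[unfolded has_field_derivative_def]] by simp
  note K' = c[OF holomorphic_derivI[OF leg_K_holomorphic open_strip s]]
  note H' = c[OF leg_H_derivative[OF s]]
  have Y: "(leg_Y \<kappa> has_derivative (\<lambda>h. \<kappa> (fst z) * Re (?K' * cplx_coord h) + \<kappa>1 (fst z) * fst h * Re ?K)) (at z)"
    unfolding leg_Y_def
    by (intro has_derivative_mult f1 has_derivative_Re K')
  have X: "(leg_X \<kappa> has_derivative (\<lambda>h. - (1 / (2 * pi)) * ((\<kappa> (fst z) * Im (?K' * cplx_coord h) + \<kappa>1 (fst z) * fst h * Im ?K)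
      + (\<kappa>1 (fst z) * Im (?K * cplx_coord h) + \<kappa>2 * fst h * Im (leg_H ?s))))) (at z)"
    unfolding leg_X_def \<kappa>1_eq
    by (intro has_derivative_mult_right has_derivative_add has_derivative_mult f1 f2 has_derivative_Im K' H')
  have W: "frechet_derivative fst (at z) h = fst h" for h :: "real \<times> real"
    by (rule has_derivative_frechet_eq[OF bounded_linear_imp_has_derivative[OF bounded_linear_fst]])
  show ?thesis
    unfolding W has_derivative_frechet_eq[OF X] has_derivative_frechet_eq[OF Y]
    by (simp add: cplx_coord_def field_simps)
qed

end

text \<open>Membership relations in the coordinates \<open>p = a A + b B\<close>, \<open>\<theta>\<^sub>1 = q \<bullet> A\<close>, \<open>\<theta>\<^sub>2 = q \<bullet> B\<close>.\<close>

definition leg_rel :: "(real \<Rightarrow> real) \<Rightarrow> real \<Rightarrow> real \<Rightarrow> real \<Rightarrow> real \<Rightarrow> bool" where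
  "leg_rel \<kappa> a b \<theta>1 \<theta>2 \<longleftrightarrow>
     (a, \<theta>2) \<in> leg_dom \<and> b = leg_Y \<kappa> (a, \<theta>2) \<and> \<theta>1 - leg_X \<kappa> (a, \<theta>2) \<in> \<int>"

definition curve_rel :: "real \<Rightarrow> real \<Rightarrow> real \<Rightarrow> real \<Rightarrow> bool" where
  "curve_rel a b \<theta>1 \<theta>2 \<longleftrightarrow> exp (Complex a (2 * pi * \<theta>2)) + exp (Complex b (- 2 * pi * \<theta>1)) = 1"

lemma curve_rel_swap: "curve_rel a b \<theta>1 \<theta>2 \<longleftrightarrow> curve_rel b a (- \<theta>2) (- \<theta>1)"
  by (simp add: curve_rel_def add.commute)

text \<open>Dividing X + Y = 1 by X gives 1/X + (-Y/X) = 1, an equation of the same shape. The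
  factor -1 = exp (i \<pi>) becomes the shift of \<theta>1 + \<theta>2 by 1/2, the phase of the
  third leg.\<close>

lemma curve_rel_rotate: "curve_rel a b \<theta>1 \<theta>2 \<longleftrightarrow> curve_rel (- a) (b - a) (\<theta>1 + \<theta>2 - 1/2) (- \<theta>2)"
proof -
  define X where "X = exp (Complex a (2 * pi * \<theta>2))"
  define Y where "Y = exp (Complex b (- 2 * pi * \<theta>1))"
  have "Complex (- a) (2 * pi * - \<theta>2) = - Complex a (2 * pi * \<theta>2)" by (simp add: complex_eq_iff)
  then have X': "exp (Complex (- a) (2 * pi * - \<theta>2)) = 1 / X"
    by (simp add: X_def exp_minus inverse_eq_divide)
  have "Complex (b - a) (- 2 * pi * (\<theta>1 + \<theta>2 - 1/2)) =
      Complex b (- 2 * pi * \<theta>1) - Complex a (2 * pi * \<theta>2) + \<i> * pi"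
    by (simp add: complex_eq_iff algebra_simps)
  then have Y': "exp (Complex (b - a) (- 2 * pi * (\<theta>1 + \<theta>2 - 1/2))) = - (Y / X)"
    by (simp only: exp_add exp_diff exp_pi_i' X_def Y_def)
      (simp add: exp_pi_i' mult.commute)
  have "X \<noteq> 0" by (simp add: X_def)
  then have "1 / X + - (Y / X) = 1 \<longleftrightarrow> 1 - Y = X" by (simp add: field_simps)
  then show ?thesis
    unfolding curve_rel_def X' Y' X_def[symmetric] Y_def[symmetric] by (auto simp: algebra_simps)
qed

lemma exp_eq_polar: "w \<noteq> 0 \<Longrightarrow>
  exp (Complex b (- 2 * pi * \<theta>)) = w \<longleftrightarrow> b = Re (Ln w) \<and> \<theta> + Im (Ln w) / (2 * pi) \<in> \<int>"
proof -
  assume w: "w \<noteq> 0"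
  have "exp (Complex b (- 2 * pi * \<theta>)) = exp (Ln w) \<longleftrightarrow>
      (\<exists>n::int. b = Re (Ln w) \<and> - 2 * pi * \<theta> = Im (Ln w) + 2 * of_int n * pi)"
    unfolding exp_eq by (simp add: complex_eq_iff)
  also have "\<dots> \<longleftrightarrow> (\<exists>n::int. b = Re (Ln w) \<and> \<theta> + Im (Ln w) / (2 * pi) = of_int (- n))"
    by (intro ex_cong1) (auto simp: field_simps)
  also have "\<dots> \<longleftrightarrow> b = Re (Ln w) \<and> \<theta> + Im (Ln w) / (2 * pi) \<in> \<int>"
  proof -
    have "(\<exists>n::int. x = of_int (- n)) \<longleftrightarrow> x \<in> \<int>" for x :: real
    proof
      assume "x \<in> \<int>"
      then obtain m where "x = of_int m" by (rule Ints_cases)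
      then show "\<exists>n::int. x = of_int (- n)" by (intro exI[of _ "- m"]) simp
    qed auto
    then show ?thesis by (simp only: ex_simps)
  qed
  finally show ?thesis using w by simp
qed

text \<open>Where \<kappa> is 1 to first order, the graph is the unmodified branch
  \<open>leg_K\<close>; integrality of \<theta>1 - X absorbs the choice of the branch.\<close>

lemma leg_rel_curve:
  assumes "(a, \<theta>2) \<in> leg_dom" "\<kappa> a = 1" "frechet_derivative \<kappa> (at a) 1 = 0"
  shows "leg_rel \<kappa> a b \<theta>1 \<theta>2 \<longleftrightarrow> curve_rel a b \<theta>1 \<theta>2"
proof -
  let ?w = "1 - exp (Complex a (2 * pi * \<theta>2))"
  have w: "?w \<noteq> 0" using assms(1) by (auto simp: leg_dom_def strip_def slit_plane_def cplx_coord_def)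
  have "curve_rel a b \<theta>1 \<theta>2 \<longleftrightarrow> exp (Complex b (- 2 * pi * \<theta>1)) = ?w"
    unfolding curve_rel_def by (auto simp: algebra_simps)
  also have "\<dots> \<longleftrightarrow> b = Re (Ln ?w) \<and> \<theta>1 + Im (Ln ?w) / (2 * pi) \<in> \<int>"
    by (rule exp_eq_polar[OF w])
  also have "\<dots> \<longleftrightarrow> leg_rel \<kappa> a b \<theta>1 \<theta>2"
    using assms by (simp add: leg_rel_def leg_X_def leg_Y_def leg_K_def cplx_coord_def)
  finally show ?thesis by simp
qed

text \<open>The leg is bent only for -3 \<le> a \<le> -2. The strip -2 < a < -1 is left for the
  overlap with the central piece.\<close>

definition leg_cut :: "real \<Rightarrow> real" where "leg_cut a = smooth_step (a + 3)"

lemma smooth_on_leg_cut: "smooth_on UNIV leg_cut"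
  unfolding leg_cut_def
  by (rule smooth_on_compose[OF open_UNIV _ _ smooth_on_step])
    (auto intro!: smooth_on_add smooth_on_bounded_linear[OF bounded_linear_ident])

lemma frechet_derivative_locally_const:
  assumes "open U" "x \<in> U" "\<And>y. y \<in> U \<Longrightarrow> f y = c"
  shows "frechet_derivative f (at x) v = 0"
proof -
  have "(f has_derivative (\<lambda>v. 0)) (at x)"
    by (rule has_derivative_transform_within_open[OF has_derivative_const assms(1,2)]) (simp add: assms(3))
  then show ?thesis by (rule has_derivative_frechet_eq)
qed

lemma leg_cut_1: "a > -2 \<Longrightarrow> leg_cut a = 1" "a > -2 \<Longrightarrow> frechet_derivative leg_cut (at a) 1 = 0"
  by (auto simp: leg_cut_def smooth_step_1
      intro!: frechet_derivative_locally_const[of "{-2<..}" _ leg_cut 1])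

lemma leg_cut_0: "a < -3 \<Longrightarrow> leg_cut a = 0" "a < -3 \<Longrightarrow> frechet_derivative leg_cut (at a) 1 = 0"
  by (auto simp: leg_cut_def smooth_step_0
      intro!: frechet_derivative_locally_const[of "{..<-3}" _ leg_cut 0])

lemma smooth_step_range: "0 \<le> smooth_step x" "smooth_step x \<le> 1"
proof -
  have "flat_exp 0 x \<ge> 0" "flat_exp 0 (1 - x) \<ge> 0" by (auto simp: flat_exp_def)
  then show "0 \<le> smooth_step x" "smooth_step x \<le> 1"
    using flat_exp_sum_pos[of x] by (auto simp: smooth_step_def field_simps)
qed

lemma leg_rel_curve': "-2 < a \<Longrightarrow> a < 0 \<Longrightarrow> leg_rel leg_cut a b \<theta>1 \<theta>2 \<longleftrightarrow> curve_rel a b \<theta>1 \<theta>2"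
  by (intro leg_rel_curve leg_dom_neg leg_cut_1)

lemma leg_rel_far: "a < -3 \<Longrightarrow> leg_rel leg_cut a b \<theta>1 \<theta>2 \<longleftrightarrow> b = 0 \<and> \<theta>1 \<in> \<int>"
  by (simp add: leg_rel_def leg_dom_neg leg_X_def leg_Y_def leg_cut_0)

text \<open>For a < -1 the modulus of 1 - exp s lies between 1/e and e, and the cut-off only shrinks
  its logarithm. This is what keeps different legs of \<open>pants_rel\<close> apart.\<close>

lemma leg_rel_bound:
  assumes "a < -1" "leg_rel leg_cut a b \<theta>1 \<theta>2" shows "\<bar>b\<bar> < 1"
proof -
  let ?t = "exp (cplx_coord (a, \<theta>2))"
  have "norm ?t = exp a" by (simp add: cplx_coord_def)
  also have "\<dots> < exp (-1)" using assms(1) by simp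
  finally have t: "norm ?t < exp (-1)" .
  have e: "2 \<le> exp (1::real)" using exp_ge_add_one_self[of 1] by simp
  have e': "exp (-1) \<le> (1/2::real)" using e by (simp add: exp_minus field_simps)
  have "norm (1 - ?t) \<le> 1 + norm ?t" using norm_triangle_ineq4[of 1 ?t] by simp
  then have u: "norm (1 - ?t) < exp 1" using t e e' by linarith
  have l: "norm (1 - ?t) > exp (-1)" 
    using norm_triangle_ineq2[of 1 ?t] t e' unfolding norm_one by linarith
  then have nz: "1 - ?t \<noteq> 0" by (auto simp: not_less)
  have "ln (norm (1 - ?t)) < 1" using u nz by (metis exp_ln exp_less_cancel_iff zero_less_norm_iff)
  moreover have "ln (norm (1 - ?t)) > -1" using l nz by (metis exp_ln exp_less_cancel_iff zero_less_norm_iff)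
  ultimately have "\<bar>Re (leg_K (cplx_coord (a, \<theta>2)))\<bar> < 1" using nz by (simp add: leg_K_def)
  then have "\<bar>leg_cut a\<bar> * \<bar>Re (leg_K (cplx_coord (a, \<theta>2)))\<bar> < 1"
    using smooth_step_range[of "a + 3"] mult_left_le_one_le[of "\<bar>Re (leg_K (cplx_coord (a, \<theta>2)))\<bar>" "leg_cut a"]
    by (simp add: leg_cut_def)
  then show ?thesis using assms(2) by (simp add: leg_rel_def leg_Y_def abs_mult)
qed

lemma curve_rel_bound:
  assumes "curve_rel a b \<theta>1 \<theta>2" "a \<le> 2" shows "b \<le> 3"
proof -
  have "exp b = norm (exp (Complex b (- 2 * pi * \<theta>1)))" by simp
  also have "exp (Complex b (- 2 * pi * \<theta>1)) = 1 - exp (Complex a (2 * pi * \<theta>2))"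
    using assms(1) by (auto simp: curve_rel_def algebra_simps)
  also have "norm \<dots> \<le> 1 + exp a" using norm_triangle_ineq4[of 1 "exp (Complex a (2 * pi * \<theta>2))"] by simp
  also have "\<dots> \<le> 1 + exp 2" using assms(2) by simp
  also have "\<dots> \<le> 2 * exp (2::real)" using one_le_exp_iff[of 2] by simp
  also have "\<dots> \<le> exp 1 * exp 2" using exp_ge_add_one_self[of 1] by (intro mult_right_mono) auto
  also have "\<dots> = exp 3" by (simp flip: exp_add)
  finally show ?thesis by simp
qed

text \<open>Three copies of the straightened leg, carried over by \<open>curve_rel_swap\<close> and
  \<open>curve_rel_rotate\<close>, and the unmodified curve in the middle. Each leg overlaps the
  middle piece in a strip of width 1 where the cut-off is still 1.\<close>

definition pants_rel :: "real \<Rightarrow> real \<Rightarrow> real \<Rightarrow> real \<Rightarrow> bool" where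
  "pants_rel a b \<theta>1 \<theta>2 \<longleftrightarrow>
     a < -1 \<and> leg_rel leg_cut a b \<theta>1 \<theta>2 \<or>
     b < -1 \<and> leg_rel leg_cut b a (- \<theta>2) (- \<theta>1) \<or>
     a > 1 \<and> leg_rel leg_cut (- a) (b - a) (\<theta>1 + \<theta>2 - 1/2) (- \<theta>2) \<or>
     a > -2 \<and> b > -2 \<and> a < 2 \<and> curve_rel a b \<theta>1 \<theta>2"

text \<open>In this region and the next three, the clauses of \<open>pants_rel\<close> that can hold
  there all agree: a leg and the centre by \<open>leg_rel_curve'\<close>, while two different legs
  exclude each other by \<open>leg_rel_bound\<close>.\<close>

lemma pants_rel_leg1: "a < -1 \<Longrightarrow> pants_rel a b \<theta>1 \<theta>2 \<longleftrightarrow> leg_rel leg_cut a b \<theta>1 \<theta>2"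
  unfolding pants_rel_def
  using leg_rel_curve'[of a b \<theta>1 \<theta>2] leg_rel_bound[of b a "- \<theta>2" "- \<theta>1"] by force

lemma pants_rel_leg2: "b < -1 \<Longrightarrow> pants_rel a b \<theta>1 \<theta>2 \<longleftrightarrow> leg_rel leg_cut b a (- \<theta>2) (- \<theta>1)"
  unfolding pants_rel_def
  using leg_rel_curve'[of b a "- \<theta>2" "- \<theta>1"] leg_rel_bound[of a b \<theta>1 \<theta>2] curve_rel_swap[of a b]
    leg_rel_bound[of "- a" "b - a" "\<theta>1 + \<theta>2 - 1/2" "- \<theta>2"] by force

lemma pants_rel_leg3:
  "a > 1 \<Longrightarrow> pants_rel a b \<theta>1 \<theta>2 \<longleftrightarrow> leg_rel leg_cut (- a) (b - a) (\<theta>1 + \<theta>2 - 1/2) (- \<theta>2)"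
  unfolding pants_rel_def
  using leg_rel_curve'[of "- a" "b - a" "\<theta>1 + \<theta>2 - 1/2" "- \<theta>2"] curve_rel_rotate[of a b \<theta>1 \<theta>2]
    leg_rel_bound[of b a "- \<theta>2" "- \<theta>1"] by force

lemma pants_rel_centre:
  "a > -2 \<Longrightarrow> b > -2 \<Longrightarrow> a < 2 \<Longrightarrow> pants_rel a b \<theta>1 \<theta>2 \<longleftrightarrow> curve_rel a b \<theta>1 \<theta>2"
  unfolding pants_rel_def
  using leg_rel_curve'[of a b \<theta>1 \<theta>2] leg_rel_curve'[of b a "- \<theta>2" "- \<theta>1"] curve_rel_swap[of a b]
    leg_rel_curve'[of "- a" "b - a" "\<theta>1 + \<theta>2 - 1/2" "- \<theta>2"] curve_rel_rotate[of a b \<theta>1 \<theta>2]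
  by force

lemma pants_rel_far:
  assumes "\<not> (\<bar>a\<bar> \<le> 4 \<and> \<bar>b\<bar> \<le> 4)"
  shows "pants_rel a b \<theta>1 \<theta>2 \<longleftrightarrow>
    a < 0 \<and> b = 0 \<and> \<theta>1 \<in> \<int> \<or> b < 0 \<and> a = 0 \<and> \<theta>2 \<in> \<int> \<or> a = b \<and> a > 0 \<and> \<theta>1 + \<theta>2 - 1/2 \<in> \<int>"
proof -
  \<comment> \<open>In the first three cases a leg is already straight. The last one is empty: the
    legs give b < 1 or b < a + 1 \<le> 4, and the centre gives b \<le> 3. This is where the bound 4
    comes from.\<close>
  consider "a < -3" | "b < -3" "a \<ge> -3" | "a > 3" "b \<ge> -3" | "b > 4" "-3 \<le> a" "a \<le> 3"
    using assms by linarith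
  then show ?thesis
  proof cases
    case 1
    then show ?thesis using leg_rel_far[of a b] by (auto simp: pants_rel_leg1)
  next
    case 2
    then show ?thesis using leg_rel_far[of b a] by (auto simp: pants_rel_leg2)
  next
    case 3
    then show ?thesis using leg_rel_far[of "- a" "b - a"] by (auto simp: pants_rel_leg3)
  next
    case 4
    have "\<not> pants_rel a b \<theta>1 \<theta>2"
      unfolding pants_rel_def
      using 4 leg_rel_bound[of a b \<theta>1 \<theta>2] curve_rel_bound[of a b \<theta>1 \<theta>2]
        leg_rel_bound[of "- a" "b - a" "\<theta>1 + \<theta>2 - 1/2" "- \<theta>2"] by force
    then show ?thesis using 4 by auto
  qed
qed

section \<open>The pair of pants as a subset of T*R^n\<close>

definition span_set ::
  "real^'n::finite \<Rightarrow> real^'n \<Rightarrow> (real \<Rightarrow> real \<Rightarrow> real \<Rightarrow> real \<Rightarrow> bool) \<Rightarrow> (real \<times> (real^'n) \<times> (real^'n)) set" where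
  "span_set A B R = {(0, q, a *\<^sub>R A + b *\<^sub>R B) | a b q. R a b (q \<bullet> A) (q \<bullet> B)}"

text \<open>The symmetries of the curve are realised by reflections q \<mapsto> -q and translations,
  under which \<open>local_lag\<close> is invariant; so all three legs are reduced to the first
  one.\<close>

lemma span_set_swap:
  "span_set A B (\<lambda>a b \<theta>1 \<theta>2. R b a (- \<theta>2) (- \<theta>1)) =
     (\<lambda>(l, q, p). (l + 0, (-1) *\<^sub>R q + 0, 1 *\<^sub>R p + 0)) ` span_set B A R" (is "?L = ?f ` ?R")
proof (intro equalityI subsetI)
  fix x assume "x \<in> ?L"
  then obtain a b q where x: "x = (0, q, a *\<^sub>R A + b *\<^sub>R B)" "R b a (- (q \<bullet> B)) (- (q \<bullet> A))"
    by (auto simp: span_set_def)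
  then have "(0, - q, b *\<^sub>R B + a *\<^sub>R A) \<in> ?R"
    unfolding span_set_def by (intro CollectI exI[of _ b] exI[of _ a] exI[of _ "- q"]) simp
  from imageI[OF this, of ?f] show "x \<in> ?f ` ?R" by (simp add: x add.commute)
next
  fix x assume "x \<in> ?f ` ?R"
  then obtain a b q where "x = (0, - q, a *\<^sub>R B + b *\<^sub>R A)" "R a b (q \<bullet> B) (q \<bullet> A)"
    by (auto simp: span_set_def)
  then show "x \<in> ?L"
    unfolding span_set_def by (intro CollectI exI[of _ b] exI[of _ a] exI[of _ "- q"]) (simp add: add.commute)
qed

text \<open>The frame changes to -A - B and B, which turns the third leg into the first. The
  translation by A'/2 shifts q \<bullet> A by 1/2 and fixes q \<bullet> B.\<close>

lemma span_set_rotate: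
  assumes "A' \<bullet> A = 1" "A' \<bullet> B = 0"
  shows "span_set A B (\<lambda>a b \<theta>1 \<theta>2. R (- a) (b - a) (\<theta>1 + \<theta>2 - 1/2) (- \<theta>2)) =
     (\<lambda>(l, q, p). (l + 0, (-1) *\<^sub>R q + (1/2) *\<^sub>R A', 1 *\<^sub>R p + 0)) ` span_set (- A - B) B R" (is "?L = ?f ` ?R")
proof (intro equalityI subsetI)
  fix x assume "x \<in> ?L"
  then obtain a b q where x: "x = (0, q, a *\<^sub>R A + b *\<^sub>R B)"
      "R (- a) (b - a) (q \<bullet> A + q \<bullet> B - 1/2) (- (q \<bullet> B))"
    by (auto simp: span_set_def)
  have "R (- a) (b - a) (((1/2) *\<^sub>R A' - q) \<bullet> (- A - B)) (((1/2) *\<^sub>R A' - q) \<bullet> B)"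
    using x(2) assms by (simp add: inner_diff_left inner_diff_right algebra_simps)
  then have "(0, (1/2) *\<^sub>R A' - q, (- a) *\<^sub>R (- A - B) + (b - a) *\<^sub>R B) \<in> ?R"
    unfolding span_set_def by blast
  from imageI[OF this, of ?f] show "x \<in> ?f ` ?R" by (simp add: x algebra_simps)
next
  fix x assume "x \<in> ?f ` ?R"
  then obtain a b q where x: "x = (0, - q + (1/2) *\<^sub>R A', a *\<^sub>R (- A - B) + b *\<^sub>R B)" "R a b (q \<bullet> (- A - B)) (q \<bullet> B)"
    by (auto simp: span_set_def)
  have "x = (0, - q + (1/2) *\<^sub>R A', (- a) *\<^sub>R A + (b - a) *\<^sub>R B)" by (simp add: x(1) algebra_simps)
  moreover have "R (- (- a)) ((b - a) - (- a)) ((- q + (1/2) *\<^sub>R A') \<bullet> A + (- q + (1/2) *\<^sub>R A') \<bullet> B - 1/2)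
      (- ((- q + (1/2) *\<^sub>R A') \<bullet> B))"
    using x(2) assms by (simp add: inner_add_left inner_diff_right algebra_simps)
  ultimately show "x \<in> ?L" unfolding span_set_def by blast
qed

context
  fixes A B A' B' :: "real^'n::finite"
  assumes dual: "A' \<bullet> A = 1" "A' \<bullet> B = 0" "B' \<bullet> A = 0" "B' \<bullet> B = 1"
begin

lemma dual_comb: "(a *\<^sub>R A + b *\<^sub>R B) \<bullet> A' = a" "(a *\<^sub>R A + b *\<^sub>R B) \<bullet> B' = b"
  using dual by (simp_all add: inner_add_left inner_commute[of A] inner_commute[of B])

lemma span_set_iff:
  "(l, q, p) \<in> span_set A B R \<longleftrightarrow>
     l = 0 \<and> p = (p \<bullet> A') *\<^sub>R A + (p \<bullet> B') *\<^sub>R B \<and> R (p \<bullet> A') (p \<bullet> B') (q \<bullet> A) (q \<bullet> B)"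
  unfolding span_set_def using dual_comb by auto

lemma span_set_comb: "(0, q, a *\<^sub>R A + b *\<^sub>R B) \<in> span_set A B R \<longleftrightarrow> R a b (q \<bullet> A) (q \<bullet> B)"
  by (simp add: span_set_iff dual_comb)

lemma local_lag_leg:
  assumes \<kappa>: "smooth_on UNIV \<kappa>" and x: "(p \<bullet> A', q \<bullet> B) \<in> leg_dom"
  shows "local_lag (span_set A B (leg_rel \<kappa>)) (l, q, p)"
proof -
  have eq: "span_set A B (leg_rel \<kappa>) = {(0, q, fst (t, q \<bullet> B) *\<^sub>R A + leg_Y \<kappa> (t, q \<bullet> B) *\<^sub>R B) | t q.
           (t, q \<bullet> B) \<in> leg_dom \<and> q \<bullet> A - leg_X \<kappa> (t, q \<bullet> B) \<in> \<int>}"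
    unfolding span_set_def leg_rel_def by auto
  \<comment> \<open>The parameter is the coordinate a of p, read off by A'; hence W =
    \<open>fst\<close> and t = 0 * X + 1 * W.\<close>
  show ?thesis
    unfolding eq
  proof (rule local_lag_param[where \<mu> = 0 and \<nu> = 1 and \<gamma> = 0 and \<tau> = "\<lambda>x. snd (snd x) \<bullet> A'"
        and lb = "\<lambda>_. 0", OF dual(1,2) open_leg_dom smooth_leg_X[OF \<kappa>] _ smooth_leg_Y[OF \<kappa>]])
    show "smooth_on leg_dom fst" by (rule smooth_on_bounded_linear[OF bounded_linear_fst])
    show "frechet_derivative (leg_X \<kappa>) (at z) h * frechet_derivative fst (at z) k
       - frechet_derivative (leg_X \<kappa>) (at z) k * frechet_derivative fst (at z) h
       + snd h * frechet_derivative (leg_Y \<kappa>) (at z) k - snd k * frechet_derivative (leg_Y \<kappa>) (at z) h = 0"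
      if "z \<in> leg_dom" for z h k using leg_isotropic[OF \<kappa> that] .
    show "continuous_on UNIV (\<lambda>x::real \<times> (real^'n) \<times> (real^'n). snd (snd x) \<bullet> A')"
      by (intro continuous_intros)
  qed (use x dual_comb in auto)
qed

lemma closed_curve: "closed (span_set A B curve_rel)"
proof -
  have "span_set A B curve_rel = {x. (fst x, snd (snd x) - ((snd (snd x) \<bullet> A') *\<^sub>R A + (snd (snd x) \<bullet> B') *\<^sub>R B),
      exp (of_real (snd (snd x) \<bullet> A') + \<i> * of_real (2 * pi * (fst (snd x) \<bullet> B)))
      + exp (of_real (snd (snd x) \<bullet> B') + \<i> * of_real (- 2 * pi * (fst (snd x) \<bullet> A)))) = (0, 0, 1)}"
    by (auto simp: span_set_iff curve_rel_def Complex_eq)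
  then show ?thesis by (simp only:) (intro closed_Collect_eq continuous_intros)
qed

end

text \<open>The curve X + Y = 1 is a graph over X wherever X avoids the slit [1, \<infinity>). If X
  lies on the slit, then Y = 1 - X \<le> 0 avoids it, and the swapped description applies.\<close>

lemma local_lag_curve:
  fixes A B A' B' :: "real^'n::finite"
  assumes dual: "A' \<bullet> A = 1" "A' \<bullet> B = 0" "B' \<bullet> A = 0" "B' \<bullet> B = 1"
  shows "local_lag (span_set A B curve_rel) x"
proof (cases "x \<in> span_set A B curve_rel")
  case False
  then show ?thesis by (rule local_lag_outside[OF closed_curve[OF dual]])
next
  case True
  obtain l q p where x: "x = (l, q, p)" by (cases x)
  note curve = True[unfolded x span_set_iff[OF dual]]
  have near: "local_lag (span_set C D curve_rel) (m, r, p)"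
    if d: "C' \<bullet> C = 1" "C' \<bullet> D = 0" "D' \<bullet> C = 0" "D' \<bullet> D = 1" and c: "(p \<bullet> C', r \<bullet> D) \<in> leg_dom"
    for C C' D D' r p :: "real^'n" and m
  proof -
    define U where "U = (\<lambda>x::real \<times> (real^'n) \<times> (real^'n). (snd (snd x) \<bullet> C', fst (snd x) \<bullet> D)) -` leg_dom"
    have U: "open U" unfolding U_def by (intro open_vimage open_leg_dom continuous_intros)
    show ?thesis
    proof (rule local_lag_cong[OF local_lag_leg[OF d smooth_on_const c, of 1] U])
      show "span_set C D curve_rel \<inter> U = span_set C D (leg_rel (\<lambda>_. 1)) \<inter> U"
        using leg_rel_curve[where \<kappa> = "\<lambda>_. 1"]
        by (auto simp: U_def span_set_iff[OF d] frechet_derivative_const)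
    qed (use c in \<open>simp add: U_def\<close>)
  qed
  let ?X = "exp (Complex (p \<bullet> A') (2 * pi * (q \<bullet> B)))" and ?Y = "exp (Complex (p \<bullet> B') (- 2 * pi * (q \<bullet> A)))"
  have XY: "?X + ?Y = 1" using curve by (simp add: curve_rel_def)
  show ?thesis
  proof (cases "?X \<in> slit_plane")
    case True
    then show ?thesis unfolding x
      by (intro near[OF dual]) (simp add: leg_dom_def strip_def cplx_coord_def)
  next
    case False
    have "?Y = 1 - ?X" using XY by (simp add: algebra_simps)
    then have "?Y \<in> \<real>\<^sub>\<le>\<^sub>0" "?Y \<noteq> 0" using False by (auto simp: slit_plane_def)
    then have "?Y \<in> slit_plane" by (auto simp: slit_plane_def complex_nonpos_Reals_iff)
    then have "local_lag (span_set B A curve_rel) (0, - q, p)"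
      using near[OF dual(4,3,2,1), of p "- q" 0]
      by (simp add: leg_dom_def strip_def cplx_coord_def)
    from local_lag_transform[OF this, of 1 "-1" "\<lambda>_. 0" 0 0]
    have "local_lag (span_set A B (\<lambda>a b \<theta>1 \<theta>2. curve_rel b a (- \<theta>2) (- \<theta>1))) (0, q, p)"
      unfolding span_set_swap by (simp add: continuous_on_const)
    then show ?thesis using curve by (simp add: x flip: curve_rel_swap)
  qed
qed

lemma local_lag_pants:
  fixes A B A' B' :: "real^'n::finite"
  assumes dual: "A' \<bullet> A = 1" "A' \<bullet> B = 0" "B' \<bullet> A = 0" "B' \<bullet> B = 1"
  shows "local_lag (span_set A B pants_rel) x"
proof -
  obtain l q p where x: "x = (l, q, p)" by (cases x)
  let ?a = "p \<bullet> A'" and ?b = "p \<bullet> B'"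
  have glue: "local_lag (span_set A B pants_rel) x"
    if l: "local_lag (span_set A B R) x" and U: "open U" "(?a, ?b) \<in> U"
      and R: "\<And>a b \<theta>1 \<theta>2. (a, b) \<in> U \<Longrightarrow> pants_rel a b \<theta>1 \<theta>2 \<longleftrightarrow> R a b \<theta>1 \<theta>2" for R U
  proof -
    define V where "V = (\<lambda>x::real \<times> (real^'n) \<times> (real^'n). (snd (snd x) \<bullet> A', snd (snd x) \<bullet> B')) -` U"
    have V: "open V" unfolding V_def by (intro open_vimage U continuous_intros)
    show ?thesis
      by (rule local_lag_cong[OF l V]) (use U R in \<open>auto simp: V_def span_set_iff[OF dual] x\<close>)
  qed
  have half: "open {(a::real, b::real). a < c}" "open {(a::real, b::real). b < c}" "open {(a::real, b::real). a > c}"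
    "open {(a::real, b::real). b > c}" for c
    unfolding case_prod_beta' by (intro open_Collect_less continuous_intros)+
  consider "?a < -1" | "?b < -1" | "?a > 1" | "?a > -2" "?b > -2" "?a < 2" by linarith
  then show ?thesis
  proof cases
    case 1
    show ?thesis
      by (rule glue[OF _ half(1)[of "-1"]])
        (use 1 in \<open>auto simp: x pants_rel_leg1 intro!: local_lag_leg[OF dual smooth_on_leg_cut] leg_dom_neg\<close>)
  next
    case 2
    have "local_lag (span_set B A (leg_rel leg_cut)) (l, - q, p)"
      by (rule local_lag_leg[OF dual(4,3,2,1) smooth_on_leg_cut]) (use 2 in \<open>auto intro: leg_dom_neg\<close>)
    from local_lag_transform[OF this, of 1 "-1" "\<lambda>_. 0" 0 0]
    have "local_lag (span_set A B (\<lambda>a b \<theta>1 \<theta>2. leg_rel leg_cut b a (- \<theta>2) (- \<theta>1))) x"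
      unfolding span_set_swap by (simp add: x)
    then show ?thesis
      by (rule glue[OF _ half(2)[of "-1"]]) (use 2 in \<open>auto simp: pants_rel_leg2\<close>)
  next
    case 3
    \<comment> \<open>The basis dual to -A - B and B is -A' and B' - A'.\<close>
    have "local_lag (span_set (- A - B) B (leg_rel leg_cut)) (l, (1/2) *\<^sub>R A' - q, p)"
      by (rule local_lag_leg[where A' = "- A'" and B' = "B' - A'", OF _ _ _ _ smooth_on_leg_cut])
        (use 3 dual in \<open>auto intro: leg_dom_neg simp: inner_diff_left inner_diff_right\<close>)
    from local_lag_transform[OF this, of 1 "-1" "\<lambda>_. 0" "(1/2) *\<^sub>R A'" 0]
    have "local_lag (span_set A B (\<lambda>a b \<theta>1 \<theta>2. leg_rel leg_cut (- a) (b - a) (\<theta>1 + \<theta>2 - 1/2) (- \<theta>2))) x"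
      unfolding span_set_rotate[OF dual(1,2)] by (simp add: x)
    then show ?thesis
      by (rule glue[OF _ half(3)[of 1]]) (use 3 in \<open>auto simp: pants_rel_leg3\<close>)
  next
    case 4
    show ?thesis
      by (rule glue[OF local_lag_curve[OF dual], where U = "{(a, b). a > -2} \<inter> {(a, b). b > -2} \<inter> {(a, b). a < 2}"])
        (use 4 in \<open>auto intro!: open_Int half simp: pants_rel_centre\<close>)
  qed
qed

section \<open>Primitive vectors\<close>

lemma integral_vec_inner_Ints: "integral_vec a \<Longrightarrow> integral_vec b \<Longrightarrow> a \<bullet> b \<in> \<int>"
  by (auto simp: integral_vec_def inner_vec_def intro!: Ints_sum Ints_mult)

lemma integral_vec_add: "integral_vec a \<Longrightarrow> integral_vec b \<Longrightarrow> integral_vec (a + b)"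
  by (auto simp: integral_vec_def)

lemma integral_vec_diff: "integral_vec a \<Longrightarrow> integral_vec b \<Longrightarrow> integral_vec (a - b)"
  by (auto simp: integral_vec_def)

lemma integral_vec_scale: "c \<in> \<int> \<Longrightarrow> integral_vec b \<Longrightarrow> integral_vec (c *\<^sub>R b)"
  by (auto simp: integral_vec_def)

lemma integral_vec_uminus: "integral_vec a \<Longrightarrow> integral_vec (- a)"
  by (auto simp: integral_vec_def)

lemma primitive_vec_integral: "primitive_vec u \<Longrightarrow> integral_vec u"
  by (simp add: primitive_vec_def)

lemma primitive_vec_nz: "primitive_vec u \<Longrightarrow> u \<noteq> 0"
  by (auto simp: primitive_vec_def)

text \<open>The integers of the form m \<bullet> u form a subgroup. Its least positive element d
  divides every coordinate of u, since a remainder would be smaller, and primitivity gives d =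
  1.\<close>

lemma primitive_vec_bezout:
  assumes "primitive_vec u" obtains m where "integral_vec m" "m \<bullet> u = 1"
proof -
  define P where "P = (\<lambda>k::int. \<exists>m. integral_vec m \<and> m \<bullet> u = of_int k)"
  have u: "integral_vec u" using assms by (rule primitive_vec_integral)
  have P_comb: "P (a - c * b)" if ab: "P a" "P b" for a b c
  proof -
    obtain m m' where "integral_vec m" "m \<bullet> u = of_int a" "integral_vec m'" "m' \<bullet> u = of_int b"
      using ab unfolding P_def by blast
    then show ?thesis unfolding P_def
      by (intro exI[of _ "m - of_int c *\<^sub>R m'"])
        (auto intro!: integral_vec_diff integral_vec_scale simp: inner_diff_left)
  qed
  have Pu: "P \<lfloor>u $ i\<rfloor>" for i
  proof -
    have "axis i 1 \<bullet> u = of_int \<lfloor>u $ i\<rfloor>" using u by (simp add: integral_vec_def inner_axis')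
    moreover have "integral_vec (axis i 1 :: real^'a)" by (simp add: integral_vec_def axis_def)
    ultimately show ?thesis unfolding P_def by blast
  qed
  have P0: "P 0" unfolding P_def by (intro exI[of _ 0]) (simp add: integral_vec_def)
  have "\<exists>n>0. P (int n)"
  proof -
    obtain i where i: "u $ i \<noteq> 0" using primitive_vec_nz[OF assms] by (auto simp: vec_eq_iff)
    then have nz: "\<lfloor>u $ i\<rfloor> \<noteq> 0" using u by (auto simp: integral_vec_def elim!: allE[of _ i] Ints_cases)
    have "P (0 - (- 1) * \<lfloor>u $ i\<rfloor>)" "P (0 - 1 * \<lfloor>u $ i\<rfloor>)" by (intro P_comb P0 Pu)+
    then have "P (int (nat \<bar>\<lfloor>u $ i\<rfloor>\<bar>))" by (cases "\<lfloor>u $ i\<rfloor> \<ge> 0") auto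
    then show ?thesis using nz by (intro exI[of _ "nat \<bar>\<lfloor>u $ i\<rfloor>\<bar>"]) auto
  qed
  then obtain d where d: "d > 0" "P (int d)" "\<And>n. n < d \<Longrightarrow> \<not> (n > 0 \<and> P (int n))"
    using exists_least_iff[of "\<lambda>n. n > 0 \<and> P (int n)"] by blast
  have "int d dvd \<lfloor>u $ i\<rfloor>" for i
  proof -
    define k where "k = \<lfloor>u $ i\<rfloor> mod int d"
    have k: "0 \<le> k" "k < int d" using d(1) by (auto simp: k_def)
    have "P k" using P_comb[OF Pu d(2), of i "\<lfloor>u $ i\<rfloor> div int d"] by (simp add: k_def minus_div_mult_eq_mod)
    then have "k = 0" using d(3)[of "nat k"] k by force
    then show ?thesis by (simp add: k_def mod_eq_0_iff_dvd)
  qed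
  then have "int d dvd Gcd (range (\<lambda>i. \<lfloor>u $ i\<rfloor>))" by (intro Gcd_greatest) auto
  then have "d = 1" using assms by (simp add: primitive_vec_def)
  then show ?thesis using d(2) that by (auto simp: P_def)
qed

text \<open>Pairing with a Bezout vector of v shows that c is an integer, pairing with one of u that
  it divides 1.\<close>

lemma primitive_vec_unique:
  assumes "primitive_vec u" "primitive_vec v" "u = c *\<^sub>R v" "c > 0" shows "u = v"
proof -
  obtain m where m: "integral_vec m" "m \<bullet> v = 1" using primitive_vec_bezout[OF assms(2)] .
  obtain m' where m': "integral_vec m'" "m' \<bullet> u = 1" using primitive_vec_bezout[OF assms(1)] .
  have "c = m \<bullet> u" using m assms(3) by simp
  then have c: "c \<in> \<int>" using integral_vec_inner_Ints[OF m(1) primitive_vec_integral[OF assms(1)]] by simp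
  have "1 = c * (m' \<bullet> v)" using m'(2) assms(3) by simp
  moreover have "m' \<bullet> v \<in> \<int>" by (rule integral_vec_inner_Ints[OF m'(1) primitive_vec_integral[OF assms(2)]])
  ultimately obtain j where j: "1 = c * of_int j" by (auto elim: Ints_cases)
  obtain k where k: "c = of_int k" using c by (rule Ints_cases)
  have "of_int (k * j) = (1::real)" using j k by simp
  then have "k * j = 1" by (simp only: of_int_eq_1_iff)
  moreover have "k > 0" using k assms(4) by simp
  ultimately have "k = 1" using pos_zmult_eq_1_iff by blast
  then show ?thesis using k assms(3) by simp
qed

lemma primitive_vec_uminus: "primitive_vec u \<Longrightarrow> primitive_vec (- u)"
proof -
  assume u: "primitive_vec u"
  then have i: "integral_vec u" by (rule primitive_vec_integral)
  then have fl: "\<lfloor>(- u) $ i\<rfloor> = - \<lfloor>u $ i\<rfloor>" for i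
    by (auto simp: integral_vec_def elim!: allE[of _ i] Ints_cases)
  have "Gcd (range (\<lambda>i. \<lfloor>(- u) $ i\<rfloor>)) = Gcd (range (\<lambda>i. \<lfloor>u $ i\<rfloor>))"
  proof (rule zdvd_antisym_nonneg)
    show "Gcd (range (\<lambda>i. \<lfloor>(- u) $ i\<rfloor>)) dvd Gcd (range (\<lambda>i. \<lfloor>u $ i\<rfloor>))"
      by (intro Gcd_greatest) (metis (no_types, lifting) Gcd_dvd dvd_minus_iff fl imageE rangeI)
    show "Gcd (range (\<lambda>i. \<lfloor>u $ i\<rfloor>)) dvd Gcd (range (\<lambda>i. \<lfloor>(- u) $ i\<rfloor>))"
      by (intro Gcd_greatest) (metis (no_types, lifting) Gcd_dvd dvd_minus_iff fl imageE rangeI)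
  qed simp_all
  then show ?thesis using u integral_vec_uminus[OF i] by (simp add: primitive_vec_def)
qed

lemma primitive_vec_parallel:
  assumes "primitive_vec u" "primitive_vec v" "u = c *\<^sub>R v" shows "u = v \<or> u = - v"
proof -
  consider "c > 0" | "c < 0" | "c = 0" by linarith
  then show ?thesis
  proof cases
    case 2
    then have "u = (- c) *\<^sub>R (- v)" using assms(3) by simp
    then show ?thesis using primitive_vec_unique[OF assms(1) primitive_vec_uminus[OF assms(2)], of "- c"] 2 by simp
  qed (use assms primitive_vec_unique[OF assms] primitive_vec_nz[OF assms(1)] in auto)
qed

lemma dual_vec_exists:
  fixes A B :: "real^'n::finite"
  assumes "B \<noteq> 0" "\<And>c. A \<noteq> c *\<^sub>R B" obtains A' where "A' \<bullet> A = 1" "A' \<bullet> B = 0"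
proof -
  define A1 where "A1 = A - ((A \<bullet> B) / (B \<bullet> B)) *\<^sub>R B"
  have A1: "A1 \<noteq> 0" "A1 \<bullet> B = 0"
    using assms by (simp_all add: A1_def inner_diff_left)
  have "A1 \<bullet> A = A1 \<bullet> (A1 + ((A \<bullet> B) / (B \<bullet> B)) *\<^sub>R B)" by (simp add: A1_def)
  also have "\<dots> = A1 \<bullet> A1" using A1(2) by (simp add: inner_add_right)
  finally show ?thesis using A1 that[of "(1 / (A1 \<bullet> A1)) *\<^sub>R A1"] by simp
qed

definition independent_pair :: "real^'n::finite \<Rightarrow> real^'n \<Rightarrow> bool" where
  "independent_pair A B \<longleftrightarrow> A \<noteq> 0 \<and> B \<noteq> 0 \<and> (\<forall>c. A \<noteq> c *\<^sub>R B)"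

lemma independent_pair_dual:
  assumes "independent_pair A B"
  obtains A' B' where "A' \<bullet> A = 1" "A' \<bullet> B = 0" "B' \<bullet> A = 0" "B' \<bullet> B = 1"
proof -
  have "B \<noteq> c *\<^sub>R A" for c
  proof
    assume B: "B = c *\<^sub>R A"
    then have "c \<noteq> 0" using assms by (auto simp: independent_pair_def)
    then have "A = (1 / c) *\<^sub>R B" using B by simp
    then show False using assms by (simp only: independent_pair_def) blast
  qed
  then show ?thesis
    using assms dual_vec_exists[of B A] dual_vec_exists[of A B] that unfolding independent_pair_def by metis
qed

section \<open>Junctions\<close>

definition lattice_inv :: "(real \<times> (real^'n::finite) \<times> (real^'n)) set \<Rightarrow> bool" where
  "lattice_inv Y \<longleftrightarrow> (\<forall>l q p m. integral_vec m \<longrightarrow> (l, q, p) \<in> Y \<longrightarrow> (l, q + m, p) \<in> Y)"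

text \<open>Invariance lets the set descend to T*T^n, and the bound on the labels makes its
  projection proper there.\<close>

definition lag_set :: "(real \<times> (real^'n::finite) \<times> (real^'n)) set \<Rightarrow> bool" where
  "lag_set Y \<longleftrightarrow> (\<forall>x. local_lag Y x) \<and> lattice_inv Y \<and> (\<exists>M. \<forall>(l, q, p)\<in>Y. \<bar>l\<bar> \<le> M)"

lemma Ints_shift: "(a::real) \<in> \<int> \<Longrightarrow> x + a - y \<in> \<int> \<longleftrightarrow> x - y \<in> \<int>"
  by (metis Ints_add Ints_diff add.commute add_diff_cancel_left' diff_add_eq diff_diff_eq2)

lemma exp_cplx_coord_shift: "k \<in> \<int> \<Longrightarrow> exp (cplx_coord (a, \<theta> + k)) = exp (cplx_coord (a, \<theta>))"
proof -
  assume "k \<in> \<int>"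
  then obtain n where "k = of_int n" by (rule Ints_cases)
  then have "cplx_coord (a, \<theta> + k) = cplx_coord (a, \<theta>) + (of_int (2 * n) * pi) * \<i>"
    by (simp add: cplx_coord_def complex_eq_iff algebra_simps)
  then show ?thesis unfolding exp_eq by blast
qed

lemma leg_rel_shift:
  assumes "j \<in> \<int>" "k \<in> \<int>" shows "leg_rel \<kappa> a b (\<theta>1 + j) (\<theta>2 + k) \<longleftrightarrow> leg_rel \<kappa> a b \<theta>1 \<theta>2"
proof -
  note e = exp_cplx_coord_shift[OF assms(2), of a \<theta>2]
  have "leg_X \<kappa> (a, \<theta>2 + k) = leg_X \<kappa> (a, \<theta>2)" "leg_Y \<kappa> (a, \<theta>2 + k) = leg_Y \<kappa> (a, \<theta>2)"
    by (simp_all add: leg_X_def leg_Y_def leg_K_def leg_H_def e)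
  moreover have "(a, \<theta>2 + k) \<in> leg_dom \<longleftrightarrow> (a, \<theta>2) \<in> leg_dom" by (simp add: leg_dom_def strip_def e)
  ultimately show ?thesis by (simp add: leg_rel_def Ints_shift[OF assms(1)])
qed

lemma curve_rel_shift:
  assumes "j \<in> \<int>" "k \<in> \<int>" shows "curve_rel a b (\<theta>1 + j) (\<theta>2 + k) \<longleftrightarrow> curve_rel a b \<theta>1 \<theta>2"
  using exp_cplx_coord_shift[OF assms(2), of a \<theta>2] exp_cplx_coord_shift[OF Ints_minus[OF assms(1)], of b "- \<theta>1"]
  by (simp add: curve_rel_def cplx_coord_def algebra_simps)

lemma pants_rel_shift:
  assumes "j \<in> \<int>" "k \<in> \<int>" shows "pants_rel a b (\<theta>1 + j) (\<theta>2 + k) \<longleftrightarrow> pants_rel a b \<theta>1 \<theta>2"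
  using assms leg_rel_shift[of j k leg_cut a b \<theta>1 \<theta>2] curve_rel_shift[of j k a b \<theta>1 \<theta>2]
    leg_rel_shift[of "- k" "- j" leg_cut b a "- \<theta>2" "- \<theta>1"]
    leg_rel_shift[of "j + k" "- k" leg_cut "- a" "b - a" "\<theta>1 + \<theta>2 - 1/2" "- \<theta>2"]
  unfolding pants_rel_def by (simp add: algebra_simps)

lemma lattice_inv_pants:
  assumes "integral_vec A" "integral_vec B" shows "lattice_inv (span_set A B pants_rel)"
  unfolding lattice_inv_def
proof (intro allI impI)
  fix l q p and m :: "real^'a" assume m: "integral_vec m" and x: "(l, q, p) \<in> span_set A B pants_rel"
  obtain a b where x: "l = 0" "p = a *\<^sub>R A + b *\<^sub>R B" "pants_rel a b (q \<bullet> A) (q \<bullet> B)"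
    using x by (auto simp: span_set_def)
  have "pants_rel a b ((q + m) \<bullet> A) ((q + m) \<bullet> B)"
    unfolding inner_add_left
    by (subst pants_rel_shift) (use x m assms integral_vec_inner_Ints in auto)
  then show "(l, q + m, p) \<in> span_set A B pants_rel" using x by (auto simp: span_set_def)
qed

lemma lattice_inv_image:
  assumes "lattice_inv Y" shows "lattice_inv ((\<lambda>(l, q, p). (l + h p, q, f p)) ` Y)"
  unfolding lattice_inv_def
proof (intro allI impI)
  fix l q p' and m :: "real^'a" assume m: "integral_vec m" and "(l, q, p') \<in> (\<lambda>(l, q, p). (l + h p, q, f p)) ` Y"
  then obtain l0 p where "(l0, q, p) \<in> Y" "l = l0 + h p" "p' = f p" by auto
  moreover from this have "(l0, q + m, p) \<in> Y" using assms m by (auto simp: lattice_inv_def)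
  ultimately show "(l, q + m, p') \<in> (\<lambda>(l, q, p). (l + h p, q, f p)) ` Y"
    by (intro image_eqI[of _ _ "(l0, q + m, p)"]) auto
qed

section \<open>Tubes over plane curves\<close>

definition tube :: "real^'n::finite \<Rightarrow> (real \<Rightarrow> real) \<Rightarrow> (real \<Rightarrow> real) \<Rightarrow> (real \<Rightarrow> real) \<Rightarrow>
    (real \<times> (real^'n) \<times> (real^'n)) set" where
  "tube g x y lb = {(lb t, q, y t *\<^sub>R g) | t q. q \<bullet> g - x t \<in> \<int>}"

lemma lattice_inv_tube: "integral_vec g \<Longrightarrow> lattice_inv (tube g x y lb)"
  unfolding lattice_inv_def tube_def
  by (auto simp: inner_add_left Ints_shift[OF integral_vec_inner_Ints])

text \<open>The curve (x, y) lies in the cylinder with coordinates q \<bullet> g modulo 1 and p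
  along g; the remaining directions of q are free. A curve in a surface is automatically Lagrangian,
  so the assumptions only make the parameter recoverable. It is the case B = 0, Y = 0 of
  \<open>local_lag_param\<close>.\<close>

lemma local_lag_tube:
  fixes g :: "real^'n::finite" and \<tau> :: "real \<times> (real^'n) \<times> (real^'n) \<Rightarrow> real"
  assumes "g \<noteq> 0" and sm: "smooth_on UNIV x" "smooth_on UNIV y" and lb: "continuous_on UNIV lb"
    and left: "\<And>t. \<mu> * x t + \<nu> * y t + \<gamma> = t"
    and \<tau>: "continuous_on UNIV \<tau>" "\<And>t q. \<tau> (lb t, q, y t *\<^sub>R g) = t"
  shows "local_lag (tube g x y lb) z"
proof -
  obtain l q p where z: "z = (l, q, p)" by (cases z)
  have eq: "tube g x y lb = {(lb (fst (t, q \<bullet> 0)), q, y (fst (t, q \<bullet> 0)) *\<^sub>R g + 0 *\<^sub>R 0) | t q.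
      (t, q \<bullet> (0::real^'n)) \<in> UNIV \<and> q \<bullet> g - x (fst (t, q \<bullet> (0::real^'n))) \<in> \<int>}"
    by (simp add: tube_def)
  have fr: "frechet_derivative (\<lambda>z. f (fst z)) (at z) h = fst h * frechet_derivative f (at (fst z)) 1"
    if "smooth_on UNIV f" for f :: "real \<Rightarrow> real" and z h :: "real \<times> real"
  proof (rule has_derivative_frechet_eq)
    have f: "(f has_derivative frechet_derivative f (at (fst z))) (at (fst z))"
      using smooth_on_has_derivative[OF that] by simp
    interpret bounded_linear "frechet_derivative f (at (fst z))" by (rule has_derivative_bounded_linear[OF f])
    have "frechet_derivative f (at (fst z)) (fst h) = fst h * frechet_derivative f (at (fst z)) 1" for h :: "real \<times> real"
      using scaleR[of "fst h" 1] by simp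
    then show "((\<lambda>z. f (fst z)) has_derivative (\<lambda>h. fst h * frechet_derivative f (at (fst z)) 1)) (at z)"
      using has_derivative_compose[OF bounded_linear_imp_has_derivative[OF bounded_linear_fst, of "at z"] f] by simp
  qed
  have fst: "smooth_on UNIV (\<lambda>z::real \<times> real. f (fst z))" if "smooth_on UNIV f" for f :: "real \<Rightarrow> real"
    by (rule smooth_on_compose[OF open_UNIV _ smooth_on_bounded_linear[OF bounded_linear_fst] that]) auto
  show ?thesis
    unfolding eq z
  proof (rule local_lag_param[where X = "\<lambda>z. x (fst z)" and W = "\<lambda>z. y (fst z)" and Y = "\<lambda>_. 0"
        and lb = "\<lambda>z. lb (fst z)" and A' = "(1 / (g \<bullet> g)) *\<^sub>R g" and \<tau> = \<tau> and \<mu> = \<mu> and \<nu> = \<nu> and \<gamma> = \<gamma>])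
    show "continuous_on UNIV (\<lambda>z. lb (fst z))"
      by (rule continuous_on_compose2[OF lb]) (auto intro: continuous_intros)
  qed (use assms in \<open>auto simp: fr fst frechet_derivative_const\<close>)
qed

section \<open>Junctions with prescribed legs far out\<close>

definition leg_at ::
  "real^'n::finite \<Rightarrow> real \<Rightarrow> real \<Rightarrow> real \<Rightarrow> real^'n \<Rightarrow> real^'n \<Rightarrow> bool" where
  "leg_at g c h l q p \<longleftrightarrow> (\<exists>s>0. p = s *\<^sub>R g) \<and> q \<bullet> g - c \<in> \<int> \<and> l = h"

lemma leg_at_label: "leg_at g c h l q p \<longleftrightarrow> leg_at g c 0 0 q p \<and> l = h"
  by (auto simp: leg_at_def)

lemma tube_iff: "(l, q, p) \<in> tube g x y lb \<longleftrightarrow> (\<exists>t. l = lb t \<and> p = y t *\<^sub>R g \<and> q \<bullet> g - x t \<in> \<int>)"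
  unfolding tube_def by auto

lemma junction2:
  fixes g :: "real^'n::finite"
  assumes "integral_vec g" "g \<noteq> 0"
  shows "\<exists>Y. lag_set Y \<and> (\<forall>l q p. p \<noteq> 0 \<longrightarrow>
           (l, q, p) \<in> Y \<longleftrightarrow> leg_at g 0 0 l q p \<or> leg_at (- g) 0 0 l q p)"
proof (intro exI conjI allI impI)
  let ?Y = "tube g (\<lambda>_. 0) (\<lambda>t. t) (\<lambda>_. 0)"
  have "local_lag ?Y z" for z
    by (rule local_lag_tube[where \<mu> = 0 and \<nu> = 1 and \<gamma> = 0 and
          \<tau> = "\<lambda>x. snd (snd x) \<bullet> ((1 / (g \<bullet> g)) *\<^sub>R g)"])
      (use assms in \<open>auto intro!: continuous_intros smooth_on_bounded_linear[OF bounded_linear_ident]\<close>)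
  moreover have "lattice_inv ?Y" by (rule lattice_inv_tube[OF assms(1)])
  moreover have "\<forall>(l, q, p)\<in>?Y. \<bar>l\<bar> \<le> 0" by (auto simp: tube_def)
  ultimately show "lag_set ?Y" unfolding lag_set_def by blast
  fix l q and p :: "real^'n" assume "p \<noteq> 0"
  then show "(l, q, p) \<in> ?Y \<longleftrightarrow> leg_at g 0 0 l q p \<or> leg_at (- g) 0 0 l q p"
    unfolding tube_iff leg_at_def
  proof (intro iffI)
    assume "\<exists>t. l = 0 \<and> p = t *\<^sub>R g \<and> q \<bullet> g - 0 \<in> \<int>"
    then obtain t where t: "l = 0" "p = t *\<^sub>R g" "q \<bullet> g \<in> \<int>" by auto
    then consider "t > 0" | "- t > 0" using \<open>p \<noteq> 0\<close> by fastforce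
    then show "((\<exists>s>0. p = s *\<^sub>R g) \<and> q \<bullet> g - 0 \<in> \<int> \<and> l = 0) \<or>
        ((\<exists>s>0. p = s *\<^sub>R (- g)) \<and> q \<bullet> (- g) - 0 \<in> \<int> \<and> l = 0)"
    proof cases
      case 1 then show ?thesis using t by auto
    next
      case 2
      then have "\<exists>s>0. p = s *\<^sub>R (- g)" using t by (intro exI[of _ "- t"]) simp
      then show ?thesis using t by simp
    qed
  next
    assume "((\<exists>s>0. p = s *\<^sub>R g) \<and> q \<bullet> g - 0 \<in> \<int> \<and> l = 0) \<or>
        ((\<exists>s>0. p = s *\<^sub>R (- g)) \<and> q \<bullet> (- g) - 0 \<in> \<int> \<and> l = 0)"
    then show "\<exists>t. l = 0 \<and> p = t *\<^sub>R g \<and> q \<bullet> g - 0 \<in> \<int>"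
    proof
      assume "(\<exists>s>0. p = s *\<^sub>R (- g)) \<and> q \<bullet> (- g) - 0 \<in> \<int> \<and> l = 0"
      then obtain s where "p = s *\<^sub>R (- g)" "q \<bullet> g \<in> \<int>" "l = 0" by auto
      then show ?thesis by (intro exI[of _ "- s"]) simp
    qed auto
  qed
qed

lemma independent_pair_uminus: "independent_pair A B \<Longrightarrow> independent_pair (- A) (- B)"
  unfolding independent_pair_def by (metis neg_equal_iff_equal neg_equal_0_iff_equal scaleR_minus_right)

context
  fixes A B A' B' :: "real^'n::finite"
  assumes dual: "A' \<bullet> A = 1" "A' \<bullet> B = 0" "B' \<bullet> A = 0" "B' \<bullet> B = 1"
begin

lemma pants_far:
  assumes "norm p > 4 * (norm A + norm B)"
  shows "(l, q, p) \<in> span_set A B pants_rel \<longleftrightarrow> leg_at (- A) 0 0 l q p \<or> leg_at (- B) 0 0 l q p \<or>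
     leg_at (A + B) (1/2) 0 l q p" (is "?L \<longleftrightarrow> ?R")
proof
  assume ?L
  then obtain a b where ab: "l = 0" "p = a *\<^sub>R A + b *\<^sub>R B" "pants_rel a b (q \<bullet> A) (q \<bullet> B)"
    by (auto simp: span_set_def)
  have "\<not> (\<bar>a\<bar> \<le> 4 \<and> \<bar>b\<bar> \<le> 4)"
  proof
    assume "\<bar>a\<bar> \<le> 4 \<and> \<bar>b\<bar> \<le> 4"
    then have "\<bar>a\<bar> * norm A + \<bar>b\<bar> * norm B \<le> 4 * norm A + 4 * norm B"
      by (intro add_mono mult_right_mono) auto
    moreover have "norm p \<le> \<bar>a\<bar> * norm A + \<bar>b\<bar> * norm B"
      using norm_triangle_ineq[of "a *\<^sub>R A" "b *\<^sub>R B"] by (simp add: ab(2))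
    ultimately show False using assms by simp
  qed
  from ab(3)[unfolded pants_rel_far[OF this]] show ?R
  proof (elim disjE conjE)
    assume "a < 0" "b = 0" "q \<bullet> A \<in> \<int>"
    then have "leg_at (- A) 0 0 l q p" using ab by (auto simp: leg_at_def intro!: exI[of _ "- a"])
    then show ?R by blast
  next
    assume "b < 0" "a = 0" "q \<bullet> B \<in> \<int>"
    then have "leg_at (- B) 0 0 l q p" using ab by (auto simp: leg_at_def intro!: exI[of _ "- b"])
    then show ?R by blast
  next
    assume "a = b" "a > 0" "q \<bullet> A + q \<bullet> B - 1/2 \<in> \<int>"
    then have "leg_at (A + B) (1/2) 0 l q p"
      using ab by (auto simp: leg_at_def inner_add_right scaleR_add_right intro!: exI[of _ a])
    then show ?R by blast
  qed
next
  assume R: ?R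
  have big: "s > 4" if "p = s *\<^sub>R g" "s > 0" "norm g \<le> norm A + norm B" for s g
  proof -
    have "4 * norm g < s * norm g" using assms that by simp
    then show ?thesis by (simp add: mult_less_cancel_right)
  qed
  from R show ?L
  proof (elim disjE)
    assume "leg_at (- A) 0 0 l q p"
    then obtain s where s: "s > 0" "p = s *\<^sub>R (- A)" "q \<bullet> A \<in> \<int>" "l = 0" by (auto simp: leg_at_def)
    then have "s > 4" by (intro big[of s "- A"]) auto
    then have "pants_rel (- s) 0 (q \<bullet> A) (q \<bullet> B)" using s by (subst pants_rel_far) auto
    then show ?L using s span_set_comb[OF dual, of q "- s" 0] by simp
  next
    assume "leg_at (- B) 0 0 l q p"
    then obtain s where s: "s > 0" "p = s *\<^sub>R (- B)" "q \<bullet> B \<in> \<int>" "l = 0" by (auto simp: leg_at_def)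
    then have "s > 4" by (intro big[of s "- B"]) auto
    then have "pants_rel 0 (- s) (q \<bullet> A) (q \<bullet> B)" using s by (subst pants_rel_far) auto
    then show ?L using s span_set_comb[OF dual, of q 0 "- s"] by simp
  next
    assume "leg_at (A + B) (1/2) 0 l q p"
    then obtain s where s: "s > 0" "p = s *\<^sub>R (A + B)" "q \<bullet> (A + B) - 1/2 \<in> \<int>" "l = 0" by (auto simp: leg_at_def)
    then have "s > 4" by (intro big[of s "A + B"]) (auto simp: norm_triangle_ineq)
    then have "pants_rel s s (q \<bullet> A) (q \<bullet> B)" using s by (subst pants_rel_far) (auto simp: inner_add_right)
    then show ?L using s span_set_comb[OF dual, of q s s] by (simp add: scaleR_add_right)
  qed
qed

text \<open>Far out, the larger coordinate of p is 0 on the legs along -A and -B and equals the ray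
  parameter on the leg along A + B. So its level m > 4 meets the third leg only, and it can serve as
  a label in \<open>junction4\<close>.\<close>

lemma pants_leg3:
  assumes "m > 4"
  shows "(0, q, p) \<in> span_set A B pants_rel \<and> max (p \<bullet> A') (p \<bullet> B') = m \<longleftrightarrow>
    p = m *\<^sub>R (A + B) \<and> q \<bullet> (A + B) - 1/2 \<in> \<int>" (is "?L \<longleftrightarrow> ?R")
proof
  assume L: ?L
  then have ab: "p = (p \<bullet> A') *\<^sub>R A + (p \<bullet> B') *\<^sub>R B" "pants_rel (p \<bullet> A') (p \<bullet> B') (q \<bullet> A) (q \<bullet> B)"
    "max (p \<bullet> A') (p \<bullet> B') = m"
    by (auto simp: span_set_iff[OF dual])
  then have "\<not> (\<bar>p \<bullet> A'\<bar> \<le> 4 \<and> \<bar>p \<bullet> B'\<bar> \<le> 4)" using assms by auto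
  from ab(2)[unfolded pants_rel_far[OF this]]
  have "p \<bullet> A' = p \<bullet> B'" "q \<bullet> (A + B) - 1/2 \<in> \<int>" using ab(3) assms by (auto simp: inner_add_right)
  then show ?R using ab(1,3) by (simp add: scaleR_add_right)
next
  assume R: ?R
  then have p: "p = m *\<^sub>R A + m *\<^sub>R B" by (simp add: scaleR_add_right)
  have "pants_rel m m (q \<bullet> A) (q \<bullet> B)" using R assms by (subst pants_rel_far) (auto simp: inner_add_right)
  then show ?L using p by (simp add: span_set_comb[OF dual] dual_comb[OF dual])
qed

text \<open>Bounds the labels of \<open>junction4\<close> on the side that is not cut off
  there.\<close>

lemma pants_max_lower:
  assumes "(0, q, p) \<in> span_set A B pants_rel" shows "max (p \<bullet> A') (p \<bullet> B') \<ge> -4"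
proof (cases "\<bar>p \<bullet> A'\<bar> \<le> 4 \<and> \<bar>p \<bullet> B'\<bar> \<le> 4")
  case False
  have "pants_rel (p \<bullet> A') (p \<bullet> B') (q \<bullet> A) (q \<bullet> B)" using assms by (auto simp: span_set_iff[OF dual])
  from this[unfolded pants_rel_far[OF False]] show ?thesis by auto
qed auto

end

lemma junction3:
  fixes A B :: "real^'n::finite"
  assumes "integral_vec A" "integral_vec B" "independent_pair A B"
  shows "\<exists>Y r. lag_set Y \<and> r > 0 \<and> (\<forall>l q p. norm p > r \<longrightarrow>
    ((l, q, p) \<in> Y \<longleftrightarrow> leg_at A 0 0 l q p \<or> leg_at B 0 0 l q p \<or> leg_at (- A - B) (1/2) 0 l q p))"
proof -
  obtain A' B' where dual: "A' \<bullet> (- A) = 1" "A' \<bullet> (- B) = 0" "B' \<bullet> (- A) = 0" "B' \<bullet> (- B) = 1"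
    using independent_pair_dual[OF independent_pair_uminus[OF assms(3)]] .
  let ?Y = "span_set (- A) (- B) pants_rel"
  have "lattice_inv ?Y" by (intro lattice_inv_pants integral_vec_uminus assms)
  moreover have "\<forall>(l, q, p)\<in>?Y. \<bar>l\<bar> \<le> 0" by (auto simp: span_set_def)
  ultimately have "lag_set ?Y"
    unfolding lag_set_def using local_lag_pants[OF dual] by blast
  moreover have "4 * (norm (- A) + norm (- B)) > 0" using assms(3) by (simp add: independent_pair_def add_pos_pos)
  ultimately show ?thesis using pants_far[OF dual] by (intro exI[of _ ?Y] exI[of _ "4 * (norm (- A) + norm (- B))"]) simp
qed

lemma continuous_on_max_inner:
  "continuous_on UNIV (\<lambda>p::real^'n::finite. max (p \<bullet> A) (p \<bullet> B))"
  by (intro continuous_intros)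

text \<open>Two pairs of pants at the same vertex, whose legs in the directions \<open>f = A + B\<close> and
  \<open>-f = C + D\<close> are joined by a tube over an S-shaped immersed curve in the \<open>(q \<bullet> f, p)\<close>-cylinder.
  The label \<open>l\<close> decreases strictly along the tube, so the three parts are separated by \<open>l\<close>.\<close>

lemma junction4:
  fixes g1 g2 g3 g4 :: "real^'n::finite"
  assumes int: "integral_vec g1" "integral_vec g2" "integral_vec g3" "integral_vec g4"
    and ind: "independent_pair g1 g2" "independent_pair g3 g4" and sum: "g1 + g2 + g3 + g4 = 0"
  shows "\<exists>Y r. lag_set Y \<and> r > 0 \<and> (\<forall>l q p. norm p > r \<longrightarrow>
    ((l, q, p) \<in> Y \<longleftrightarrow> leg_at g1 0 5 l q p \<or> leg_at g2 0 5 l q p \<or> leg_at g3 0 (-6) l q p \<or> leg_at g4 0 (-6) l q p))"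
proof -
  \<comment> \<open>The signs come from \<open>pants_rel\<close>, which has its legs along -A, -B
    and A + B.\<close>
  define A B C D f where "A = - g1" "B = - g2" "C = - g3" "D = - g4" "f = A + B"
  note defs = this
  have "g3 + g4 = - (g1 + g2)" using sum by (metis add.assoc add_eq_0_iff)
  moreover have "C + D = - (g3 + g4)" "f = - (g1 + g2)" by (simp_all add: defs)
  ultimately have CD: "C + D = - f" by simp
  obtain A' B' where dA: "A' \<bullet> A = 1" "A' \<bullet> B = 0" "B' \<bullet> A = 0" "B' \<bullet> B = 1"
    using independent_pair_dual[OF independent_pair_uminus[OF ind(1)]] unfolding defs by blast
  obtain C' D' where dC: "C' \<bullet> C = 1" "C' \<bullet> D = 0" "D' \<bullet> C = 0" "D' \<bullet> D = 1"
    using independent_pair_dual[OF independent_pair_uminus[OF ind(2)]] unfolding defs by blast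
  have fA: "f \<bullet> A' = 1" using dA by (simp add: defs(5) inner_add_left inner_commute[of A] inner_commute[of B])
  then have f: "f \<noteq> 0" by auto
  have intf: "integral_vec f" using int unfolding defs by (intro integral_vec_add integral_vec_uminus)
  \<comment> \<open>Far out these labels are 5 on the legs g1, g2 and -6 on g3, g4. Along the legs
    in directions f and -f they approach each other and match the label -t of the tube.\<close>
  define h1 h2 where "h1 = (\<lambda>p. 5 - max (p \<bullet> A') (p \<bullet> B'))" "h2 = (\<lambda>p. max (p \<bullet> C') (p \<bullet> D') - 6)"
  define Y1 where "Y1 = (\<lambda>(l, q, p). (l + h1 p, q, p)) ` span_set A B pants_rel"
  define Y2 where "Y2 = (\<lambda>(l, q, p). (l + h2 p, q, p)) ` span_set C D pants_rel"
  \<comment> \<open>At t = 0 the curve has climbed to y = 5; by t = 1 it has dropped to -5, from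
    where it climbs again, and x has gone once around the circle from 1/2 to 3/2. Since 11 x + y = t
    + 21/2, it is immersed.\<close>
  define x y where "x = (\<lambda>t. 1/2 + smooth_step t)" "y = (\<lambda>t. t + 5 - 11 * smooth_step t)"
  define Tb where "Tb = tube f x y uminus"
  have Y1: "local_lag Y1 z" for z
    using local_lag_transform_all[OF local_lag_pants[OF dA], of 1 1 h1 0 0 z]
    unfolding Y1_def h1_h2_def by (simp add: continuous_on_max_inner continuous_on_diff)
  have Y2: "local_lag Y2 z" for z
    using local_lag_transform_all[OF local_lag_pants[OF dC], of 1 1 h2 0 0 z]
    unfolding Y2_def h1_h2_def by (simp add: continuous_on_max_inner continuous_on_diff)
  have sm: "smooth_on UNIV x" "smooth_on UNIV y"
    unfolding x_y_def
    by (intro smooth_on_add smooth_on_diff smooth_on_mult smooth_on_const smooth_on_step open_UNIV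
        smooth_on_bounded_linear[OF bounded_linear_ident])+
  have Tb: "local_lag Tb z" for z
    unfolding Tb_def
    by (rule local_lag_tube[where \<mu> = 11 and \<nu> = 1 and \<gamma> = "-21/2" and \<tau> = "\<lambda>x. - fst x", OF f sm])
      (auto intro!: continuous_intros simp: x_y_def)
  have inv: "lattice_inv Y1" "lattice_inv Y2" "lattice_inv Tb"
    unfolding Y1_def Y2_def Tb_def using int intf
    by (auto intro!: lattice_inv_image[where f = "\<lambda>p. p"] lattice_inv_pants lattice_inv_tube integral_vec_uminus simp: defs)
  have mem1: "(l, q, p) \<in> Y1 \<longleftrightarrow> (0, q, p) \<in> span_set A B pants_rel \<and> l = h1 p" for l q p
    unfolding Y1_def by (auto simp: span_set_def image_iff)
  have mem2: "(l, q, p) \<in> Y2 \<longleftrightarrow> (0, q, p) \<in> span_set C D pants_rel \<and> l = h2 p" for l q p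
    unfolding Y2_def by (auto simp: span_set_def image_iff)
  have memT: "(l, q, p) \<in> Tb \<longleftrightarrow> p = y (- l) *\<^sub>R f \<and> q \<bullet> f - x (- l) \<in> \<int>" for l q p
    unfolding Tb_def tube_iff by (auto intro: exI[of _ "- l"])
  have eq1: "(l, q, p) \<in> Y1 \<longleftrightarrow> (l, q, p) \<in> Tb" if "0 < l" "l < 1" for l q p
  proof -
    have "(l, q, p) \<in> Y1 \<longleftrightarrow> (0, q, p) \<in> span_set A B pants_rel \<and> max (p \<bullet> A') (p \<bullet> B') = 5 - l"
      unfolding mem1 h1_h2_def by auto
    also have "\<dots> \<longleftrightarrow> p = (5 - l) *\<^sub>R f \<and> q \<bullet> f - 1/2 \<in> \<int>"
      using pants_leg3[OF dA, of "5 - l" q p] that by (simp add: defs(5))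
    also have "\<dots> \<longleftrightarrow> (l, q, p) \<in> Tb" using that by (simp add: memT x_y_def smooth_step_0)
    finally show ?thesis .
  qed
  have eq2: "(l, q, p) \<in> Y2 \<longleftrightarrow> (l, q, p) \<in> Tb" if "-2 < l" "l < -1" for l q p
  proof -
    have "(l, q, p) \<in> Y2 \<longleftrightarrow> (0, q, p) \<in> span_set C D pants_rel \<and> max (p \<bullet> C') (p \<bullet> D') = l + 6"
      unfolding mem2 h1_h2_def by auto
    also have "\<dots> \<longleftrightarrow> p = (l + 6) *\<^sub>R (C + D) \<and> q \<bullet> (C + D) - 1/2 \<in> \<int>"
      using that by (intro pants_leg3[OF dC]) simp
    also have "\<dots> \<longleftrightarrow> p = (- l - 6) *\<^sub>R f \<and> - (q \<bullet> f) - 1/2 \<in> \<int>"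
      unfolding CD by (simp add: scaleR_left_diff_distrib scaleR_left_distrib)
    \<comment> \<open>The phase 1/2 along -f is -1/2 along f, which modulo 1 is the end value 3/2 of
      x.\<close>
    also have "- (q \<bullet> f) - 1/2 \<in> \<int> \<longleftrightarrow> q \<bullet> f - 3/2 \<in> \<int>"
    proof -
      have "- (q \<bullet> f) - 1/2 = - (q \<bullet> f + 1 - 1/2)" "q \<bullet> f - 3/2 = q \<bullet> f + (-2) - (-1/2)" by simp_all
      moreover have "q \<bullet> f + 1 - 1/2 = q \<bullet> f + 0 - (-1/2)" by simp
      ultimately show ?thesis
        using Ints_shift[of "-2" "q \<bullet> f" "-1/2"] Ints_shift[of 0 "q \<bullet> f" "-1/2"] by (metis Ints_0 Ints_minus Ints_numeral minus_in_Ints_iff)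
    qed
    also have "p = (- l - 6) *\<^sub>R f \<and> q \<bullet> f - 3/2 \<in> \<int> \<longleftrightarrow> (l, q, p) \<in> Tb"
    proof -
      have "y (- l) = - l - 6" "x (- l) = 3/2" using that by (simp_all add: x_y_def smooth_step_1)
      then show ?thesis by (simp only: memT)
    qed
    finally show ?thesis .
  qed
  \<comment> \<open>The three ranges of l overlap in (0, 1) and (-2, -1), where the pieces coincide
    by \<open>eq1\<close> and \<open>eq2\<close>.\<close>
  define J where "J = {(l, q, p). 0 < l \<and> (l, q, p) \<in> Y1 \<or> -2 < l \<and> l < 1 \<and> (l, q, p) \<in> Tb \<or> l < -1 \<and> (l, q, p) \<in> Y2}"
  have J: "local_lag J z" for z
  proof -
    obtain l q p where z: "z = (l, q, p)" by (cases z)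
    have o: "open {z::real \<times> (real^'n) \<times> (real^'n). fst z \<in> U}" if "open U" for U
      using open_vimage[OF that, of fst] by (simp add: vimage_def continuous_on_fst)
    consider "0 < l" | "-2 < l" "l < 1" | "l < -1" by linarith
    then show ?thesis
    proof cases
      case 1
      show ?thesis
        by (rule local_lag_cong[OF Y1 o[of "{0<..}"]]) (use 1 eq1 z in \<open>auto simp: J_def\<close>)
    next
      case 2
      show ?thesis
        by (rule local_lag_cong[OF Tb o[of "{-2<..<1}"]]) (use 2 eq1 eq2 z in \<open>auto simp: J_def\<close>)
    next
      case 3
      show ?thesis
        by (rule local_lag_cong[OF Y2 o[of "{..<-1}"]]) (use 3 eq2 z in \<open>auto simp: J_def\<close>)
    qed
  qed
  have "lattice_inv J" using inv unfolding lattice_inv_def J_def by blast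
  moreover have "\<bar>l\<bar> \<le> 10" if "(l, q, p) \<in> J" for l q p
    using that pants_max_lower[OF dA, of q p] pants_max_lower[OF dC, of q p]
    by (auto simp: J_def mem1 mem2 h1_h2_def)
  ultimately have lag: "lag_set J" unfolding lag_set_def using J by blast
  define r where "r = 4 * (norm A + norm B) + 4 * (norm C + norm D) + 20 * norm f"
  have r: "r > 0" using f by (simp add: r_def add_nonneg_pos)
  have far: "(l, q, p) \<in> J \<longleftrightarrow> leg_at g1 0 5 l q p \<or> leg_at g2 0 5 l q p \<or> leg_at g3 0 (-6) l q p \<or> leg_at g4 0 (-6) l q p"
    if p: "norm p > r" for l q p
  proof -
    have nn: "norm A \<ge> 0" "norm B \<ge> 0" "norm C \<ge> 0" "norm D \<ge> 0" "norm f \<ge> 0" by simp_all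
    have "4 * (a + b) < P \<and> 4 * (c + d) < P \<and> 20 * e < P"
      if "4 * (a + b) + 4 * (c + d) + 20 * e < P" "a \<ge> 0" "b \<ge> 0" "c \<ge> 0" "d \<ge> 0" "e \<ge> 0" for a b c d e P :: real
      using that by auto
    from this[OF p[unfolded r_def] nn] have pA: "norm p > 4 * (norm A + norm B)"
      and pC: "norm p > 4 * (norm C + norm D)" and pf: "norm p > 20 * norm f" by auto
    have small: "\<not> (\<exists>s. p = s *\<^sub>R f \<and> \<bar>s\<bar> \<le> 20)"
    proof
      assume "\<exists>s. p = s *\<^sub>R f \<and> \<bar>s\<bar> \<le> 20"
      then obtain s where "p = s *\<^sub>R f" "\<bar>s\<bar> \<le> 20" by blast
      then have "norm p \<le> 20 * norm f" by (simp add: mult_right_mono)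
      then show False using pf by simp
    qed
    have noT: "\<not> (-2 < l \<and> l < 1 \<and> (l, q, p) \<in> Tb)"
    proof
      assume a: "-2 < l \<and> l < 1 \<and> (l, q, p) \<in> Tb"
      have "\<bar>y (- l)\<bar> \<le> 20" using a smooth_step_range[of "- l"] by (auto simp: x_y_def)
      then show False using a small by (auto simp: memT)
    qed
    have s1: "0 < l \<and> (l, q, p) \<in> Y1 \<longleftrightarrow> leg_at g1 0 5 l q p \<or> leg_at g2 0 5 l q p"
    proof -
      have h: "leg_at (- A) 0 0 0 q p \<Longrightarrow> h1 p = 5" "leg_at (- B) 0 0 0 q p \<Longrightarrow> h1 p = 5"
        using dA by (auto simp: leg_at_def h1_h2_def inner_commute[of A] inner_commute[of B])
      \<comment> \<open>The third leg is followed only while its label is positive, that is for s <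
        5; this part lies inside radius r.\<close>
      have n: "\<not> (leg_at f (1/2) 0 0 q p \<and> 0 < h1 p)"
      proof
        assume "leg_at f (1/2) 0 0 q p \<and> 0 < h1 p"
        then obtain s where s: "s > 0" "p = s *\<^sub>R f" "0 < h1 p" by (auto simp: leg_at_def)
        then have "s < 5" using fA by (simp add: h1_h2_def)
        then show False using small s by auto
      qed
      show ?thesis
        unfolding mem1 pants_far[OF dA pA] defs(5)[symmetric] leg_at_label[of g1 0 5] leg_at_label[of g2 0 5]
        using h n by (auto simp: defs(1,2))
    qed
    have s2: "l < -1 \<and> (l, q, p) \<in> Y2 \<longleftrightarrow> leg_at g3 0 (-6) l q p \<or> leg_at g4 0 (-6) l q p"
    proof -
      have h: "leg_at (- C) 0 0 0 q p \<Longrightarrow> h2 p = -6" "leg_at (- D) 0 0 0 q p \<Longrightarrow> h2 p = -6"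
        using dC by (auto simp: leg_at_def h1_h2_def inner_commute[of C] inner_commute[of D])
      have n: "\<not> (leg_at (C + D) (1/2) 0 0 q p \<and> h2 p < -1)"
      proof
        assume "leg_at (C + D) (1/2) 0 0 q p \<and> h2 p < -1"
        then obtain s where s: "s > 0" "p = s *\<^sub>R (C + D)" "h2 p < -1" by (auto simp: leg_at_def)
        have "(C + D) \<bullet> C' = 1" using dC by (simp add: inner_add_left inner_commute[of C] inner_commute[of D])
        then have "s < 5" using s by (simp add: h1_h2_def)
        moreover have "p = (- s) *\<^sub>R f" using s by (simp add: CD)
        ultimately show False using small s by fastforce
      qed
      show ?thesis
        unfolding mem2 pants_far[OF dC pC] leg_at_label[of g3 0 "-6"] leg_at_label[of g4 0 "-6"]
        using h n by (auto simp: defs(3,4))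
    qed
    show ?thesis using s1 s2 noT unfolding J_def by blast
  qed
  show ?thesis using lag r far by blast
qed

lemma independent_pair_primitive:
  assumes "primitive_vec u" "primitive_vec v" "u \<noteq> v" "u \<noteq> - v" "a \<noteq> 0" "b \<noteq> 0"
  shows "independent_pair (a *\<^sub>R u) (b *\<^sub>R v)"
  unfolding independent_pair_def
proof (intro conjI allI)
  fix c show "a *\<^sub>R u \<noteq> c *\<^sub>R b *\<^sub>R v"
  proof
    assume "a *\<^sub>R u = c *\<^sub>R b *\<^sub>R v"
    then have "u = (c * b / a) *\<^sub>R v" using assms(5) by (metis divide_inverse_commute eq_vector_fraction_iff scaleR_scaleR vector_fraction_eq_iff)
    then show False using primitive_vec_parallel[OF assms(1,2)] assms(3,4) by blast
  qed
qed (use assms primitive_vec_nz in auto)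

lemma lag_set_empty: "lag_set {}"
  by (auto simp: lag_set_def lattice_inv_def intro: local_lag_outside)

text \<open>Balancing rules out a single leg, forces two legs to be opposite and makes any two of
  three legs independent. Four legs are grouped into two pairs, neither of them opposite.\<close>

lemma junction_legs:
  fixes u :: "'i \<Rightarrow> real^'n::finite" and w :: "'i \<Rightarrow> nat"
  assumes fin: "finite I" and card: "card I \<le> 4" and prim: "\<And>i. i \<in> I \<Longrightarrow> primitive_vec (u i)"
    and inj: "inj_on u I" and w: "\<And>i. i \<in> I \<Longrightarrow> w i > 0" and sum: "(\<Sum>i\<in>I. real (w i) *\<^sub>R u i) = 0"
  shows "\<exists>Y r c h. lag_set Y \<and> r > 0 \<and> (\<forall>l q p. norm p > r \<longrightarrow>
     ((l, q, p) \<in> Y \<longleftrightarrow> (\<exists>i\<in>I. leg_at (real (w i) *\<^sub>R u i) (c i) (h i) l q p)))"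
proof -
  let ?g = "\<lambda>i. real (w i) *\<^sub>R u i"
  have int: "integral_vec (?g i)" if "i \<in> I" for i
    using prim[OF that] by (intro integral_vec_scale primitive_vec_integral) auto
  have nz: "?g i \<noteq> 0" if "i \<in> I" for i using w[OF that] primitive_vec_nz[OF prim[OF that]] by simp
  have neq: "u i \<noteq> u j" if "i \<in> I" "j \<in> I" "i \<noteq> j" for i j using inj that by (auto dest: inj_onD)
  have ind: "independent_pair (?g i) (?g j)" if "i \<in> I" "j \<in> I" "i \<noteq> j" "u i \<noteq> - u j" for i j
    using prim neq w that by (intro independent_pair_primitive) force+
  have four: ?thesis if I: "I = {i, j, k, m}" "distinct [i, j, k, m]" and anti: "u i \<noteq> - u j" "u k \<noteq> - u m" for i j k m
  proof -
    have s: "?g i + ?g j + ?g k + ?g m = 0" using sum I by (simp add: add.assoc)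
    have ip: "independent_pair (?g i) (?g j)" "independent_pair (?g k) (?g m)"
      using ind I anti by auto
    have iv: "integral_vec (?g i)" "integral_vec (?g j)" "integral_vec (?g k)" "integral_vec (?g m)"
      using int I by auto
    obtain Y r where "lag_set Y" "r > 0" and far: "\<forall>l q p. norm p > r \<longrightarrow> ((l, q, p) \<in> Y \<longleftrightarrow>
        leg_at (?g i) 0 5 l q p \<or> leg_at (?g j) 0 5 l q p \<or> leg_at (?g k) 0 (-6) l q p \<or> leg_at (?g m) 0 (-6) l q p)"
      using junction4[OF iv ip s] by blast
    moreover have "k \<noteq> i" "k \<noteq> j" "m \<noteq> i" "m \<noteq> j" using I by auto
    ultimately show ?thesis using I
      by - (rule exI[of _ Y], rule exI[of _ r],
          rule exI[of _ "\<lambda>_. 0"], rule exI[of _ "\<lambda>n. if n \<in> {i, j} then 5 else -6"], simp)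
  qed
  consider "card I = 0" | "card I = 1" | "card I = 2" | "card I = 3" | "card I = 4" using card by linarith
  then show ?thesis
  proof cases
    case 1
    then show ?thesis using fin lag_set_empty by (intro exI[of _ "{}"] exI[of _ 1]) auto
  next
    case 2
    then obtain i where "I = {i}" by (auto simp: card_1_singleton_iff)
    then show ?thesis using sum nz by auto
  next
    case 3
    then obtain i j where I: "I = {i, j}" "i \<noteq> j" by (auto simp: card_2_iff)
    then have gj: "?g j = - ?g i" using sum by (simp add: eq_neg_iff_add_eq_0 add.commute)
    obtain Y where Y: "lag_set Y" "\<forall>l q p. p \<noteq> 0 \<longrightarrow> ((l, q, p) \<in> Y \<longleftrightarrow>
        leg_at (?g i) 0 0 l q p \<or> leg_at (- ?g i) 0 0 l q p)"
      using junction2[OF int[of i] nz[of i]] I by blast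
    have "(l, q, p) \<in> Y \<longleftrightarrow> (\<exists>m\<in>I. leg_at (?g m) 0 0 l q p)" if "norm p > 1" for l q p
    proof -
      have "p \<noteq> 0" using that by auto
      then show ?thesis unfolding I using Y(2) by (simp only: gj bex_simps simp_thms)
    qed
    then show ?thesis using Y(1)
      by - (rule exI[of _ Y], rule exI[of _ 1], rule exI[of _ "\<lambda>_. 0"], rule exI[of _ "\<lambda>_. 0"], simp)
  next
    case 4
    then obtain i j k where I: "I = {i, j, k}" "i \<noteq> j" "j \<noteq> k" "i \<noteq> k" by (auto simp: card_3_iff)
    have s: "?g i + ?g j + ?g k = 0" using sum I by (simp add: add.assoc)
    \<comment> \<open>If two of the three directions were opposite, balancing would make the third
      parallel to them, hence equal to one of them.\<close>
    have "u i \<noteq> - u j"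
    proof
      assume a: "u i = - u j"
      have "?g k = - (?g i + ?g j)"
        unfolding eq_neg_iff_add_eq_0 using s by (simp only: add.commute[of "?g k"])
      then have "real (w k) *\<^sub>R u k = (real (w i) - real (w j)) *\<^sub>R u j" unfolding a by (simp add: algebra_simps)
      then have "u k = ((real (w i) - real (w j)) / real (w k)) *\<^sub>R u j"
        using w[of k] I(1) by (simp add: eq_vector_fraction_iff)
      then have "u k = u j \<or> u k = - u j" using primitive_vec_parallel prim I(1) by blast
      then show False using neq[of k j] neq[of i k] I a by auto
    qed
    then have ip: "independent_pair (?g i) (?g j)" using ind I by auto
    have "?g k = - (?g i + ?g j)"
      unfolding eq_neg_iff_add_eq_0 using s by (simp only: add.commute[of "?g k"])
    then have "- ?g i - ?g j = ?g k" by simp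
    then obtain Y r where "lag_set Y" "r > 0" "\<forall>l q p. norm p > r \<longrightarrow> ((l, q, p) \<in> Y \<longleftrightarrow>
        leg_at (?g i) 0 0 l q p \<or> leg_at (?g j) 0 0 l q p \<or> leg_at (?g k) (1/2) 0 l q p)"
      using junction3[OF int[of i] int[of j] ip] I by auto
    then show ?thesis using I
      by - (rule exI[of _ Y], rule exI[of _ r],
          rule exI[of _ "\<lambda>n. if n = k then 1/2 else 0"], rule exI[of _ "\<lambda>_. 0"], simp)
  next
    case 5
    then obtain i I' where "I = insert i I'" "i \<notin> I'" "card I' = 3"
      using card_eq_SucD[of I 3] by auto
    then obtain j k m where I: "I = {i, j, k, m}" "distinct [i, j, k, m]" by (auto simp: card_3_iff)
    show ?thesis
    proof (cases "u i \<noteq> - u j \<and> u k \<noteq> - u m")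
      case True
      then show ?thesis using four I by blast
    next
      case False
      have "I = {i, k, j, m}" "distinct [i, k, j, m]" using I by auto
      \<comment> \<open>A vector has only one opposite: with j opposite to i, or m opposite to k,
        the pairs i, k and j, m are not opposite, since the four directions are distinct.\<close>
      moreover have "u i \<noteq> - u k \<and> u j \<noteq> - u m"
        using False neq[of k j] neq[of i m] I by (auto simp: I(1))
      ultimately show ?thesis using four by blast
    qed
  qed
qed

section \<open>Separating the parallel conormals of a weighted leg\<close>

lemma Ints_split:
  fixes a c :: real
  assumes "w > 0" shows "real w * a - c \<in> \<int> \<longleftrightarrow> (\<exists>k<w. a - (c + real k) / real w \<in> \<int>)"
proof
  assume "real w * a - c \<in> \<int>"
  then obtain m where m: "real w * a - c = of_int m" by (rule Ints_cases)
  define k where "k = nat (m mod int w)"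
  have k: "int k = m mod int w" "k < w" using assms by (auto simp: k_def nat_less_iff)
  have "m = int w * (m div int w) + int k" using k by simp
  then have "real_of_int m = real w * of_int (m div int w) + real k" by (metis of_int_add of_int_mult of_int_of_nat_eq)
  then have "a - (c + real k) / real w = of_int (m div int w)"
    using m assms by (simp add: field_simps)
  then show "\<exists>k<w. a - (c + real k) / real w \<in> \<int>" using k(2) by (intro exI[of _ k]) simp
next
  assume "\<exists>k<w. a - (c + real k) / real w \<in> \<int>"
  then obtain k where k: "a - (c + real k) / real w \<in> \<int>" by blast
  have "real w * a - c = real w * (a - (c + real k) / real w) + real k" using assms by (simp add: field_simps)
  then show "real w * a - c \<in> \<int>" using k by auto
qed

text \<open>Just outside radius r the leg along w u is the union of w conormals of u with phases (c
  + k) / w, by \<open>Ints_split\<close>. Each is continued by a tube along which the phase moves to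
  0 and the label to k + 1 while \<kappa> grows from 0 to 1.\<close>

lemma junction_split:
  fixes u :: "'i \<Rightarrow> real^'n::finite" and w :: "'i \<Rightarrow> nat"
  assumes fin: "finite I" and prim: "\<And>i. i \<in> I \<Longrightarrow> primitive_vec (u i)"
    and inj: "inj_on u I" and w: "\<And>i. i \<in> I \<Longrightarrow> w i > 0"
    and Y: "lag_set Y" "r > 0" and legs: "\<And>l q p. norm p > r \<Longrightarrow>
     ((l, q, p) \<in> Y \<longleftrightarrow> (\<exists>i\<in>I. leg_at (real (w i) *\<^sub>R u i) (c i) (h i) l q p))"
  shows "\<exists>J. lag_set J \<and> (\<forall>l q p. norm p > r + 2 \<longrightarrow>
     ((l, q, p) \<in> J \<longleftrightarrow> (\<exists>i\<in>I. \<exists>k<w i. leg_at (u i) 0 (real k + 1) l q p)))"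
proof -
  define K where "K = Sigma I (\<lambda>i. {..<w i})"
  have K: "finite K" using fin by (simp add: K_def)
  \<comment> \<open>In terms of norm p, \<kappa> is 0 up to r + 1, which leaves the shell between r
    and r + 1 for gluing with \<open>Y\<close>, and it is 1 from r + 2 on.\<close>
  define \<kappa> where "\<kappa> = (\<lambda>i s. smooth_step (s * norm (u i) - r - 1))"
  define x where "x = (\<lambda>(i, k) s. (c i + real k) / real (w i) * (1 - \<kappa> i s))"
  define lb where "lb = (\<lambda>(i, k) s. h i + \<kappa> i s * (real k + 1 - h i))"
  define T where "T = (\<lambda>j. tube (u (fst j)) (x j) (\<lambda>t. t) (lb j))"
  \<comment> \<open>The tube runs along the full line through 0, of which only the ray in direction
    u belongs to the leg.\<close>
  define V where "V = (\<lambda>j. T j \<inter> {(l, q, p). p \<bullet> u (fst j) > 0})"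
  have sm\<kappa>: "smooth_on UNIV (\<kappa> i)" for i
    unfolding \<kappa>_def
    by (rule smooth_on_compose[OF open_UNIV _ _ smooth_on_step])
      (auto intro!: smooth_on_diff smooth_on_mult smooth_on_bounded_linear[OF bounded_linear_ident])
  have unz: "u i \<noteq> 0" if "i \<in> I" for i using primitive_vec_nz prim that by blast
  have memV: "(l, q, p) \<in> V j \<longleftrightarrow> (\<exists>s>0. l = lb j s \<and> p = s *\<^sub>R u (fst j) \<and> q \<bullet> u (fst j) - x j s \<in> \<int>)"
    if "j \<in> K" for l q p j
    using unz[of "fst j"] that by (auto simp: V_def T_def tube_iff K_def zero_less_mult_iff leD[OF inner_ge_zero])
  have locT: "local_lag (T j) z" if "j \<in> K" for j z
    unfolding T_def
  proof (rule local_lag_tube[where \<mu> = 0 and \<nu> = 1 and \<gamma> = 0 and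
        \<tau> = "\<lambda>x. snd (snd x) \<bullet> ((1 / (u (fst j) \<bullet> u (fst j))) *\<^sub>R u (fst j))"])
    show "u (fst j) \<noteq> 0" using unz that by (auto simp: K_def)
    then show "snd (snd (lb j t, q, t *\<^sub>R u (fst j))) \<bullet> ((1 / (u (fst j) \<bullet> u (fst j))) *\<^sub>R u (fst j)) = t" for t q
      by simp
    show "smooth_on UNIV (x j)" unfolding x_def case_prod_beta
      by (intro smooth_on_mult smooth_on_diff smooth_on_const sm\<kappa> open_UNIV)
    show "continuous_on UNIV (lb j)" unfolding lb_def case_prod_beta
      by (intro continuous_intros smooth_on_continuous_on sm\<kappa>)
  qed (use unz that in \<open>auto intro!: continuous_intros smooth_on_bounded_linear[OF bounded_linear_ident]
      simp: K_def\<close>)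
  have locV: "local_lag (V j) (l, q, p)" if j: "j \<in> K" and p: "p \<noteq> 0" for j l q p
  proof (cases "p \<bullet> u (fst j) > 0")
    case True
    show ?thesis
    proof (rule local_lag_cong[OF locT[OF j]])
      show "open {z::real \<times> (real^'n) \<times> (real^'n). 0 < snd (snd z) \<bullet> u (fst j)}"
        by (intro open_Collect_less continuous_intros)
    qed (use True in \<open>auto simp: V_def\<close>)
  next
    case False
    have u: "u (fst j) \<noteq> 0" using unz j by (auto simp: K_def)
    \<comment> \<open>On \<open>V j\<close> the vectors p and u point the same way, so p \<bullet> u
      = norm p * norm u. The strict inequality is an open condition that excludes
      \<open>V j\<close>.\<close>
    show ?thesis
    proof (rule local_lag_empty)
      show "open {z::real \<times> (real^'n) \<times> (real^'n). snd (snd z) \<bullet> u (fst j) < norm (snd (snd z)) * norm (u (fst j))}"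
        by (intro open_Collect_less continuous_intros)
      have "norm p * norm (u (fst j)) > 0" using p u by simp
      then show "(l, q, p) \<in> {z. snd (snd z) \<bullet> u (fst j) < norm (snd (snd z)) * norm (u (fst j))}"
        using False by simp
      show "V j \<inter> {z. snd (snd z) \<bullet> u (fst j) < norm (snd (snd z)) * norm (u (fst j))} = {}"
        by (auto simp: memV[OF j] dot_square_norm power2_eq_square abs_mult)
    qed
  qed
  have disj: "i = j" if ij: "i \<in> K" "j \<in> K" "z \<in> V i" "z \<in> V j" for i j z
  proof -
    obtain l q p where z: "z = (l, q, p)" by (cases z)
    obtain s where s: "s > 0" "l = lb i s" "p = s *\<^sub>R u (fst i)" "q \<bullet> u (fst i) - x i s \<in> \<int>"
      using ij(3) memV[OF ij(1)] z by blast
    obtain t where t: "t > 0" "l = lb j t" "p = t *\<^sub>R u (fst j)" "q \<bullet> u (fst j) - x j t \<in> \<int>"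
      using ij(4) memV[OF ij(2)] z by blast
    have I: "fst i \<in> I" "fst j \<in> I" using ij by (auto simp: K_def)
    have "s *\<^sub>R u (fst i) = t *\<^sub>R u (fst j)" using s(3) t(3) by simp
    then have "u (fst i) = (t / s) *\<^sub>R u (fst j)" using s(1) by (simp add: eq_vector_fraction_iff)
    then have "u (fst i) = u (fst j)" using primitive_vec_unique[OF prim prim] I s(1) t(1) by simp
    then have f: "fst i = fst j" using inj I by (auto dest: inj_onD)
    then have st: "s = t" using s(3) t(3) unz[OF I(1)] by simp
    obtain m k k' where m: "i = (m, k)" "j = (m, k')" using f by (cases i, cases j) auto
    have k: "k < w m" "k' < w m" using ij m by (auto simp: K_def)
    \<comment> \<open>The labels of two tubes over the same ray differ by \<kappa> (k - k'). Where
      \<kappa> vanishes the labels agree, and the phases, which differ by a multiple of 1/w that is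
      not an integer, take over.\<close>
    have eq: "\<kappa> m s * (real k - real k') = 0"
      using s(2) t(2) st m by (auto simp: lb_def algebra_simps)
    have "k = k'"
    proof (cases "\<kappa> m s = 0")
      case True
      have "(real k - real k') / real (w m) \<in> \<int>"
      proof -
        have "(real k - real k') / real (w m) = (q \<bullet> u m - x j s) - (q \<bullet> u m - x i s)"
          using True by (simp add: m x_def add_divide_distrib diff_divide_distrib)
        then show ?thesis using s(4) t(4) st m by (metis Ints_diff fst_conv)
      qed
      moreover have "\<bar>(real k - real k') / real (w m)\<bar> < 1" using k by (simp add: abs_less_iff field_simps)
      ultimately have "(real k - real k') / real (w m) = 0" by (rule Ints_nonzero_abs_less1)
      then show ?thesis using k by simp
    qed (use eq in simp)
    then show ?thesis using m by simp
  qed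
  define W where "W = (\<Union>j\<in>K. V j)"
  have locW: "local_lag W (l, q, p)" if "p \<noteq> 0" for l q p
    unfolding W_def by (rule local_lag_UN[OF K locV[OF _ that]]) (use disj in blast)+
  have overlap: "(l, q, p) \<in> Y \<longleftrightarrow> (l, q, p) \<in> W" if p: "r < norm p" "norm p < r + 1" for l q p
  proof -
    have "(l, q, p) \<in> W \<longleftrightarrow> (\<exists>i\<in>I. \<exists>k<w i. (l, q, p) \<in> V (i, k))" by (auto simp: W_def K_def)
    also have "\<dots> \<longleftrightarrow> (\<exists>i\<in>I. \<exists>k<w i. \<exists>s>0. l = h i \<and> p = s *\<^sub>R u i \<and> q \<bullet> u i - (c i + real k) / real (w i) \<in> \<int>)"
    proof (intro bex_cong refl ex_cong1 conj_cong)
      fix i k assume i: "i \<in> I" "k < w i"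
      then have ik: "(i, k) \<in> K" by (simp add: K_def)
      have "lb (i, k) s = h i \<and> x (i, k) s = (c i + real k) / real (w i)" if "s > 0" "p = s *\<^sub>R u i" for s
      proof -
        have "\<kappa> i s = 0" unfolding \<kappa>_def using that p by (intro smooth_step_0) simp
        then show ?thesis by (simp add: lb_def x_def)
      qed
      then show "(l, q, p) \<in> V (i, k) \<longleftrightarrow>
          (\<exists>s>0. l = h i \<and> p = s *\<^sub>R u i \<and> q \<bullet> u i - (c i + real k) / real (w i) \<in> \<int>)"
        unfolding memV[OF ik] by auto
    qed
    also have "\<dots> \<longleftrightarrow> (\<exists>i\<in>I. leg_at (real (w i) *\<^sub>R u i) (c i) (h i) l q p)"
    proof (intro bex_cong refl)
      fix i assume i: "i \<in> I"
      have "(\<exists>s>0. p = s *\<^sub>R u i) \<longleftrightarrow> (\<exists>s>0. p = s *\<^sub>R real (w i) *\<^sub>R u i)"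
      proof
        assume "\<exists>s>0. p = s *\<^sub>R u i"
        then obtain s where "s > 0" "p = s *\<^sub>R u i" by blast
        then show "\<exists>s>0. p = s *\<^sub>R real (w i) *\<^sub>R u i" using w[OF i] by (intro exI[of _ "s / real (w i)"]) simp
      next
        assume "\<exists>s>0. p = s *\<^sub>R real (w i) *\<^sub>R u i"
        then obtain s where "s > 0" "p = s *\<^sub>R real (w i) *\<^sub>R u i" by blast
        then show "\<exists>s>0. p = s *\<^sub>R u i" using w[OF i] by (intro exI[of _ "s * real (w i)"]) simp
      qed
      then show "(\<exists>k<w i. \<exists>s>0. l = h i \<and> p = s *\<^sub>R u i \<and> q \<bullet> u i - (c i + real k) / real (w i) \<in> \<int>) \<longleftrightarrow>
          leg_at (real (w i) *\<^sub>R u i) (c i) (h i) l q p"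
        unfolding leg_at_def using Ints_split[OF w[OF i], of "q \<bullet> u i" "c i"] by auto
    qed
    finally show ?thesis using legs[OF p(1)] by simp
  qed
  define J where "J = {(l, q, p). norm p < r + 1 \<and> (l, q, p) \<in> Y \<or> norm p > r \<and> (l, q, p) \<in> W}"
  have "local_lag J z" for z
  proof -
    obtain l q p where z: "z = (l, q, p)" by (cases z)
    show ?thesis
    proof (cases "norm p < r + 1")
      case True
      have o: "open {z::real \<times> (real^'n) \<times> (real^'n). norm (snd (snd z)) < r + 1}"
        by (intro open_Collect_less continuous_intros)
      have "local_lag Y z" using Y(1) unfolding lag_set_def by blast
      then show ?thesis
        by (rule local_lag_cong[OF _ o]) (use True z overlap in \<open>auto simp: J_def\<close>)
    next
      case False
      have o: "open {z::real \<times> (real^'n) \<times> (real^'n). r < norm (snd (snd z))}"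
        by (intro open_Collect_less continuous_intros)
      have "p \<noteq> 0" using False Y(2) by auto
      then have "local_lag W z" using locW z by simp
      then show ?thesis
        by (rule local_lag_cong[OF _ o]) (use False z overlap in \<open>auto simp: J_def\<close>)
    qed
  qed
  moreover have "lattice_inv J"
  proof -
    have T: "lattice_inv (T j)" if "j \<in> K" for j
      unfolding T_def using that by (intro lattice_inv_tube primitive_vec_integral prim) (auto simp: K_def)
    have "lattice_inv Y" using Y by (simp add: lag_set_def)
    then show ?thesis
      using T unfolding lattice_inv_def J_def W_def V_def by (simp only: mem_Collect_eq case_prod_conv Int_iff UN_iff) metis
  qed
  moreover have "\<exists>M. \<forall>(l, q, p)\<in>J. \<bar>l\<bar> \<le> M"
  proof -
    obtain M where M: "\<And>l q p. (l, q, p) \<in> Y \<Longrightarrow> \<bar>l\<bar> \<le> M" using Y unfolding lag_set_def by blast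
    define b where "b = (\<lambda>(i, k). 2 * \<bar>h i\<bar> + real k + 1)"
    have b0: "b j \<ge> 0" for j by (auto simp: b_def case_prod_beta)
    have "\<bar>l\<bar> \<le> sum b K" if lW: "(l, q, p) \<in> W" for l q p
    proof -
      obtain j where j: "j \<in> K" "(l, q, p) \<in> V j" using lW unfolding W_def by blast
      then obtain s where s: "l = lb j s" using memV by blast
      obtain i k where ik: "j = (i, k)" by (cases j)
      have "\<bar>\<kappa> i s * (real k + 1 - h i)\<bar> \<le> 1 * \<bar>real k + 1 - h i\<bar>"
        unfolding abs_mult \<kappa>_def using smooth_step_range by (intro mult_right_mono) auto
      then have "\<bar>l\<bar> \<le> b j" unfolding s ik lb_def b_def by auto
      also have "b j \<le> sum b K" using K j(1) b0 by (intro member_le_sum) auto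
      finally show ?thesis .
    qed
    then have "\<bar>l\<bar> \<le> max M (sum b K)" if "(l, q, p) \<in> J" for l q p
      using that M by (fastforce simp: J_def)
    then show ?thesis by blast
  qed
  ultimately have "lag_set J" by (simp add: lag_set_def)
  moreover have "(l, q, p) \<in> J \<longleftrightarrow> (\<exists>i\<in>I. \<exists>k<w i. leg_at (u i) 0 (real k + 1) l q p)" if p: "norm p > r + 2" for l q p
  proof -
    have "(l, q, p) \<in> J \<longleftrightarrow> (\<exists>i\<in>I. \<exists>k<w i. (l, q, p) \<in> V (i, k))" using p by (auto simp: J_def W_def K_def)
    also have "\<dots> \<longleftrightarrow> (\<exists>i\<in>I. \<exists>k<w i. leg_at (u i) 0 (real k + 1) l q p)"
    proof (intro bex_cong refl ex_cong1 conj_cong)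
      fix i k assume i: "i \<in> I" "k < w i"
      then have ik: "(i, k) \<in> K" by (simp add: K_def)
      have "lb (i, k) s = real k + 1 \<and> x (i, k) s = 0" if "s > 0" "p = s *\<^sub>R u i" for s
      proof -
        have "\<kappa> i s = 1" unfolding \<kappa>_def using that p by (intro smooth_step_1) simp
        then show ?thesis by (simp add: lb_def x_def)
      qed
      then show "(l, q, p) \<in> V (i, k) \<longleftrightarrow> leg_at (u i) 0 (real k + 1) l q p"
        unfolding memV[OF ik] leg_at_def by auto
    qed
    finally show ?thesis .
  qed
  ultimately show ?thesis by blast
qed

text \<open>A leg is a cone in p with a condition on q alone, so scaling p preserves it and shrinks
  the radius r + 2 to \<epsilon>.\<close>

lemma junction_exists:
  fixes u :: "'i \<Rightarrow> real^'n::finite" and w :: "'i \<Rightarrow> nat"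
  assumes "finite I" "card I \<le> 4" "\<And>i. i \<in> I \<Longrightarrow> primitive_vec (u i)" "inj_on u I"
    and "\<And>i. i \<in> I \<Longrightarrow> w i > 0" "(\<Sum>i\<in>I. real (w i) *\<^sub>R u i) = 0" and "\<epsilon> > 0"
  shows "\<exists>J. lag_set J \<and> (\<forall>l q p. norm p > \<epsilon> \<longrightarrow>
     ((l, q, p) \<in> J \<longleftrightarrow> (\<exists>i\<in>I. \<exists>k<w i. leg_at (u i) 0 (real k + 1) l q p)))"
proof -
  obtain Y r c h where Y: "lag_set Y" "r > 0" "\<And>l q p. norm p > r \<Longrightarrow>
     ((l, q, p) \<in> Y \<longleftrightarrow> (\<exists>i\<in>I. leg_at (real (w i) *\<^sub>R u i) (c i) (h i) l q p))"
    using junction_legs[OF assms(1-6)] by blast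
  obtain J where J: "lag_set J" "\<And>l q p. norm p > r + 2 \<Longrightarrow>
     ((l, q, p) \<in> J \<longleftrightarrow> (\<exists>i\<in>I. \<exists>k<w i. leg_at (u i) 0 (real k + 1) l q p))"
    using junction_split[OF assms(1,3-5) Y] by blast
  define \<delta> where "\<delta> = \<epsilon> / (r + 2)"
  have \<delta>: "\<delta> > 0" using assms(7) Y(2) by (simp add: \<delta>_def)
  define S where "S = (\<lambda>(l, q, p). (l + 0, 1 *\<^sub>R q + 0, \<delta> *\<^sub>R p + 0)) ` J"
  have mem: "(l, q, p) \<in> S \<longleftrightarrow> (l, q, (1 / \<delta>) *\<^sub>R p) \<in> J" for l q p
    using \<delta> unfolding S_def by (force simp: image_iff)
  have "local_lag S z" for z
    unfolding S_def using J(1) \<delta> unfolding lag_set_def by (intro local_lag_transform_all) auto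
  moreover have "lattice_inv S" using J(1) by (auto simp: lag_set_def lattice_inv_def mem)
  moreover have "\<exists>M. \<forall>(l, q, p)\<in>S. \<bar>l\<bar> \<le> M"
  proof -
    obtain M where "\<And>l q p. (l, q, p) \<in> J \<Longrightarrow> \<bar>l\<bar> \<le> M" using J(1) unfolding lag_set_def by blast
    then show ?thesis by (intro exI[of _ M]) (auto simp: mem)
  qed
  ultimately have "lag_set S" by (simp add: lag_set_def)
  moreover have "(l, q, p) \<in> S \<longleftrightarrow> (\<exists>i\<in>I. \<exists>k<w i. leg_at (u i) 0 (real k + 1) l q p)" if p: "norm p > \<epsilon>" for l q p
  proof -
    have "(r + 2) * \<epsilon> < (r + 2) * norm p" using p Y(2) by (intro mult_strict_left_mono) auto
    then have "norm ((1 / \<delta>) *\<^sub>R p) > r + 2"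
      using assms(7) Y(2) by (simp add: \<delta>_def field_simps)
    moreover have "leg_at (u i) 0 m l q ((1 / \<delta>) *\<^sub>R p) \<longleftrightarrow> leg_at (u i) 0 m l q p" for i m
    proof -
      have "(\<exists>s>0. (1 / \<delta>) *\<^sub>R p = s *\<^sub>R u i) \<longleftrightarrow> (\<exists>s>0. p = s *\<^sub>R u i)"
      proof
        assume "\<exists>s>0. (1 / \<delta>) *\<^sub>R p = s *\<^sub>R u i"
        then obtain s where s: "s > 0" "(1 / \<delta>) *\<^sub>R p = s *\<^sub>R u i" by blast
        have "p = \<delta> *\<^sub>R (1 / \<delta>) *\<^sub>R p" using \<delta> by simp
        also have "\<dots> = (\<delta> * s) *\<^sub>R u i" by (simp only: s(2) scaleR_scaleR)
        finally show "\<exists>s>0. p = s *\<^sub>R u i" using s(1) \<delta> by (intro exI[of _ "\<delta> * s"]) simp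
      next
        assume "\<exists>s>0. p = s *\<^sub>R u i"
        then obtain s where s: "s > 0" "p = s *\<^sub>R u i" by blast
        then show "\<exists>s>0. (1 / \<delta>) *\<^sub>R p = s *\<^sub>R u i" using \<delta> by (intro exI[of _ "s / \<delta>"]) simp
      qed
      then show ?thesis by (simp add: leg_at_def)
    qed
    ultimately show ?thesis unfolding mem using J(2) by simp
  qed
  ultimately show ?thesis by blast
qed

section \<open>From sets with labels to immersed manifolds\<close>

lemma quot_eq_iff: "quot (q, p) = quot (q', p') \<longleftrightarrow> p = p' \<and> integral_vec (q - q')"
proof -
  have "cis (2 * pi * x) = cis (2 * pi * y) \<longleftrightarrow> x - y \<in> \<int>" for x y :: real
  proof -
    have "cis (2 * pi * x) = cis (2 * pi * y) \<longleftrightarrow> (\<exists>n::int. 2 * pi * x = 2 * pi * y + 2 * of_int n * pi)"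
      unfolding cis_conv_exp exp_eq by (simp add: complex_eq_iff)
    also have "\<dots> \<longleftrightarrow> (\<exists>n::int. x - y = of_int n)"
    proof (intro ex_cong1)
      fix n :: int
      have "2 * pi * x = 2 * pi * y + 2 * of_int n * pi \<longleftrightarrow> (2 * pi) * (x - y - of_int n) = 0"
        by (auto simp: algebra_simps)
      also have "\<dots> \<longleftrightarrow> x - y = of_int n" by simp
      finally show "2 * pi * x = 2 * pi * y + 2 * of_int n * pi \<longleftrightarrow> x - y = of_int n" .
    qed
    also have "\<dots> \<longleftrightarrow> x - y \<in> \<int>" by (auto elim: Ints_cases)
    finally show ?thesis .
  qed
  then show ?thesis by (auto simp: quot_def vec_eq_iff integral_vec_def)
qed

lemma snd_quot [simp]: "snd (quot z) = snd z"
  by (simp add: quot_def)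

lemma continuous_on_quot: "continuous_on UNIV (quot :: (real^'n::finite) \<times> (real^'n) \<Rightarrow> _)"
  unfolding quot_def cis_conv_exp
  by (intro continuous_intros continuous_on_vec_lambda)

text \<open>A branch of the inverse of the torus covering, centred at q0. Its coordinates differ
  from those of q0 by at most 1/2, and it is continuous away from the points opposite to q0 in some
  coordinate.\<close>

definition unq :: "real^'n::finite \<Rightarrow> complex^'n \<Rightarrow> real^'n" where
  "unq q0 z = (\<chi> j. q0 $ j + Arg (z $ j / cis (2 * pi * q0 $ j)) / (2 * pi))"

definition unq_dom :: "real^'n::finite \<Rightarrow> (complex^'n) set" where
  "unq_dom q0 = {z. \<forall>j. z $ j / cis (2 * pi * q0 $ j) \<notin> \<real>\<^sub>\<le>\<^sub>0}"

lemma open_unq_dom: "open (unq_dom q0)"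
proof -
  have "unq_dom q0 = (\<Inter>j. (\<lambda>z. z $ j / cis (2 * pi * q0 $ j)) -` (- \<real>\<^sub>\<le>\<^sub>0))" by (auto simp: unq_dom_def)
  moreover have "open \<dots>"
    by (intro open_INT ballI finite open_vimage open_Compl closed_nonpos_Reals_complex continuous_intros) auto
  ultimately show ?thesis by simp
qed

lemma continuous_on_unq: "continuous_on (unq_dom q0) (unq q0)"
proof -
  have A: "continuous_on (unq_dom q0) (\<lambda>z. Arg (z $ j / cis (2 * pi * q0 $ j)))" for j
    by (rule continuous_on_compose2[OF continuous_on_Arg])
      (auto simp: unq_dom_def intro!: continuous_intros)
  show ?thesis
    unfolding unq_def
    by (intro continuous_on_vec_lambda continuous_on_add continuous_on_divide continuous_on_const A) auto
qed

lemma quot_unq: "z \<in> cotorus \<Longrightarrow> quot (unq q0 (fst z), snd z) = z"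
proof -
  assume "z \<in> cotorus"
  then obtain q p where z: "z = quot (q, p)" by (auto simp: cotorus_def)
  have "cis (2 * pi * unq q0 (fst z) $ j) = cis (2 * pi * q $ j)" for j
  proof -
    let ?w = "cis (2 * pi * q $ j) / cis (2 * pi * q0 $ j)"
    have "2 * pi * unq q0 (fst z) $ j = 2 * pi * q0 $ j + Arg ?w"
      by (simp add: unq_def z quot_def field_simps)
    then have "cis (2 * pi * unq q0 (fst z) $ j) = cis (2 * pi * q0 $ j) * cis (Arg ?w)"
      by (simp add: cis_mult)
    also have "cis (Arg ?w) = ?w" by (subst cis_Arg) (auto simp: sgn_div_norm norm_divide)
    finally show ?thesis by simp
  qed
  then show ?thesis by (simp add: z quot_def)
qed

lemma unq_integral: "integral_vec (unq q0 (fst (quot (q, p))) - q)"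
proof -
  have "quot (unq q0 (fst (quot (q, p))), p) = quot (q, p)"
    using quot_unq[of "quot (q, p)" q0] by (simp add: cotorus_def snd_quot)
  then show ?thesis by (simp only: quot_eq_iff)
qed

lemma unq_near:
  assumes "norm (q - q0) < 1/2"
  shows "unq q0 (fst (quot (q, p))) = q" "fst (quot (q, p)) \<in> unq_dom q0"
proof -
  have t: "\<bar>2 * pi * (q $ j - q0 $ j)\<bar> < pi" for j
  proof -
    have "\<bar>q $ j - q0 $ j\<bar> < 1/2" using component_le_norm_cart[of "q - q0" j] assms by simp
    then have "(2 * pi) * \<bar>q $ j - q0 $ j\<bar> < (2 * pi) * (1/2)" by (intro mult_strict_left_mono) auto
    then show ?thesis by (simp add: abs_mult)
  qed
  have w: "fst (quot (q, p)) $ j / cis (2 * pi * q0 $ j) = cis (2 * pi * (q $ j - q0 $ j))" for j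
    by (simp add: quot_def cis_divide algebra_simps)
  have A: "Arg (cis (2 * pi * (q $ j - q0 $ j))) = 2 * pi * (q $ j - q0 $ j)" for j
    using t[of j] by (intro Arg_cis) (auto simp: abs_less_iff)
  show "unq q0 (fst (quot (q, p))) = q"
    unfolding unq_def w A by (simp add: vec_eq_iff)
  show "fst (quot (q, p)) \<in> unq_dom q0"
    unfolding unq_dom_def
  proof (intro CollectI allI notI)
    fix j assume "fst (quot (q, p)) $ j / cis (2 * pi * q0 $ j) \<in> \<real>\<^sub>\<le>\<^sub>0"
    then have "cis (2 * pi * (q $ j - q0 $ j)) \<in> \<real>\<^sub>\<le>\<^sub>0" by (simp only: w)
    then have "Arg (cis (2 * pi * (q $ j - q0 $ j))) = pi"
      using cis_neq_zero[of "2 * pi * (q $ j - q0 $ j)"] unfolding Arg_eq_pi complex_nonpos_Reals_iff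
      by (auto simp: complex_eq_iff less_le simp del: cis_neq_zero)
    then show False using A[of j] t[of j] by simp
  qed
qed

lemma closed_cotorus: "closed (cotorus :: ((complex^'n::finite) \<times> (real^'n)) set)"
proof -
  have "(cotorus :: ((complex^'n) \<times> (real^'n)) set) = {z. \<forall>j. norm (fst z $ j) = 1}"
  proof (intro equalityI subsetI)
    fix z :: "(complex^'n) \<times> (real^'n)" assume "z \<in> {z. \<forall>j. norm (fst z $ j) = 1}"
    then have "cis (Arg (fst z $ j)) = fst z $ j" for j
      by (subst cis_Arg) (auto simp: sgn_div_norm dest: spec[of _ j])
    then have "quot ((\<chi> j. Arg (fst z $ j) / (2 * pi)), snd z) = z"
      by (simp add: quot_def vec_eq_iff prod_eq_iff)
    then show "z \<in> cotorus" unfolding cotorus_def by (metis rangeI)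
  qed (auto simp: cotorus_def quot_def)
  also have "closed \<dots>" by (intro closed_Collect_all closed_Collect_eq continuous_intros)
  finally show ?thesis .
qed

section \<open>The labelled set in R x T*T^n and its charts\<close>

definition labelled_quot :: "(real \<times> (real^'n::finite) \<times> (real^'n)) set \<Rightarrow> (real \<times> (complex^'n) \<times> (real^'n)) set" where
  "labelled_quot Y = (\<lambda>(l, z). (l, quot z)) ` Y"

context
  fixes Y :: "(real \<times> (real^'n::finite) \<times> (real^'n)) set"
  assumes loc: "\<And>x. local_lag Y x" and inv: "lattice_inv Y"
begin

lemma labelled_quot_iff: "(l, quot (q, p)) \<in> labelled_quot Y \<longleftrightarrow> (l, q, p) \<in> Y"
proof
  assume "(l, quot (q, p)) \<in> labelled_quot Y"
  then obtain q' p' where "(l, q', p') \<in> Y" "quot (q, p) = quot (q', p')" by (auto simp: labelled_quot_def)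
  then have "(l, q', p) \<in> Y" "integral_vec (q - q')" by (auto simp: quot_eq_iff)
  then have "(l, q' + (q - q'), p) \<in> Y" using inv unfolding lattice_inv_def by blast
  then show "(l, q, p) \<in> Y" by simp
qed (force simp: labelled_quot_def)

lemma labelled_quot_cotorus: "x \<in> labelled_quot Y \<Longrightarrow> snd x \<in> cotorus"
  by (auto simp: labelled_quot_def cotorus_def)

lemma labelled_quot_unq: "(l, z) \<in> labelled_quot Y \<Longrightarrow> (l, unq q0 (fst z), snd z) \<in> Y"
  using labelled_quot_iff[of l "unq q0 (fst z)" "snd z"] quot_unq[of z q0] labelled_quot_cotorus by fastforce

lemma closed_labelled_quot: "closed (labelled_quot Y)"
proof -
  have "\<exists>U. open U \<and> x \<in> U \<and> U \<subseteq> - labelled_quot Y" if x: "x \<notin> labelled_quot Y" for x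
  proof (cases "snd x \<in> cotorus")
    case False
    show ?thesis
      by (intro exI[of _ "snd -` (- cotorus)"])
        (use False labelled_quot_cotorus in \<open>auto intro!: open_vimage continuous_intros closed_cotorus open_Compl\<close>)
  next
    case True
    then obtain l q p where xq: "x = (l, quot (q, p))" by (cases x) (auto simp: cotorus_def)
    define S where "S = (UNIV :: real set) \<times> unq_dom q \<times> (UNIV :: (real^'n) set)"
    define h where "h = (\<lambda>x::real \<times> (complex^'n) \<times> (real^'n). (fst x, unq q (fst (snd x)), snd (snd x)))"
    have S: "open S" unfolding S_def by (intro open_Times open_UNIV open_unq_dom)
    have "continuous_on S h"
      unfolding h_def S_def by (intro continuous_intros continuous_on_compose2[OF continuous_on_unq]) auto
    moreover have "open (- Y)" using local_lag_closed[OF loc] by (simp add: open_Compl)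
    ultimately have "open (h -` (- Y) \<inter> S)"
      using continuous_on_open_vimage[OF S, of h] by blast
    moreover have "x \<in> h -` (- Y) \<inter> S"
      using x unq_near[of q q p] by (simp add: xq labelled_quot_iff S_def h_def) (simp add: quot_def)
    moreover have "h -` (- Y) \<inter> S \<subseteq> - labelled_quot Y"
      using labelled_quot_unq by (auto simp: h_def)
    ultimately show ?thesis by blast
  qed
  then have "open (- labelled_quot Y)" by (subst open_subopen) blast
  then show ?thesis by (simp add: closed_def)
qed

text \<open>The last condition says that the chart is small enough for the branch at q0 to undo
  \<open>quot\<close> on it, so that \<xi> can be recovered from the point of the quotient.\<close>

definition quot_chart ::
  "real^'n \<Rightarrow> (real \<times> (complex^'n) \<times> (real^'n)) set \<Rightarrow> (real^'n) set \<Rightarrow> (real^'n \<Rightarrow> (real^'n) \<times> (real^'n)) \<Rightarrow>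
   (real^'n \<Rightarrow> real) \<Rightarrow> ((real^'n) \<times> (real^'n) \<Rightarrow> real^'n) \<Rightarrow> real^'n \<Rightarrow> bool" where
  "quot_chart q0 W B F lb \<Lambda> c \<longleftrightarrow> lag_chart B F lb \<Lambda> c \<and> open W \<and>
     W \<subseteq> {x. fst (snd x) \<in> unq_dom q0} \<and> labelled_quot Y \<inter> W = (\<lambda>\<xi>. (lb \<xi>, quot (F \<xi>))) ` B \<and>
     (\<forall>\<xi>\<in>B. unq q0 (fst (quot (F \<xi>))) = fst (F \<xi>))"

lemma quot_chart_exists:
  assumes "x \<in> labelled_quot Y"
  obtains q0 W B F lb \<Lambda> c where "quot_chart q0 W B F lb \<Lambda> c" "x \<in> W"
proof -
  obtain l q p where x: "x = (l, quot (q, p))" "(l, q, p) \<in> Y" using assms by (auto simp: labelled_quot_def)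
  obtain N where N: "open N" "(l, q, p) \<in> N" "lag_graph (Y \<inter> N)"
    using loc[of "(l, q, p)"] x(2) unfolding local_lag_def by blast
  \<comment> \<open>Within distance 1/2 of q the branch \<open>unq q\<close> inverts
    \<open>quot\<close>.\<close>
  define N1 where "N1 = {y::real \<times> (real^'n) \<times> (real^'n). norm (fst (snd y) - q) < 1/2}"
  have N1: "open N1" unfolding N1_def by (intro open_Collect_less continuous_intros)
  have "lag_graph (Y \<inter> N \<inter> N1)" by (rule lag_graph_Int[OF N(3) N1])
  then obtain B F lb \<Lambda> c where ch: "lag_chart B F lb \<Lambda> c" and eq: "Y \<inter> N \<inter> N1 = (\<lambda>\<xi>. (lb \<xi>, F \<xi>)) ` B"
    unfolding lag_graph_def by blast
  define S where "S = (UNIV :: real set) \<times> unq_dom q \<times> (UNIV :: (real^'n) set)"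
  define h where "h = (\<lambda>x::real \<times> (complex^'n) \<times> (real^'n). (fst x, unq q (fst (snd x)), snd (snd x)))"
  have S: "open S" unfolding S_def by (intro open_Times open_UNIV open_unq_dom)
  have hc: "continuous_on S h"
    unfolding h_def S_def by (intro continuous_intros continuous_on_compose2[OF continuous_on_unq]) auto
  define W where "W = h -` (N \<inter> N1) \<inter> S"
  have W: "open W" unfolding W_def using continuous_on_open_vimage[OF S, of h] hc open_Int[OF N(1) N1] by blast
  have hq: "h (l', quot (q', p')) = (l', q', p') \<and> (l', quot (q', p')) \<in> S" if "(l', q', p') \<in> N1" for l' q' p'
    using that unq_near[of q' q p'] by (simp add: N1_def h_def S_def) (simp add: quot_def)
  have img: "labelled_quot Y \<inter> W = (\<lambda>\<xi>. (lb \<xi>, quot (F \<xi>))) ` B"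
  proof (intro equalityI subsetI)
    fix y assume y: "y \<in> labelled_quot Y \<inter> W"
    then have "h y \<in> Y" using labelled_quot_unq[of "fst y" "snd y" q] by (simp add: h_def)
    then have "h y \<in> Y \<inter> N \<inter> N1" using y by (simp add: W_def)
    then obtain \<xi> where \<xi>: "\<xi> \<in> B" "h y = (lb \<xi>, F \<xi>)" unfolding eq by blast
    have "(fst (h y), quot (snd (h y))) = y"
      using y quot_unq[of "snd y" q] labelled_quot_cotorus[of y] by (simp add: h_def)
    then have "y = (lb \<xi>, quot (F \<xi>))" unfolding \<xi>(2) by simp
    then show "y \<in> (\<lambda>\<xi>. (lb \<xi>, quot (F \<xi>))) ` B" using \<xi>(1) by blast
  next
    fix y assume "y \<in> (\<lambda>\<xi>. (lb \<xi>, quot (F \<xi>))) ` B"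
    then obtain \<xi> where \<xi>: "\<xi> \<in> B" "y = (lb \<xi>, quot (F \<xi>))" by blast
    have "(lb \<xi>, F \<xi>) \<in> Y \<inter> N \<inter> N1" unfolding eq using \<xi>(1) by blast
    then show "y \<in> labelled_quot Y \<inter> W"
      using hq[of "lb \<xi>" "fst (F \<xi>)" "snd (F \<xi>)"] \<xi>(2) labelled_quot_iff[of "lb \<xi>" "fst (F \<xi>)" "snd (F \<xi>)"]
      by (auto simp: W_def)
  qed
  have near: "unq q (fst (quot (F \<xi>))) = fst (F \<xi>)" if "\<xi> \<in> B" for \<xi>
  proof -
    have "(lb \<xi>, F \<xi>) \<in> N1" using that eq by blast
    then have "h (lb \<xi>, quot (F \<xi>)) = (lb \<xi>, F \<xi>)"
      using hq[of "lb \<xi>" "fst (F \<xi>)" "snd (F \<xi>)"] by simp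
    then have "fst (snd (h (lb \<xi>, quot (F \<xi>)))) = fst (F \<xi>)" by simp
    then show ?thesis by (simp only: h_def fst_conv snd_conv)
  qed
  have "quot_chart q W B F lb \<Lambda> c"
    unfolding quot_chart_def using ch W img near by (auto simp: W_def S_def)
  moreover have "x \<in> W"
    using hq[of l q p] N(2) by (simp add: W_def x(1) N1_def)
  ultimately show ?thesis by (rule that)
qed

definition chart_map ::
  "real^'n \<Rightarrow> ((real^'n) \<times> (real^'n) \<Rightarrow> real^'n) \<Rightarrow> real^'n \<Rightarrow> real \<times> (complex^'n) \<times> (real^'n) \<Rightarrow> real^'n" where
  "chart_map q0 \<Lambda> c x = \<Lambda> (unq q0 (fst (snd x)), snd (snd x)) + c"

context
  fixes q0 W B F lb \<Lambda> c assumes ch: "quot_chart q0 W B F lb \<Lambda> c"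
begin

lemma chart_map_inverse: "\<xi> \<in> B \<Longrightarrow> chart_map q0 \<Lambda> c (lb \<xi>, quot (F \<xi>)) = \<xi>"
  using ch by (auto simp: quot_chart_def chart_map_def snd_quot lag_chart_def)

lemma chart_homeomorphic:
  "homeomorphic_maps (top_of_set (labelled_quot Y \<inter> W)) (top_of_set B)
     (chart_map q0 \<Lambda> c) (\<lambda>\<xi>. (lb \<xi>, quot (F \<xi>)))"
proof -
  have lc: "lag_chart B F lb \<Lambda> c" and img: "labelled_quot Y \<inter> W = (\<lambda>\<xi>. (lb \<xi>, quot (F \<xi>))) ` B"
    and dom: "W \<subseteq> {x. fst (snd x) \<in> unq_dom q0}" using ch by (auto simp: quot_chart_def)
  have \<Lambda>: "bounded_linear \<Lambda>" using lc by (simp add: lag_chart_def)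
  have "continuous_on W (\<lambda>x. (unq q0 (fst (snd x)), snd (snd x)))"
    using dom by (intro continuous_intros continuous_on_compose2[OF continuous_on_unq]) auto
  then have c1: "continuous_on W (chart_map q0 \<Lambda> c)"
    unfolding chart_map_def by (intro continuous_on_add continuous_on_const bounded_linear.continuous_on[OF \<Lambda>])
  have "continuous_on B F" using lc by (auto simp: lag_chart_def intro: smooth_on_continuous_on)
  then have c2: "continuous_on B (\<lambda>\<xi>. (lb \<xi>, quot (F \<xi>)))"
    using lc by (intro continuous_on_Pair continuous_on_compose2[OF continuous_on_quot]) (auto simp: lag_chart_def)
  show ?thesis
    unfolding homeomorphic_maps_def
  proof (intro conjI)
    show "continuous_map (top_of_set (labelled_quot Y \<inter> W)) (top_of_set B) (chart_map q0 \<Lambda> c)"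
    proof -
      have "chart_map q0 \<Lambda> c x \<in> B" if "x \<in> labelled_quot Y \<inter> W" for x
        using that unfolding img by (auto simp: chart_map_inverse)
      moreover have "continuous_on (labelled_quot Y \<inter> W) (chart_map q0 \<Lambda> c)"
        by (rule continuous_on_subset[OF c1]) simp
      ultimately show ?thesis by (simp add: continuous_map_in_subtopology image_subset_iff_funcset[symmetric] image_subset_iff)
    qed
    show "continuous_map (top_of_set B) (top_of_set (labelled_quot Y \<inter> W)) (\<lambda>\<xi>. (lb \<xi>, quot (F \<xi>)))"
      using c2 by (auto simp: img)
  qed (auto simp: img chart_map_inverse)
qed

end

lemma integral_vec_locally_constant:
  fixes f :: "real^'n \<Rightarrow> real^'n"
  assumes "open S" "continuous_on S f" "\<And>x. x \<in> S \<Longrightarrow> integral_vec (f x)" "x \<in> S"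
  shows "\<exists>U. open U \<and> x \<in> U \<and> U \<subseteq> S \<and> (\<forall>y\<in>U. f y = f x)"
proof (intro exI conjI ballI)
  let ?U = "f -` ball (f x) 1 \<inter> S"
  show "open ?U" using assms(1,2) continuous_on_open_vimage by blast
  fix y assume y: "y \<in> ?U"
  have "f y $ i = f x $ i" for i
  proof -
    have "\<bar>f x $ i - f y $ i\<bar> < 1"
      using y component_le_norm_cart[of "f x - f y" i] by (simp add: dist_norm)
    moreover have "f x $ i - f y $ i \<in> \<int>" using assms(3)[OF assms(4)] assms(3)[of y] y by (auto simp: integral_vec_def)
    ultimately have "f x $ i - f y $ i = 0" using Ints_nonzero_abs_less1 by blast
    then show ?thesis by simp
  qed
  then show "f y = f x" by (simp add: vec_eq_iff)
qed (use assms in auto)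

text \<open>The lifts of a point of T*T^n used by the two charts differ by an integral vector, which
  depends continuously on the point and is therefore locally constant. So the transition map is
  locally an affine map applied to the smooth \<open>F\<close>.\<close>

lemma chart_transition_smooth:
  assumes ch: "quot_chart q0 W B F lb \<Lambda> c" and ch': "quot_chart q1 W' B' F' lb' \<Lambda>' c'"
  shows "open {\<xi>\<in>B. (lb \<xi>, quot (F \<xi>)) \<in> W'}"
    and "smooth_on {\<xi>\<in>B. (lb \<xi>, quot (F \<xi>)) \<in> W'} (\<lambda>\<xi>. chart_map q1 \<Lambda>' c' (lb \<xi>, quot (F \<xi>)))"
proof -
  have lc: "lag_chart B F lb \<Lambda> c" using ch by (simp add: quot_chart_def)
  have smF: "smooth_on B F" and B: "open B" and lb: "continuous_on B lb" using lc by (auto simp: lag_chart_def)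
  have \<Lambda>': "bounded_linear \<Lambda>'" and W': "open W'" "W' \<subseteq> {x. fst (snd x) \<in> unq_dom q1}"
    using ch' by (auto simp: quot_chart_def lag_chart_def)
  define S where "S = {\<xi>\<in>B. (lb \<xi>, quot (F \<xi>)) \<in> W'}"
  have cq: "continuous_on B (\<lambda>\<xi>. quot (F \<xi>))"
    by (rule continuous_on_compose2[OF continuous_on_quot smooth_on_continuous_on[OF smF]]) auto
  have "continuous_on B (\<lambda>\<xi>. (lb \<xi>, quot (F \<xi>)))" by (intro continuous_on_Pair lb cq)
  then have "open ((\<lambda>\<xi>. (lb \<xi>, quot (F \<xi>))) -` W' \<inter> B)" using W'(1) continuous_on_open_vimage[OF B] by blast
  moreover have "S = (\<lambda>\<xi>. (lb \<xi>, quot (F \<xi>))) -` W' \<inter> B" by (auto simp: S_def)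
  ultimately have S: "open S" by simp
  have SB: "S \<subseteq> B" by (auto simp: S_def)
  define m where "m = (\<lambda>\<xi>. unq q1 (fst (quot (F \<xi>))) - fst (F \<xi>))"
  have "continuous_on S (\<lambda>\<xi>. unq q1 (fst (quot (F \<xi>))))"
    by (rule continuous_on_compose2[OF continuous_on_unq])
      (use cq SB W'(2) in \<open>auto intro!: continuous_intros intro: continuous_on_subset simp: S_def\<close>)
  then have mc: "continuous_on S m"
    unfolding m_def using smooth_on_continuous_on[OF smooth_on_subset[OF smF SB]]
    by (intro continuous_intros)
  have mi: "integral_vec (m \<xi>)" for \<xi>
    unfolding m_def using unq_integral[of q1 "fst (F \<xi>)" "snd (F \<xi>)"] by simp
  show "open {\<xi>\<in>B. (lb \<xi>, quot (F \<xi>)) \<in> W'}" using S by (simp only: S_def)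
  show "smooth_on {\<xi>\<in>B. (lb \<xi>, quot (F \<xi>)) \<in> W'} (\<lambda>\<xi>. chart_map q1 \<Lambda>' c' (lb \<xi>, quot (F \<xi>)))"
    unfolding S_def[symmetric]
  proof (rule smooth_on_local)
    fix \<xi> assume "\<xi> \<in> S"
    then obtain U where U: "open U" "\<xi> \<in> U" "U \<subseteq> S" "\<forall>y\<in>U. m y = m \<xi>"
      using integral_vec_locally_constant[OF S mc mi] by blast
    have "smooth_on U (\<lambda>y. \<Lambda>' (F y + (m \<xi>, 0)) + c')"
      using U SB by (intro smooth_on_add smooth_on_linear_comp[OF \<Lambda>'] smooth_on_const smooth_on_subset[OF smF]) auto
    moreover have "\<Lambda>' (F y + (m \<xi>, 0)) + c' = chart_map q1 \<Lambda>' c' (lb y, quot (F y))" if "y \<in> U" for y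
    proof -
      have "m \<xi> = m y" using U(4) that by simp
      then have "F y + (m \<xi>, 0) = (unq q1 (fst (quot (F y))), snd (F y))" by (simp add: m_def prod_eq_iff)
      then show ?thesis by (simp add: chart_map_def snd_quot)
    qed
    ultimately show "\<exists>U g. open U \<and> \<xi> \<in> U \<and> smooth_on U g \<and>
        (\<forall>y\<in>U. g y = chart_map q1 \<Lambda>' c' (lb y, quot (F y)))"
      using U(1,2) by blast
  qed
qed

text \<open>Differentiating the affine left inverse gives a linear left inverse of the
  derivative.\<close>

lemma lag_chart_immersion: "lag_chart B F lb \<Lambda> c \<Longrightarrow> lagrangian_immersion_on B F"
proof -
  assume ch: "lag_chart B F lb \<Lambda> c"
  have "inj (frechet_derivative F (at x))" if x: "x \<in> B" for x
  proof -
    have B: "open B" and \<Lambda>: "bounded_linear \<Lambda>" and left: "\<And>\<xi>. \<xi> \<in> B \<Longrightarrow> \<Lambda> (F \<xi>) + c = \<xi>"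
      and F: "(F has_derivative frechet_derivative F (at x)) (at x)"
      using ch x by (auto simp: lag_chart_def intro: smooth_on_has_derivative)
    have "((\<lambda>\<xi>. \<Lambda> (F \<xi>) + c) has_derivative (\<lambda>v. \<Lambda> (frechet_derivative F (at x) v))) (at x)"
      by (intro has_derivative_add_const bounded_linear.has_derivative[OF \<Lambda> F])
    then have "((\<lambda>\<xi>. \<xi>) has_derivative (\<lambda>v. \<Lambda> (frechet_derivative F (at x) v))) (at x)"
      by (rule has_derivative_transform_within_open[OF _ B x]) (rule left)
    then have "(\<lambda>v. \<Lambda> (frechet_derivative F (at x) v)) = (\<lambda>v. v)"
      using has_derivative_unique has_derivative_ident by blast
    then show ?thesis by (metis injI)
  qed
  then show ?thesis using ch by (auto simp: lagrangian_immersion_on_def lag_chart_def)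
qed

text \<open>Inside one chart (q, p) determines \<xi> through the left inverse and hence the label,
  so the labels over (q, p) have no limit point. Countability is what allows the sheets to be
  numbered by natural numbers.\<close>

lemma countable_fibre: "countable {l. (l, q, p) \<in> Y}"
proof -
  have "\<not> l islimpt {l. (l, q, p) \<in> Y}" for l
  proof -
    obtain N where N: "open N" "(l, q, p) \<in> N" "Y \<inter> N = {} \<or> lag_graph (Y \<inter> N)"
      using loc[of "(l, q, p)"] unfolding local_lag_def by blast
    define U where "U = (\<lambda>l. (l, q, p)) -` N"
    have U: "open U" "l \<in> U" unfolding U_def using N by (auto intro!: open_vimage continuous_intros)
    have uniq: "l1 = l2" if "l1 \<in> U" "l2 \<in> U" "(l1, q, p) \<in> Y" "(l2, q, p) \<in> Y" for l1 l2
    proof -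
      have m: "(l1, q, p) \<in> Y \<inter> N" "(l2, q, p) \<in> Y \<inter> N" using that by (auto simp: U_def)
      then obtain B F lb \<Lambda> c where ch: "lag_chart B F lb \<Lambda> c" "Y \<inter> N = (\<lambda>\<xi>. (lb \<xi>, F \<xi>)) ` B"
        using N(3) unfolding lag_graph_def by blast
      obtain \<xi>1 \<xi>2 where x: "\<xi>1 \<in> B" "(l1, q, p) = (lb \<xi>1, F \<xi>1)" "\<xi>2 \<in> B" "(l2, q, p) = (lb \<xi>2, F \<xi>2)"
        using m unfolding ch(2) by blast
      have left: "\<Lambda> (F \<xi>) + c = \<xi>" if "\<xi> \<in> B" for \<xi> using ch(1) that by (simp add: lag_chart_def)
      have "F \<xi>1 = F \<xi>2" using x(2,4) by (metis prod.inject)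
      then have "\<xi>1 = \<xi>2" using left[OF x(1)] left[OF x(3)] by metis
      then show ?thesis using x(2,4) by (metis prod.inject)
    qed
    show ?thesis
    proof
      assume lim: "l islimpt {l. (l, q, p) \<in> Y}"
      obtain l1 where l1: "(l1, q, p) \<in> Y" "l1 \<in> U" "l1 \<noteq> l"
        using islimptE[OF lim U(2,1)] by blast
      then have o: "open (U - {l1})" "l \<in> U - {l1}" using U by auto
      obtain l2 where "(l2, q, p) \<in> Y" "l2 \<in> U - {l1}" using islimptE[OF lim o(2,1)] by blast
      then show False using uniq[of l1 l2] l1 by blast
    qed
  qed
  then have "{l. (l, q, p) \<in> Y} sparse_in UNIV" by (auto simp: sparse_in_def)
  from sparse_imp_countable[OF open_UNIV this] show ?thesis by simp
qed

text \<open>The preimage of a compact K is closed and contained in an interval of labels times K,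
  hence compact; for a metrizable target this implies properness.\<close>

lemma proper_labelled_quot:
  assumes bounded: "\<And>K. \<exists>M. \<forall>(l, q, p)\<in>Y. norm p \<le> K \<longrightarrow> \<bar>l\<bar> \<le> M"
  shows "proper_map (top_of_set (labelled_quot Y)) (top_of_set cotorus) snd"
proof (rule compact_imp_proper_map)
  have m: "metrizable_space (top_of_set (cotorus :: ((complex^'n) \<times> (real^'n)) set))"
    by (intro metrizable_space_subtopology metrizable_space_euclidean)
  then show "k_space (top_of_set (cotorus :: ((complex^'n) \<times> (real^'n)) set))"
    by (rule metrizable_imp_k_space)
  show "kc_space (top_of_set (cotorus :: ((complex^'n) \<times> (real^'n)) set))"
    by (intro kc_space_subtopology kc_space_euclidean)
  show "snd \<in> topspace (top_of_set (labelled_quot Y)) \<rightarrow> topspace (top_of_set cotorus)"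
    using labelled_quot_cotorus by auto
  show "continuous_map (top_of_set (labelled_quot Y)) (top_of_set cotorus) snd \<or>
      kc_space (top_of_set (labelled_quot Y))"
    by (intro disjI2 kc_space_subtopology kc_space_euclidean)
  fix K assume "compactin (top_of_set (cotorus :: ((complex^'n) \<times> (real^'n)) set)) K"
  then have K: "compact K" by (simp add: compactin_subtopology)
  then have "bounded K" by (rule compact_imp_bounded)
  then obtain k where k: "\<And>z. z \<in> K \<Longrightarrow> norm z \<le> k" unfolding bounded_iff by blast
  obtain M where M: "\<And>l q p. (l, q, p) \<in> Y \<Longrightarrow> norm p \<le> k \<Longrightarrow> \<bar>l\<bar> \<le> M" using bounded[of k] by blast
  let ?S = "{x \<in> labelled_quot Y. snd x \<in> K}"
  have sub: "?S \<subseteq> {- M..M} \<times> K"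
  proof
    fix x assume x: "x \<in> ?S"
    then obtain l q p where xq: "x = (l, quot (q, p))" "(l, q, p) \<in> Y" by (auto simp: labelled_quot_def)
    have "norm p \<le> norm (quot (q, p))" using norm_snd_le[of p "fst (quot (q, p))"] by (simp add: quot_def)
    then have "norm p \<le> k" using k[of "snd x"] x xq by simp
    then show "x \<in> {- M..M} \<times> K" using M[OF xq(2)] x xq by (auto simp: abs_le_iff)
  qed
  have "closed ?S"
  proof -
    have "closed (snd -` K :: (real \<times> (complex^'n) \<times> (real^'n)) set)"
      by (intro closed_vimage compact_imp_closed K continuous_intros)
    moreover have "?S = labelled_quot Y \<inter> snd -` K" by auto
    ultimately show ?thesis using closed_labelled_quot by (simp add: closed_Int)
  qed
  moreover have "compact ({- M..M} \<times> K)" by (intro compact_Times K compact_Icc)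
  ultimately have "compact (?S \<inter> ({- M..M} \<times> K))" by (rule closed_Int_compact)
  then have "compact ?S" unfolding Int_absorb2[OF sub] .
  then show "compactin (top_of_set (labelled_quot Y)) {x \<in> topspace (top_of_set (labelled_quot Y)). snd x \<in> K}"
    by (auto simp: compactin_subtopology)
qed

text \<open>The required carrier type has only a discrete label, so the topology of \<open>labelled_quot Y\<close> is
  transported along an injection that numbers the sheets over each point of \<open>T\<^sup>*T\<^sup>n\<close>; this
  injection is not continuous for the product topology.\<close>

lemma realize_manifold:
  assumes bounded: "\<And>K. \<exists>M. \<forall>(l, q, p)\<in>Y. norm p \<le> K \<longrightarrow> \<bar>l\<bar> \<le> M"
  shows "\<exists>(T :: (nat \<times> (complex^'n) \<times> (real^'n)) topology) \<A> H.
    homeomorphic_map (top_of_set (labelled_quot Y)) T H \<and> (\<forall>x\<in>labelled_quot Y. snd (H x) = snd x) \<and>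
    smooth_manifold T \<A> \<and> lagrangian_immersion \<A> snd \<and> proper_map T (top_of_set cotorus) snd"
proof -
  define X where "X = labelled_quot Y"
  define H where "H = (\<lambda>(l, z). (to_nat_on {l. (l, z) \<in> X} l, z))"
  have cnt: "countable {l. (l, z) \<in> X}" for z
  proof (cases "z \<in> cotorus")
    case True
    then obtain q p where "z = quot (q, p)" by (auto simp: cotorus_def)
    then show ?thesis using countable_fibre[of q p] by (simp add: X_def labelled_quot_iff)
  next
    case False
    then have "(l, z) \<notin> X" for l using labelled_quot_cotorus[of "(l, z)"] by (auto simp: X_def)
    then show ?thesis by simp
  qed
  have inj: "inj_on H X"
  proof (rule inj_onI)
    fix x y assume xy: "x \<in> X" "y \<in> X" "H x = H y"
    obtain l m z where x: "x = (l, z)" and y: "y = (m, z)" using xy(3) by (cases x, cases y) (auto simp: H_def)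
    have "l = m"
      using xy inj_on_to_nat_on[OF cnt[of z]] by (auto simp: H_def x y dest: inj_onD)
    then show "x = y" by (simp add: x y)
  qed
  have sndH: "snd (H x) = snd x" for x by (simp add: H_def case_prod_beta)
  define G where "G = inv_into X H"
  have GH: "G (H x) = x" if "x \<in> X" for x using inj that by (simp add: G_def)
  have HG: "G y \<in> X" "H (G y) = y" if "y \<in> H ` X" for y using that by (auto simp: G_def inv_into_into f_inv_into_f)
  define T where "T = pullback_topology (H ` X) G (top_of_set X)"
  have topT: "topspace T = H ` X" by (auto simp: T_def topspace_pullback_topology HG GH)
  have hm: "homeomorphic_maps (top_of_set X) T H G"
    unfolding homeomorphic_maps_def
  proof (intro conjI ballI)
    have "continuous_map (top_of_set X) (top_of_set X) (G \<circ> H)"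
      by (rule continuous_map_eq[of _ _ id]) (simp_all add: GH)
    then show "continuous_map (top_of_set X) T H"
      unfolding T_def by (rule continuous_map_pullback') auto
    have "continuous_map T (top_of_set X) (id \<circ> G)"
      unfolding T_def by (rule continuous_map_pullback) simp
    then show "continuous_map T (top_of_set X) G" by simp
  qed (use GH HG topT in auto)
  then have hm': "homeomorphic_maps T (top_of_set X) G H" by (rule iffD1[OF homeomorphic_maps_sym])
  have space: "(top_of_set X) homeomorphic_space T" using hm unfolding homeomorphic_space_def by blast
  define g where "g = (\<lambda>(lb :: real^'n \<Rightarrow> real) (F :: real^'n \<Rightarrow> (real^'n) \<times> (real^'n)) \<xi>. (lb \<xi>, quot (F \<xi>)))"
  define \<A> where "\<A> = {(H ` (X \<inter> W), chart_map q0 \<Lambda> c \<circ> G) | q0 W B F lb \<Lambda> c. quot_chart q0 W B F lb \<Lambda> c}"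
  have chart: "homeomorphic_maps (subtopology T (H ` (X \<inter> W))) (top_of_set B) (chart_map q0 \<Lambda> c \<circ> G) (H \<circ> g lb F)"
    if ch: "quot_chart q0 W B F lb \<Lambda> c" for q0 W B F lb \<Lambda> c
  proof -
    have "homeomorphic_maps (subtopology T (H ` (X \<inter> W))) (subtopology (top_of_set X) (X \<inter> W)) G H"
    proof (rule homeomorphic_maps_subtopologies_alt[OF hm'])
      have "G y \<in> X \<inter> W" if "y \<in> H ` (X \<inter> W)" for y using that GH by fastforce
      then show "G ` (topspace T \<inter> H ` (X \<inter> W)) \<subseteq> X \<inter> W" by blast
    qed auto
    then have "homeomorphic_maps (subtopology T (H ` (X \<inter> W))) (top_of_set (X \<inter> W)) G H"
      by (simp add: subtopology_subtopology Int_assoc[symmetric])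
    from homeomorphic_maps_compose[OF conjI[OF this chart_homeomorphic[OF ch, folded X_def]]]
    show ?thesis by (simp add: g_def)
  qed
  have top: "topspace (subtopology T (H ` (X \<inter> W))) = H ` (X \<inter> W)" for W by (auto simp: topT)
  have surj: "(chart_map q0 \<Lambda> c \<circ> G) ` (H ` (X \<inter> W)) = B"
    and inv: "\<And>\<xi>. \<xi> \<in> B \<Longrightarrow> inv_into (H ` (X \<inter> W)) (chart_map q0 \<Lambda> c \<circ> G) \<xi> = H (g lb F \<xi>)"
    and gX: "\<And>\<xi>. \<xi> \<in> B \<Longrightarrow> g lb F \<xi> \<in> X \<inter> W"
    and gsurj: "\<And>x. x \<in> X \<inter> W \<Longrightarrow> \<exists>\<xi>\<in>B. x = g lb F \<xi>"
    and cg: "\<And>\<xi>. \<xi> \<in> B \<Longrightarrow> (chart_map q0 \<Lambda> c \<circ> G) (H (g lb F \<xi>)) = \<xi>"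
    if ch: "quot_chart q0 W B F lb \<Lambda> c" for q0 W B F lb \<Lambda> c
  proof -
    have img: "X \<inter> W = g lb F ` B" using ch by (simp add: quot_chart_def X_def g_def)
    show gX: "g lb F \<xi> \<in> X \<inter> W" if "\<xi> \<in> B" for \<xi> using that img by blast
    show "\<exists>\<xi>\<in>B. x = g lb F \<xi>" if "x \<in> X \<inter> W" for x using that img by blast
    show cg: "(chart_map q0 \<Lambda> c \<circ> G) (H (g lb F \<xi>)) = \<xi>" if "\<xi> \<in> B" for \<xi>
      using GH gX[OF that] chart_map_inverse[OF ch that] by (simp add: g_def)
    then show "(chart_map q0 \<Lambda> c \<circ> G) ` (H ` (X \<inter> W)) = B"
      unfolding img image_image by simp
    have "inj_on (chart_map q0 \<Lambda> c \<circ> G) (H ` (X \<inter> W))"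
      unfolding img by (rule inj_on_inverseI[where g = "\<lambda>\<xi>. H (g lb F \<xi>)"]) (use cg in auto)
    then show "inv_into (H ` (X \<inter> W)) (chart_map q0 \<Lambda> c \<circ> G) \<xi> = H (g lb F \<xi>)" if "\<xi> \<in> B" for \<xi>
      by (rule inv_into_f_eq) (use gX[OF that] cg[OF that] in auto)
  qed
  have "smooth_manifold T \<A>"
    unfolding smooth_manifold_def
  proof (intro conjI)
    show "Hausdorff_space T"
      using homeomorphic_Hausdorff_space[OF space] Hausdorff_space_subtopology[OF Hausdorff_space_euclidean] by blast
    have "second_countable (euclidean :: (real \<times> (complex^'n) \<times> (real^'n)) topology)"
    proof -
      obtain \<B> :: "(real \<times> (complex^'n) \<times> (real^'n)) set set"
        where B: "countable \<B>" "topological_basis \<B>" using ex_countable_basis by blast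
      have "\<exists>V\<in>\<B>. x \<in> V \<and> V \<subseteq> U" if "open U" "x \<in> U" for U x
        using B(2) that by (meson topological_basisE)
      moreover have "open V" if "V \<in> \<B>" for V using B(2) that topological_basis_open by blast
      ultimately show ?thesis unfolding second_countable_def using B(1)
        by (intro exI[of _ \<B>]) (simp add: open_openin[symmetric])
    qed
    then show "second_countable T"
      using homeomorphic_space_second_countability[OF space] second_countable_subtopology by blast
    show "(\<Union>(D, \<phi>)\<in>\<A>. D) = topspace T"
    proof (intro equalityI subsetI)
      fix y assume "y \<in> topspace T"
      then obtain x where x: "x \<in> X" "y = H x" by (auto simp: topT)
      obtain q0 W B F lb \<Lambda> c where "quot_chart q0 W B F lb \<Lambda> c" "x \<in> W"
        using quot_chart_exists x(1) unfolding X_def by metis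
      then have "(H ` (X \<inter> W), chart_map q0 \<Lambda> c \<circ> G) \<in> \<A>" "y \<in> H ` (X \<inter> W)"
        using x unfolding \<A>_def by blast+
      then show "y \<in> (\<Union>(D, \<phi>)\<in>\<A>. D)" by blast
    qed (auto simp: \<A>_def topT)
    show "\<forall>(D, \<phi>)\<in>\<A>. openin T D \<and> open (\<phi> ` D) \<and>
        homeomorphic_map (subtopology T D) (top_of_set (\<phi> ` D)) \<phi>"
    proof (clarify, intro conjI)
      fix D \<phi> assume "(D, \<phi>) \<in> \<A>"
      then obtain q0 W B F lb \<Lambda> c where ch: "quot_chart q0 W B F lb \<Lambda> c"
        and D: "D = H ` (X \<inter> W)" and \<phi>: "\<phi> = chart_map q0 \<Lambda> c \<circ> G" unfolding \<A>_def by blast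
      have W: "open W" and B: "open B" using ch by (auto simp: quot_chart_def lag_chart_def)
      have "open_map (top_of_set X) T H"
        by (rule homeomorphic_imp_open_map[OF homeomorphic_maps_imp_map[OF hm]])
      moreover have "openin (top_of_set X) (X \<inter> W)" by (rule openin_open_Int[OF W])
      ultimately show "openin T D" unfolding D open_map_def by simp
      show "open (\<phi> ` D)" unfolding D \<phi> surj[OF ch] by (rule B)
      show "homeomorphic_map (subtopology T D) (top_of_set (\<phi> ` D)) \<phi>"
        unfolding D \<phi> surj[OF ch] by (rule homeomorphic_maps_imp_map[OF chart[OF ch]])
    qed
    show "\<forall>(D, \<phi>)\<in>\<A>. \<forall>(D', \<phi>')\<in>\<A>. smooth_on (\<phi> ` (D \<inter> D')) (\<phi>' \<circ> inv_into D \<phi>)"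
    proof clarify
      fix D \<phi> D' \<phi>' assume "(D, \<phi>) \<in> \<A>" "(D', \<phi>') \<in> \<A>"
      then obtain q0 W B F lb \<Lambda> c q1 W' B' F' lb' \<Lambda>' c' where ch: "quot_chart q0 W B F lb \<Lambda> c"
        and D: "D = H ` (X \<inter> W)" and \<phi>: "\<phi> = chart_map q0 \<Lambda> c \<circ> G"
        and ch': "quot_chart q1 W' B' F' lb' \<Lambda>' c'"
        and D': "D' = H ` (X \<inter> W')" and \<phi>': "\<phi>' = chart_map q1 \<Lambda>' c' \<circ> G" unfolding \<A>_def by blast
      have "\<phi> ` (D \<inter> D') \<subseteq> {\<xi>\<in>B. (lb \<xi>, quot (F \<xi>)) \<in> W'}"
      proof
        fix \<eta> assume "\<eta> \<in> \<phi> ` (D \<inter> D')"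
        then obtain x x' where x: "x \<in> X \<inter> W" "x' \<in> X \<inter> W'" "H x = H x'" "\<eta> = \<phi> (H x)"
          unfolding D D' by auto
        then have xx: "x = x'" using inj by (auto dest: inj_onD)
        obtain \<xi> where \<xi>: "\<xi> \<in> B" "x = g lb F \<xi>" using gsurj[OF ch x(1)] by blast
        then have "\<eta> = \<xi>" using x(4) cg[OF ch \<xi>(1)] by (simp only: \<phi>)
        then show "\<eta> \<in> {\<xi>\<in>B. (lb \<xi>, quot (F \<xi>)) \<in> W'}" using \<xi> x(2) xx by (simp add: g_def)
      qed
      moreover have "smooth_on {\<xi>\<in>B. (lb \<xi>, quot (F \<xi>)) \<in> W'} (\<phi>' \<circ> inv_into D \<phi>)"
      proof (rule smooth_on_cong[OF chart_transition_smooth(1)[OF ch ch'] _ chart_transition_smooth(2)[OF ch ch']])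
        fix \<xi> assume "\<xi> \<in> {\<xi>\<in>B. (lb \<xi>, quot (F \<xi>)) \<in> W'}"
        then have \<xi>: "\<xi> \<in> B" by simp
        have "(\<phi>' \<circ> inv_into D \<phi>) \<xi> = \<phi>' (H (g lb F \<xi>))" using inv[OF ch \<xi>] by (simp add: D \<phi>)
        also have "\<dots> = chart_map q1 \<Lambda>' c' (g lb F \<xi>)" using gX[OF ch \<xi>] GH by (simp add: \<phi>')
        finally show "(\<phi>' \<circ> inv_into D \<phi>) \<xi> = chart_map q1 \<Lambda>' c' (lb \<xi>, quot (F \<xi>))" by (simp add: g_def)
      qed
      ultimately show "smooth_on (\<phi> ` (D \<inter> D')) (\<phi>' \<circ> inv_into D \<phi>)" by (rule smooth_on_subset[rotated])
    qed
  qed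
  moreover have "lagrangian_immersion \<A> snd"
    unfolding lagrangian_immersion_def
  proof clarify
    fix D \<phi> and x :: "nat \<times> (complex^'n) \<times> (real^'n)" assume "(D, \<phi>) \<in> \<A>" and x: "x \<in> D"
    then obtain q0 W B F lb \<Lambda> c where ch: "quot_chart q0 W B F lb \<Lambda> c"
      and D: "D = H ` (X \<inter> W)" and \<phi>: "\<phi> = chart_map q0 \<Lambda> c \<circ> G" unfolding \<A>_def by blast
    have img: "\<phi> ` D = B" unfolding D \<phi> by (rule surj[OF ch])
    have "lagrangian_immersion_on B F" using ch lag_chart_immersion by (auto simp: quot_chart_def)
    moreover have "snd y = quot (F (\<phi> y))" if "y \<in> D" for y
    proof -
      obtain \<xi> where \<xi>: "\<xi> \<in> B" "y = H (g lb F \<xi>)" using \<open>y \<in> D\<close> gsurj[OF ch] unfolding D by blast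
      then show ?thesis using cg[OF ch \<xi>(1)] by (simp only: \<phi> sndH) (simp add: g_def)
    qed
    ultimately show "\<exists>B F. \<phi> x \<in> B \<and> B \<subseteq> \<phi> ` D \<and> lagrangian_immersion_on B F \<and>
        (\<forall>y\<in>D. \<phi> y \<in> B \<longrightarrow> snd y = quot (F (\<phi> y)))"
      using x img by (intro exI[of _ B] exI[of _ F]) auto
  qed
  moreover have "proper_map T (top_of_set cotorus) snd"
  proof -
    have "proper_map T (top_of_set X) G"
      by (rule homeomorphic_imp_proper_map[OF homeomorphic_maps_imp_map[OF hm']])
    from proper_map_compose[OF this proper_labelled_quot[OF bounded, folded X_def]]
    have pr: "proper_map T (top_of_set cotorus) (snd \<circ> G)" .
    have eq: "(snd \<circ> G) y = snd y" if "y \<in> topspace T" for y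
      using HG(2)[of y] sndH[of "G y"] that by (simp add: topT)
    have "{y \<in> topspace T. snd y = z} = {y \<in> topspace T. (snd \<circ> G) y = z}" for z
      using eq by (intro Collect_cong) auto
    moreover have "closed_map T (top_of_set cotorus) snd"
      by (rule closed_map_eq[OF proper_imp_closed_map[OF pr] eq])
    ultimately show ?thesis
      using pr unfolding proper_map_def by simp
  qed
  ultimately show ?thesis
    using homeomorphic_maps_imp_map[OF hm] sndH unfolding X_def by blast
qed

end

section \<open>Edges of a tropical curve\<close>

text \<open>Simultaneous Dirichlet approximation: an integral vector sufficiently close to a large
  multiple of \<open>v\<close> is orthogonal to every integral vector orthogonal to \<open>v\<close>.\<close>

lemma integral_vec_orthogonal:
  fixes v :: "real^'n::finite" and A :: "(real^'n) set"
  assumes "v \<noteq> 0" "finite A" "\<And>a. a \<in> A \<Longrightarrow> integral_vec a \<and> a \<bullet> v = 0"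
  obtains m where "integral_vec m" "m \<noteq> 0" "\<And>a. a \<in> A \<Longrightarrow> a \<bullet> m = 0"
proof -
  obtain j where j: "v $ j \<noteq> 0" using assms(1) by (auto simp: vec_eq_iff)
  \<comment> \<open>With w $ j = 1 the j-th coordinate of m differs by less than 1/N \<le> 1 from
    the integer q \<ge> 1, so it is not 0.\<close>
  define w where "w = (1 / v $ j) *\<^sub>R v"
  have w: "w $ j = 1" "\<And>a. a \<in> A \<Longrightarrow> a \<bullet> w = 0" using j assms(3) by (auto simp: w_def)
  obtain f :: "'n \<Rightarrow> nat" where f: "bij_betw f UNIV {0..<CARD('n)}" using ex_bij_betw_finite_nat[OF finite] by blast
  \<comment> \<open>N exceeds the sum of the absolute coordinates of every a in A, which makes a
    \<bullet> m an integer of modulus less than 1.\<close>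
  define N where "N = nat \<lceil>\<Sum>a\<in>A. \<Sum>i\<in>UNIV. \<bar>a $ i\<bar>\<rceil> + 1"
  have N0: "N > 0" by (simp add: N_def)
  obtain q p where q: "0 < q" and p: "\<And>i. i < CARD('n) \<Longrightarrow> \<bar>of_int q * w $ (inv f i) - of_int (p i)\<bar> < 1 / N"
    using Dirichlet_approx_simult[where N = N and \<theta> = "\<lambda>i. w $ (inv f i)" and n = "CARD('n)"] N0 by metis
  define m :: "real^'n" where "m = (\<chi> i. of_int (p (f i)))"
  have near: "\<bar>of_int q * w $ i - m $ i\<bar> < 1 / N" for i
  proof -
    have "f i < CARD('n)" "inv f (f i) = i"
      using f by (auto simp: bij_betw_def inv_f_f)
    then show ?thesis using p[of "f i"] by (simp add: m_def)
  qed
  have N: "real N \<ge> 1" by (simp add: N_def)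
  have "integral_vec m" by (simp add: integral_vec_def m_def)
  moreover have "m \<noteq> 0"
  proof
    assume "m = 0"
    then have "of_int q < 1 / real N" using near[of j] w(1) q by simp
    moreover have "1 / real N \<le> 1" using N by simp
    ultimately show False using q by linarith
  qed
  moreover have "a \<bullet> m = 0" if a: "a \<in> A" for a
  proof -
    have "\<bar>a \<bullet> m\<bar> = \<bar>a \<bullet> (of_int q *\<^sub>R w - m)\<bar>" using w(2)[OF a] by (simp add: inner_diff_right)
    also have "\<dots> \<le> (\<Sum>i\<in>UNIV. \<bar>a $ i\<bar> * \<bar>of_int q * w $ i - m $ i\<bar>)"
      unfolding inner_vec_def by (rule order_trans[OF sum_abs]) (simp add: abs_mult)
    also have "\<dots> \<le> (\<Sum>i\<in>UNIV. \<bar>a $ i\<bar> * (1 / N))"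
      by (intro sum_mono mult_left_mono less_imp_le[OF near]) auto
    also have "\<dots> = (\<Sum>i\<in>UNIV. \<bar>a $ i\<bar>) / N" by (simp add: sum_divide_distrib)
    also have "\<dots> < 1"
    proof -
      have "(\<Sum>i\<in>UNIV. \<bar>a $ i\<bar>) \<le> (\<Sum>a\<in>A. \<Sum>i\<in>UNIV. \<bar>a $ i\<bar>)"
        using a assms(2) by (intro member_le_sum) (auto intro: sum_nonneg)
      also have "\<dots> < real N" unfolding N_def by linarith
      finally show ?thesis using N by simp
    qed
    finally have "\<bar>a \<bullet> m\<bar> < 1" .
    moreover have "a \<bullet> m \<in> \<int>" using assms(3)[OF a] \<open>integral_vec m\<close> integral_vec_inner_Ints by blast
    ultimately show ?thesis by (rule Ints_nonzero_abs_less1[rotated])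
  qed
  ultimately show ?thesis by (rule that)
qed

lemma primitive_multiple:
  fixes m :: "real^'n::finite"
  assumes "integral_vec m" "m \<noteq> 0" obtains u c where "primitive_vec u" "m = c *\<^sub>R u" "c \<noteq> 0"
proof -
  define g where "g = Gcd (range (\<lambda>i. \<lfloor>m $ i\<rfloor>))"
  have mi: "m $ i = of_int \<lfloor>m $ i\<rfloor>" for i using assms(1) by (simp add: integral_vec_def)
  have "g \<noteq> 0"
  proof
    assume "g = 0"
    then have "\<lfloor>m $ i\<rfloor> = 0" for i unfolding g_def Gcd_0_iff by auto
    then show False using mi assms(2) by (metis of_int_0 vec_eq_iff zero_index)
  qed
  then have g: "g > 0" using g_def by (metis Gcd_int_greater_eq_0 order_le_less)
  have dvd: "g dvd \<lfloor>m $ i\<rfloor>" for i unfolding g_def by (rule Gcd_dvd) simp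
  define u :: "real^'n" where "u = (\<chi> i. of_int (\<lfloor>m $ i\<rfloor> div g))"
  have mu: "m = of_int g *\<^sub>R u"
  proof -
    have "m $ i = of_int g * of_int (\<lfloor>m $ i\<rfloor> div g)" for i
      by (subst mi) (metis dvd dvd_mult_div_cancel of_int_mult)
    then show ?thesis by (simp add: vec_eq_iff u_def)
  qed
  have "Gcd (range (\<lambda>i. \<lfloor>u $ i\<rfloor>)) = 1"
  proof -
    let ?h = "Gcd (range (\<lambda>i. \<lfloor>u $ i\<rfloor>))"
    have "g * ?h dvd g"
      unfolding g_def
    proof (rule Gcd_greatest)
      fix b assume "b \<in> range (\<lambda>i. \<lfloor>m $ i\<rfloor>)"
      then obtain i where b: "b = \<lfloor>m $ i\<rfloor>" by blast
      have "?h dvd \<lfloor>u $ i\<rfloor>" by (rule Gcd_dvd) simp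
      moreover have "\<lfloor>m $ i\<rfloor> = g * \<lfloor>u $ i\<rfloor>" using dvd[of i] by (simp add: u_def)
      ultimately show "Gcd (range (\<lambda>i. \<lfloor>m $ i\<rfloor>)) * ?h dvd b" unfolding b g_def[symmetric] by (simp add: mult_dvd_mono)
    qed
    then have "?h dvd 1" using g by (metis dvd_mult_cancel_left mult.right_neutral less_irrefl)
    then show ?thesis by (metis Gcd_int_greater_eq_0 zdvd1_eq abs_of_nonneg)
  qed
  then have "primitive_vec u" by (simp add: primitive_vec_def integral_vec_def u_def)
  then show ?thesis using that[OF _ mu] g by simp
qed

text \<open>The half-spaces whose boundary contains the midpoint z of two points of S have normals
  orthogonal to the segment. An integral m orthogonal to these normals can be followed from z for a
  short time inside S, and in dimension 1 it must be parallel to S.\<close>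

lemma primitive_direction_exists:
  fixes S :: "(real^'n::finite) set"
  assumes "rational_polyhedral_domain S" "aff_dim S = 1"
  obtains u where "primitive_vec u" "\<And>x. x \<in> S \<Longrightarrow> affine hull S = {x + t *\<^sub>R u | t. True}"
    "closed S" "convex S" "\<And>x. S \<noteq> {x}" "S \<noteq> {}"
proof -
  obtain F where F: "finite F" "S = \<Inter>F" "\<And>H. H \<in> F \<Longrightarrow> \<exists>a c. integral_vec a \<and> H = {x. a \<bullet> x \<le> c}"
    using assms(1) by (auto simp: rational_polyhedral_domain_def)
  then obtain a c where ac: "\<And>H. H \<in> F \<Longrightarrow> integral_vec (a H) \<and> H = {x. a H \<bullet> x \<le> c H}" by metis
  have mem: "x \<in> S \<longleftrightarrow> (\<forall>H\<in>F. a H \<bullet> x \<le> c H)" for x using ac by (auto simp: F(2))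
  have half: "closed H \<and> convex H" if "H \<in> F" for H
  proof -
    have "closed {x. a H \<bullet> x \<le> c H}" "convex {x. a H \<bullet> x \<le> c H}"
      by (rule closed_halfspace_le convex_halfspace_le)+
    then show ?thesis using ac[OF that] by simp
  qed
  have cl: "closed S" and cv: "convex S"
    unfolding F(2) using half by (auto intro: closed_Inter convex_Inter)
  have ne: "S \<noteq> {}" "S \<noteq> {x}" for x using assms(2) by auto
  obtain x where "x \<in> S" using ne(1) by blast
  then obtain y where xy: "x \<in> S" "y \<in> S" "x \<noteq> y" using ne(2)[of x] by blast
  define v where "v = y - x"
  have v: "v \<noteq> 0" using xy by (simp add: v_def)
  have hull: "affine hull S = {x + t *\<^sub>R v | t. True}"
  proof -
    have "affine hull {x, y} = affine hull S"
    proof (rule affine_dim_equal)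
      show "affine hull {x, y} \<subseteq> affine hull S" using xy by (intro hull_mono) auto
      show "aff_dim (affine hull {x, y}) = aff_dim (affine hull S)" using assms(2) xy(3) by simp
    qed auto
    moreover have "affine hull {x, y} = {x + t *\<^sub>R v | t. True}" by (auto simp: affine_hull_2_alt v_def)
    ultimately show ?thesis by simp
  qed
  define z where "z = (1/2) *\<^sub>R (x + y)"
  define I where "I = {H\<in>F. a H \<bullet> z = c H}"
  have az: "a H \<bullet> z = (a H \<bullet> x + a H \<bullet> y) / 2" for H by (simp add: z_def inner_add_right)
  have perp: "a H \<bullet> v = 0" if "H \<in> I" for H
  proof -
    have "a H \<bullet> x \<le> c H" "a H \<bullet> y \<le> c H" using that xy mem by (auto simp: I_def)
    then show ?thesis using that az[of H] by (simp add: I_def v_def inner_diff_right)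
  qed
  have zS: "a H \<bullet> z \<le> c H" if "H \<in> F" for H
    using that xy mem az[of H] by fastforce
  obtain m where m: "integral_vec m" "m \<noteq> 0" "\<And>H. H \<in> I \<Longrightarrow> a H \<bullet> m = 0"
  proof (rule integral_vec_orthogonal[OF v])
    show "finite (a ` I)" using F(1) by (simp add: I_def)
    show "integral_vec b \<and> b \<bullet> v = 0" if "b \<in> a ` I" for b
      using that perp ac by (force simp: I_def)
  qed auto
  have "\<forall>H\<in>F. eventually (\<lambda>e. a H \<bullet> (z + e *\<^sub>R m) \<le> c H) (at_right (0::real))"
  proof
    fix H assume H: "H \<in> F"
    show "eventually (\<lambda>e. a H \<bullet> (z + e *\<^sub>R m) \<le> c H) (at_right (0::real))"
    proof (cases "H \<in> I")
      case True
      then show ?thesis using m(3) by (simp add: inner_add_right I_def)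
    next
      case False
      then have lt: "a H \<bullet> z < c H" using zS[OF H] H by (auto simp: I_def)
      have "((\<lambda>e. a H \<bullet> (z + e *\<^sub>R m)) \<longlongrightarrow> a H \<bullet> (z + 0 *\<^sub>R m)) (at_right (0::real))"
        by (intro tendsto_intros)
      then have "eventually (\<lambda>e. a H \<bullet> (z + e *\<^sub>R m) < c H) (at_right (0::real))"
        using lt by (intro order_tendstoD(2)) auto
      then show ?thesis by eventually_elim simp
    qed
  qed
  then have "eventually (\<lambda>e. \<forall>H\<in>F. a H \<bullet> (z + e *\<^sub>R m) \<le> c H) (at_right (0::real))"
    by (intro eventually_ball_finite F(1))
  then obtain e :: real where e: "e > 0" "z + e *\<^sub>R m \<in> S"
    unfolding mem by (metis (mono_tags, lifting) dense eventually_at_right_field)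
  have "z \<in> S" using zS mem by blast
  then obtain t1 t2 where t: "z = x + t1 *\<^sub>R v" "z + e *\<^sub>R m = x + t2 *\<^sub>R v"
    using e(2) hull hull_inc[of _ S affine] by blast
  then have "e *\<^sub>R m = (t2 - t1) *\<^sub>R v" by (metis add_diff_cancel_left add_diff_cancel_left' scaleR_left_diff_distrib)
  then have "m = ((t2 - t1) / e) *\<^sub>R v" using e(1) by (simp add: eq_vector_fraction_iff)
  moreover obtain u d where u: "primitive_vec u" "m = d *\<^sub>R u" "d \<noteq> 0" using primitive_multiple[OF m(1,2)] .
  ultimately have "d *\<^sub>R u = ((t2 - t1) / e) *\<^sub>R v" by simp
  moreover from this have "(t2 - t1) / e \<noteq> 0" using u m(2) by auto
  ultimately obtain b where vu: "v = b *\<^sub>R u" "b \<noteq> 0" using u(3)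
    by (metis divide_eq_0_iff eq_vector_fraction_iff)
  have "affine hull S = {w + t *\<^sub>R u | t. True}" if w: "w \<in> S" for w
  proof -
    obtain t0 where w: "w = x + t0 *\<^sub>R v" using w hull hull_inc[of w S affine] by blast
    show ?thesis
      unfolding hull
    proof (intro equalityI subsetI; clarify)
      fix t show "\<exists>s. x + t *\<^sub>R v = w + s *\<^sub>R u \<and> True"
        by (intro exI[of _ "(t - t0) * b"]) (simp add: w vu algebra_simps)
    next
      fix t show "\<exists>s. w + t *\<^sub>R u = x + s *\<^sub>R v \<and> True"
        using vu(2) by (intro exI[of _ "t0 + t / b"]) (simp add: w vu(1) algebra_simps)
    qed
  qed
  then show ?thesis using that u(1) cl cv ne by blast
qed

text \<open>The choice fixes u up to sign; only the line spanned by u and the integrality of q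
  \<bullet> u matter later.\<close>

definition edge_vec :: "(real^'n::finite) set \<Rightarrow> real^'n" where
  "edge_vec S = (SOME u. primitive_vec u \<and> (\<forall>x\<in>S. affine hull S = {x + t *\<^sub>R u | t. True}))"

context
  fixes S :: "(real^'n::finite) set"
  assumes S: "rational_polyhedral_domain S" "aff_dim S = 1"
begin

lemma edge_closed: "closed S" and edge_convex: "convex S" and edge_not_singleton: "S \<noteq> {x}"
  by (rule primitive_direction_exists[OF S]; assumption)+

lemma edge_vec: "primitive_vec (edge_vec S)" "x \<in> S \<Longrightarrow> affine hull S = {x + t *\<^sub>R edge_vec S | t. True}"
proof -
  have "\<exists>u. primitive_vec u \<and> (\<forall>x\<in>S. affine hull S = {x + t *\<^sub>R u | t. True})"
    using primitive_direction_exists[OF S] by metis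
  from someI_ex[OF this, folded edge_vec_def]
  show "primitive_vec (edge_vec S)" "x \<in> S \<Longrightarrow> affine hull S = {x + t *\<^sub>R edge_vec S | t. True}" by auto
qed

lemma edge_line: "x \<in> S \<Longrightarrow> y \<in> S \<Longrightarrow> \<exists>t. y = x + t *\<^sub>R edge_vec S"
  using edge_vec(2)[of x] hull_inc[of y S affine] by auto

lemma edge_frontier: "rel_frontier S = S - rel_interior S"
  by (simp add: rel_frontier_def closure_closed[OF edge_closed])

lemma edge_interior:
  assumes "p \<in> S"
  shows "p \<in> rel_interior S \<longleftrightarrow> (\<exists>\<delta>>0. \<forall>t. \<bar>t\<bar> < \<delta> \<longrightarrow> p + t *\<^sub>R edge_vec S \<in> S)"
proof
  have nz: "norm (edge_vec S) > 0" using primitive_vec_nz[OF edge_vec(1)] by simp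
  {
    assume "p \<in> rel_interior S"
    then obtain e where e: "e > 0" "ball p e \<inter> affine hull S \<subseteq> S" by (auto simp: mem_rel_interior_ball)
    have "p + t *\<^sub>R edge_vec S \<in> S" if "\<bar>t\<bar> < e / norm (edge_vec S)" for t
    proof -
      have "p + t *\<^sub>R edge_vec S \<in> ball p e" using that nz by (simp add: dist_norm field_simps)
      moreover have "p + t *\<^sub>R edge_vec S \<in> affine hull S" using edge_vec(2)[OF assms] by auto
      ultimately show ?thesis using e(2) by blast
    qed
    then show "\<exists>\<delta>>0. \<forall>t. \<bar>t\<bar> < \<delta> \<longrightarrow> p + t *\<^sub>R edge_vec S \<in> S"
      using e(1) nz by (intro exI[of _ "e / norm (edge_vec S)"]) simp
  next
    assume "\<exists>\<delta>>0. \<forall>t. \<bar>t\<bar> < \<delta> \<longrightarrow> p + t *\<^sub>R edge_vec S \<in> S"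
    then obtain \<delta> where \<delta>: "\<delta> > 0" "\<And>t. \<bar>t\<bar> < \<delta> \<Longrightarrow> p + t *\<^sub>R edge_vec S \<in> S" by blast
    have "ball p (\<delta> * norm (edge_vec S)) \<inter> affine hull S \<subseteq> S"
    proof
      fix y assume y: "y \<in> ball p (\<delta> * norm (edge_vec S)) \<inter> affine hull S"
      then obtain t where t: "y = p + t *\<^sub>R edge_vec S" using edge_vec(2)[OF assms] by auto
      then have "\<bar>t\<bar> < \<delta>" using y nz by (simp add: dist_norm)
      then show "y \<in> S" using \<delta>(2) t by blast
    qed
    then show "p \<in> rel_interior S"
      using \<delta>(1) nz assms unfolding mem_rel_interior_ball by (intro conjI exI[of _ "\<delta> * norm (edge_vec S)"]) auto
  }
qed

lemma edge_segment:
  assumes "x + a *\<^sub>R d \<in> S" "x + b *\<^sub>R d \<in> S" "a \<le> t" "t \<le> b" shows "x + t *\<^sub>R d \<in> S"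
proof (cases "a = b")
  case False
  define s where "s = (t - a) / (b - a)"
  have ab: "b - a > 0" using assms False by simp
  have s: "0 \<le> s" "s \<le> 1" using assms ab by (auto simp: s_def)
  have "(1 - s) *\<^sub>R (x + a *\<^sub>R d) + s *\<^sub>R (x + b *\<^sub>R d) \<in> S"
    using edge_convex assms s by (simp add: convex_alt)
  moreover have "(1 - s) *\<^sub>R (x + a *\<^sub>R d) + s *\<^sub>R (x + b *\<^sub>R d) = x + (a + s * (b - a)) *\<^sub>R d"
    by (simp add: algebra_simps)
  moreover have "a + s * (b - a) = t" using ab by (simp add: s_def)
  ultimately show ?thesis by simp
qed (use assms in auto)

text \<open>S is an interval in a line and v is an end of it: points of S on both sides would make v
  interior. So exactly one of the two primitive vectors points into S, which is what the definite
  description in \<open>edge_dir\<close> requires.\<close>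

lemma edge_endpoint:
  assumes v: "v \<in> rel_frontier S"
  shows "edge_dir v S = edge_vec S \<or> edge_dir v S = - edge_vec S"
    and "\<exists>\<delta>>0. \<forall>t. 0 \<le> t \<and> t \<le> \<delta> \<longrightarrow> v + t *\<^sub>R edge_dir v S \<in> S"
    and "p \<in> S \<Longrightarrow> \<exists>t\<ge>0. p = v + t *\<^sub>R edge_dir v S"
    and "primitive_vec (edge_dir v S)"
proof -
  have vS: "v \<in> S" "v \<notin> rel_interior S" using v by (auto simp: edge_frontier)
  obtain y where y: "y \<in> S" "y \<noteq> v" using edge_not_singleton[of v] vS(1) by blast
  obtain t0 where t0: "y = v + t0 *\<^sub>R edge_vec S" using edge_line[OF vS(1) y(1)] by blast
  define e where "e = (if t0 > 0 then edge_vec S else - edge_vec S)"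
  have e_pm: "e = edge_vec S \<or> e = - edge_vec S" by (simp add: e_def)
  have t0nz: "\<bar>t0\<bar> > 0" using y t0 by auto
  have ye: "v + \<bar>t0\<bar> *\<^sub>R e \<in> S" using y t0 by (auto simp: e_def)
  have pe: "primitive_vec e" using edge_vec(1) primitive_vec_uminus by (auto simp: e_def)
  have line: "\<exists>t. p = v + t *\<^sub>R e" if p: "p \<in> S" for p
  proof -
    obtain t where "p = v + t *\<^sub>R edge_vec S" using edge_line[OF vS(1) p] by blast
    then have "p = v + t *\<^sub>R e \<or> p = v + (- t) *\<^sub>R e" by (auto simp: e_def)
    then show ?thesis by blast
  qed
  have nn: "t \<ge> 0" if p: "v + t *\<^sub>R e \<in> S" for t
  proof (rule ccontr)
    assume "\<not> t \<ge> 0"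
    then have t: "t < 0" by simp
    have seg: "v + s *\<^sub>R e \<in> S" if "\<bar>s\<bar> < min \<bar>t0\<bar> (- t)" for s
      using edge_segment[OF p ye, of s] that by auto
    have "v + s *\<^sub>R edge_vec S \<in> S" if "\<bar>s\<bar> < min \<bar>t0\<bar> (- t)" for s
      using e_pm seg[of s] seg[of "- s"] that by auto
    moreover have "min \<bar>t0\<bar> (- t) > 0" using t t0nz by simp
    ultimately have "v \<in> rel_interior S" unfolding edge_interior[OF vS(1)] by blast
    then show False using vS(2) by simp
  qed
  have dir: "edge_dir v S = e"
    unfolding edge_dir_def
  proof (rule the_equality)
    show "primitive_vec e \<and> (\<exists>t>0. v + t *\<^sub>R e \<in> S)" using pe ye t0nz by blast
    fix u assume u: "primitive_vec u \<and> (\<exists>t>0. v + t *\<^sub>R u \<in> S)"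
    then obtain t where t: "t > 0" "v + t *\<^sub>R u \<in> S" by blast
    obtain s where s: "v + t *\<^sub>R u = v + s *\<^sub>R e" using line[OF t(2)] by blast
    then have s0: "s \<ge> 0" using nn t(2) by simp
    have tu: "t *\<^sub>R u = s *\<^sub>R e" using s by simp
    then have ue: "u = (s / t) *\<^sub>R e" using t(1) by (simp add: eq_vector_fraction_iff)
    have "s \<noteq> 0" using ue primitive_vec_nz[of u] u by auto
    then have "s / t > 0" using s0 t(1) by simp
    then show "u = e" using primitive_vec_unique[OF _ pe ue] u by simp
  qed
  show "edge_dir v S = edge_vec S \<or> edge_dir v S = - edge_vec S" unfolding dir by (rule e_pm)
  show "primitive_vec (edge_dir v S)" unfolding dir by (rule pe)
  show "\<exists>\<delta>>0. \<forall>t. 0 \<le> t \<and> t \<le> \<delta> \<longrightarrow> v + t *\<^sub>R edge_dir v S \<in> S"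
    unfolding dir using edge_segment[of v 0 e "\<bar>t0\<bar>"] ye vS(1) t0nz by (intro exI[of _ "\<bar>t0\<bar>"]) auto
  show "\<exists>t\<ge>0. p = v + t *\<^sub>R edge_dir v S" if "p \<in> S"
    unfolding dir using line[OF that] nn that by blast
qed

lemma edge_interior_dir:
  assumes "v \<in> rel_frontier S" "0 < t" "t < \<delta>" "\<And>s. 0 \<le> s \<Longrightarrow> s \<le> \<delta> \<Longrightarrow> v + s *\<^sub>R edge_dir v S \<in> S"
  shows "v + t *\<^sub>R edge_dir v S \<in> rel_interior S"
proof -
  let ?p = "v + t *\<^sub>R edge_dir v S"
  have p: "?p \<in> S" using assms by auto
  have m: "?p + s *\<^sub>R edge_dir v S \<in> S" if "\<bar>s\<bar> < min t (\<delta> - t)" for s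
    using assms(4)[of "t + s"] that by (auto simp: algebra_simps)
  have "?p + s *\<^sub>R edge_vec S \<in> S" if "\<bar>s\<bar> < min t (\<delta> - t)" for s
    using edge_endpoint(1)[OF assms(1)]
  proof
    assume "edge_dir v S = edge_vec S" then show ?thesis using m[OF that] by simp
  next
    assume "edge_dir v S = - edge_vec S" then show ?thesis using m[of "- s"] that by simp
  qed
  moreover have "min t (\<delta> - t) > 0" using assms by simp
  ultimately show ?thesis unfolding edge_interior[OF p] by blast
qed

text \<open>Two ends with the same inward direction would each lie ahead of the other, hence
  coincide, and only two directions are available.\<close>

lemma finite_edge_frontier: "finite (rel_frontier S)"
proof -
  have "inj_on (\<lambda>v. edge_dir v S) (rel_frontier S)"
  proof (rule inj_onI)
    fix v w assume vw: "v \<in> rel_frontier S" "w \<in> rel_frontier S" "edge_dir v S = edge_dir w S"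
    have "v \<in> S" "w \<in> S" using vw by (auto simp: edge_frontier)
    then obtain s t where st: "s \<ge> 0" "t \<ge> 0" "w = v + s *\<^sub>R edge_dir v S" "v = w + t *\<^sub>R edge_dir v S"
      using edge_endpoint(3)[OF vw(1), of w] edge_endpoint(3)[OF vw(2), of v] vw(3) by metis
    have "(v + s *\<^sub>R edge_dir v S) + t *\<^sub>R edge_dir v S = v"
      by (simp only: st(3)[symmetric] st(4)[symmetric])
    then have "(s + t) *\<^sub>R edge_dir v S = 0" by (simp add: scaleR_left_distrib add.assoc)
    then have "s + t = 0" using primitive_vec_nz[OF edge_endpoint(4)[OF vw(1)]] by simp
    then show "v = w" using st by simp
  qed
  moreover have "(\<lambda>v. edge_dir v S) ` rel_frontier S \<subseteq> {edge_vec S, - edge_vec S}"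
    using edge_endpoint(1) by blast
  ultimately show ?thesis by (meson finite.emptyI finite_insert finite_subset finite_imageD)
qed

end

section \<open>Assembling the lift\<close>

context
  fixes E :: "(real^'n::finite) set set" and w :: "(real^'n) set \<Rightarrow> nat"
  assumes curve: "tropical_curve E w"
begin

lemma edge_domain: "S \<in> E \<Longrightarrow> rational_polyhedral_domain S" "S \<in> E \<Longrightarrow> aff_dim S = 1" "S \<in> E \<Longrightarrow> w S > 0"
  using curve by (auto simp: tropical_curve_def)

lemma edges_locally_finite: "\<exists>N. open N \<and> p \<in> N \<and> finite {S\<in>E. S \<inter> N \<noteq> {}}"
  using curve by (auto simp: tropical_curve_def locally_finite_in_def)

lemma vertex_frontier:
  assumes "v \<in> vertices E" "S \<in> E" "v \<in> S" shows "v \<in> rel_frontier S"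
proof -
  obtain S' where S': "S' \<in> E" "v \<in> rel_frontier S'" using assms(1) by (auto simp: vertices_def)
  then have "v \<in> S'" using edge_frontier[OF edge_domain(1,2)] by blast
  show ?thesis
  proof (cases "S = S'")
    case False
    then have "S \<inter> S' = {} \<or> (\<exists>v. S \<inter> S' = {v} \<and> v \<in> rel_frontier S \<and> v \<in> rel_frontier S')"
      using curve assms(2) S'(1) by (auto simp: tropical_curve_def)
    moreover have vSS: "v \<in> S \<inter> S'" using assms(3) \<open>v \<in> S'\<close> by simp
    ultimately obtain v' where "S \<inter> S' = {v'}" "v' \<in> rel_frontier S" by auto
    then show ?thesis using vSS by simp
  qed (use S' in simp)
qed

lemma edges_meet_in_vertex:
  assumes "S \<in> E" "S' \<in> E" "p \<in> S" "p \<in> S'" "S \<noteq> S'" shows "p \<in> vertices E" "S \<inter> S' = {p}"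
proof -
  have "S \<inter> S' = {} \<or> (\<exists>v. S \<inter> S' = {v} \<and> v \<in> rel_frontier S \<and> v \<in> rel_frontier S')"
    using curve assms by (auto simp: tropical_curve_def)
  moreover have pSS: "p \<in> S \<inter> S'" using assms by simp
  ultimately obtain v where "S \<inter> S' = {v}" "v \<in> rel_frontier S" by auto
  moreover from this have "p = v" using pSS by simp
  ultimately show "p \<in> vertices E" "S \<inter> S' = {p}" using assms(1) by (auto simp: vertices_def)
qed

lemma finite_edges_compact: "compact C \<Longrightarrow> finite {S\<in>E. S \<inter> C \<noteq> {}}"
proof -
  assume C: "compact C"
  define N where "N = (\<lambda>p. SOME N. open N \<and> p \<in> N \<and> finite {S\<in>E. S \<inter> N \<noteq> {}})"
  have N: "open (N p) \<and> p \<in> N p \<and> finite {S\<in>E. S \<inter> N p \<noteq> {}}" for p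
    unfolding N_def by (rule someI_ex[OF edges_locally_finite])
  have cov: "C \<subseteq> (\<Union>p\<in>C. N p)" using N by blast
  obtain D where D: "D \<subseteq> C" "finite D" "C \<subseteq> (\<Union>p\<in>D. N p)"
    by (rule compactE_image[OF C _ cov]) (use N in auto)
  have "{S\<in>E. S \<inter> C \<noteq> {}} \<subseteq> (\<Union>p\<in>D. {S\<in>E. S \<inter> N p \<noteq> {}})" using D(3) by blast
  moreover have "finite (\<Union>p\<in>D. {S\<in>E. S \<inter> N p \<noteq> {}})" using N by (intro finite_UN_I D(2)) simp
  ultimately show ?thesis by (rule finite_subset)
qed

lemma finite_vertices:
  assumes "finite {S\<in>E. S \<inter> N \<noteq> {}}" shows "finite (vertices E \<inter> N)"
proof (rule finite_subset)
  show "vertices E \<inter> N \<subseteq> (\<Union>S\<in>{S\<in>E. S \<inter> N \<noteq> {}}. rel_frontier S)"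
    using edge_frontier[OF edge_domain(1,2)] by (auto simp: vertices_def)
  show "finite (\<Union>S\<in>{S\<in>E. S \<inter> N \<noteq> {}}. rel_frontier S)"
    using assms finite_edge_frontier[OF edge_domain(1,2)] by auto
qed

text \<open>Inside the ball the curve is the cone over the edges at v: local finiteness removes the
  other edges, and each of the finitely many edges at v contains an initial segment. The bound 1
  later confines the vertices whose junctions meet a bounded set.\<close>

lemma vertex_radius:
  assumes v: "v \<in> vertices E" and G: "open G" "v \<in> G"
  shows "\<exists>\<rho>>0. \<rho> \<le> 1 \<and> cball v \<rho> \<subseteq> G \<and> (\<forall>S\<in>E. S \<inter> cball v \<rho> \<noteq> {} \<longrightarrow> v \<in> S) \<and>
    (\<forall>S\<in>E. v \<in> S \<longrightarrow> (\<forall>t\<ge>0. norm (t *\<^sub>R edge_dir v S) \<le> \<rho> \<longrightarrow> v + t *\<^sub>R edge_dir v S \<in> S))"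
proof -
  obtain N where N: "open N" "v \<in> N" "finite {S\<in>E. S \<inter> N \<noteq> {}}" using edges_locally_finite by blast
  define F where "F = {S\<in>E. S \<inter> N \<noteq> {} \<and> v \<notin> S}"
  define I where "I = {S\<in>E. v \<in> S}"
  have fin: "finite F" "finite I"
    by (rule finite_subset[OF _ N(3)]; use N(2) in \<open>auto simp: F_def I_def\<close>)+
  have "open (N \<inter> G \<inter> (\<Inter>S\<in>F. - S))"
    using N(1) G(1) fin edge_closed[OF edge_domain(1,2)] by (intro open_Int open_INT ballI) (auto simp: F_def open_Compl)
  moreover have "v \<in> N \<inter> G \<inter> (\<Inter>S\<in>F. - S)" using N G by (auto simp: F_def)
  ultimately have "\<exists>e>0. cball v e \<subseteq> N \<inter> G \<inter> (\<Inter>S\<in>F. - S)"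
    by (rule open_contains_cball[THEN iffD1, rule_format])
  then obtain \<rho>0 where \<rho>0: "\<rho>0 > 0" "cball v \<rho>0 \<subseteq> N \<inter> G \<inter> (\<Inter>S\<in>F. - S)" by blast
  have "\<forall>S\<in>I. eventually (\<lambda>\<rho>. \<forall>t\<ge>0. norm (t *\<^sub>R edge_dir v S) \<le> \<rho> \<longrightarrow> v + t *\<^sub>R edge_dir v S \<in> S) (at_right (0::real))"
  proof
    fix S assume "S \<in> I"
    then have SE: "S \<in> E" and vf: "v \<in> rel_frontier S" using vertex_frontier[OF v] by (auto simp: I_def)
    note pr = edge_domain(1,2)[OF SE]
    have nz: "norm (edge_dir v S) > 0" using primitive_vec_nz[OF edge_endpoint(4)[OF pr vf]] by simp
    obtain \<delta> where \<delta>: "\<delta> > 0" "\<And>t. 0 \<le> t \<Longrightarrow> t \<le> \<delta> \<Longrightarrow> v + t *\<^sub>R edge_dir v S \<in> S"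
      using edge_endpoint(2)[OF pr vf] by blast
    have "\<forall>t\<ge>0. norm (t *\<^sub>R edge_dir v S) \<le> \<rho> \<longrightarrow> v + t *\<^sub>R edge_dir v S \<in> S"
      if "\<rho> < \<delta> * norm (edge_dir v S)" for \<rho>
    proof (intro allI impI)
      fix t :: real assume t: "t \<ge> 0" "norm (t *\<^sub>R edge_dir v S) \<le> \<rho>"
      then have "t * norm (edge_dir v S) < \<delta> * norm (edge_dir v S)" using that by simp
      then have "t \<le> \<delta>" using nz by simp
      then show "v + t *\<^sub>R edge_dir v S \<in> S" using \<delta>(2) t(1) by blast
    qed
    moreover have "\<delta> * norm (edge_dir v S) > 0" using \<delta>(1) nz by simp
    ultimately show "eventually (\<lambda>\<rho>. \<forall>t\<ge>0. norm (t *\<^sub>R edge_dir v S) \<le> \<rho> \<longrightarrow> v + t *\<^sub>R edge_dir v S \<in> S) (at_right (0::real))"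
      unfolding eventually_at_right_field by blast
  qed
  then have "eventually (\<lambda>\<rho>. \<forall>S\<in>I. \<forall>t\<ge>0. norm (t *\<^sub>R edge_dir v S) \<le> \<rho> \<longrightarrow> v + t *\<^sub>R edge_dir v S \<in> S) (at_right (0::real))"
    by (intro eventually_ball_finite fin)
  then obtain b where b: "b > 0" "\<And>\<rho>. 0 < \<rho> \<Longrightarrow> \<rho> < b \<Longrightarrow>
      \<forall>S\<in>I. \<forall>t\<ge>0. norm (t *\<^sub>R edge_dir v S) \<le> \<rho> \<longrightarrow> v + t *\<^sub>R edge_dir v S \<in> S"
    unfolding eventually_at_right_field by blast
  define \<rho> where "\<rho> = min (min \<rho>0 1) (b / 2)"
  have \<rho>: "\<rho> > 0" "\<rho> \<le> 1" "\<rho> \<le> \<rho>0" "\<rho> < b" using \<rho>0(1) b(1) by (auto simp: \<rho>_def)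
  have sub: "cball v \<rho> \<subseteq> N \<inter> G \<inter> (\<Inter>S\<in>F. - S)" by (rule order_trans[OF subset_cball[OF \<rho>(3)] \<rho>0(2)])
  have "v \<in> S" if S: "S \<in> E" "S \<inter> cball v \<rho> \<noteq> {}" for S
  proof (rule ccontr)
    assume "v \<notin> S"
    then have "S \<in> F" using S sub by (auto simp: F_def)
    then show False using S(2) sub by blast
  qed
  moreover have "\<forall>S\<in>E. v \<in> S \<longrightarrow> (\<forall>t\<ge>0. norm (t *\<^sub>R edge_dir v S) \<le> \<rho> \<longrightarrow> v + t *\<^sub>R edge_dir v S \<in> S)"
    using b(2)[OF \<rho>(1,4)] by (simp add: I_def)
  ultimately show ?thesis using \<rho>(1,2) sub by (intro exI[of _ \<rho>]) auto
qed

definition sheet :: "(real^'n) set \<Rightarrow> nat \<Rightarrow> (real \<times> (real^'n) \<times> (real^'n)) set" where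
  "sheet S k = {(l, q, p). l = real k + 1 \<and> p \<in> S \<and> q \<bullet> edge_vec S \<in> \<int>}"

text \<open>The labels k + 1 are those to which \<open>junction_split\<close> brings the legs, so
  that sheets and junctions match near the vertices.\<close>

definition sheets :: "(real \<times> (real^'n) \<times> (real^'n)) set" where
  "sheets = (\<Union>S\<in>E. \<Union>k<w S. sheet S k)"

lemma sheets_iff: "(l, q, p) \<in> sheets \<longleftrightarrow> (\<exists>S\<in>E. \<exists>k<w S. l = real k + 1 \<and> p \<in> S \<and> q \<bullet> edge_vec S \<in> \<int>)"
  by (auto simp: sheets_def sheet_def)

lemma local_lag_sheet:
  assumes S: "S \<in> E" and p: "p \<notin> rel_frontier S" shows "local_lag (sheet S k) (l, q, p)"
proof (cases "p \<in> S")
  case False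
  show ?thesis
  proof (rule local_lag_empty)
    show "open {x::real \<times> (real^'n) \<times> (real^'n). snd (snd x) \<in> - S}"
      using open_vimage[of "- S" "\<lambda>x::real \<times> (real^'n) \<times> (real^'n). snd (snd x)"] edge_closed[OF edge_domain(1,2)[OF S]]
      by (simp add: vimage_def open_Compl continuous_on_snd continuous_on_id)
  qed (use False in \<open>auto simp: sheet_def\<close>)
next
  case True
  note pr = edge_domain(1,2)[OF S]
  let ?u = "edge_vec S"
  have unz: "?u \<noteq> 0" by (rule primitive_vec_nz[OF edge_vec(1)[OF pr]])
  have "p \<in> rel_interior S" using p True edge_frontier[OF pr] by blast
  then obtain \<delta> where \<delta>: "\<delta> > 0" "\<And>t. \<bar>t\<bar> < \<delta> \<Longrightarrow> p + t *\<^sub>R ?u \<in> S" using edge_interior[OF pr True] by blast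
  define Tb where "Tb = tube ?u (\<lambda>_. 0) (\<lambda>t. t) (\<lambda>_. real k + 1)"
  have "local_lag Tb z" for z
    unfolding Tb_def
    by (rule local_lag_tube[where \<mu> = 0 and \<nu> = 1 and \<gamma> = 0 and
          \<tau> = "\<lambda>x. snd (snd x) \<bullet> ((1 / (?u \<bullet> ?u)) *\<^sub>R ?u)"])
      (use unz in \<open>auto intro!: continuous_intros smooth_on_bounded_linear[OF bounded_linear_ident]\<close>)
  then have "local_lag ((\<lambda>(l, q, p'). (l + 0, 1 *\<^sub>R q + 0, 1 *\<^sub>R p' + p)) ` Tb) (l, q, p)"
    by (intro local_lag_transform_all) auto
  moreover have "(\<lambda>(l, q, p'). (l + 0, 1 *\<^sub>R q + 0, 1 *\<^sub>R p' + p)) ` Tb =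
      {(l, q, p'). l = real k + 1 \<and> (\<exists>t. p' = p + t *\<^sub>R ?u) \<and> q \<bullet> ?u \<in> \<int>}" (is "_ = ?T")
    by (force simp: Tb_def tube_def image_iff algebra_simps)
  ultimately have loc: "local_lag ?T (l, q, p)" by simp
  show ?thesis
  proof (rule local_lag_cong[OF loc])
    show "open {x::real \<times> (real^'n) \<times> (real^'n). norm (snd (snd x) - p) < \<delta> * norm ?u}"
      by (intro open_Collect_less continuous_intros)
    show "(l, q, p) \<in> {x. norm (snd (snd x) - p) < \<delta> * norm ?u}" using \<delta>(1) unz by simp
    have "p' \<in> S \<longleftrightarrow> (\<exists>t. p' = p + t *\<^sub>R ?u)" if near: "norm (p' - p) < \<delta> * norm ?u" for p'
    proof
      assume "p' \<in> S" then show "\<exists>t. p' = p + t *\<^sub>R ?u" by (rule edge_line[OF pr True])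
    next
      assume "\<exists>t. p' = p + t *\<^sub>R ?u"
      then obtain t where t: "p' = p + t *\<^sub>R ?u" by blast
      then have "\<bar>t\<bar> < \<delta>" using near unz by simp
      then show "p' \<in> S" using \<delta>(2) t by blast
    qed
    then show "sheet S k \<inter> {x. norm (snd (snd x) - p) < \<delta> * norm ?u} = ?T \<inter> {x. norm (snd (snd x) - p) < \<delta> * norm ?u}"
      by (auto simp: sheet_def)
  qed
qed

text \<open>Near p there are only finitely many edges. Sheets through a common point have the same
  k, and two edges meet only in a vertex.\<close>

lemma local_lag_sheets:
  assumes p: "p \<notin> vertices E" shows "local_lag sheets (l, q, p)"
proof -
  obtain N where N: "open N" "p \<in> N" "finite {S\<in>E. S \<inter> N \<noteq> {}}" using edges_locally_finite by blast
  define K where "K = Sigma {S\<in>E. S \<inter> N \<noteq> {}} (\<lambda>S. {..<w S})"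
  have "local_lag (\<Union>j\<in>K. sheet (fst j) (snd j)) (l, q, p)"
  proof (rule local_lag_UN)
    show "finite K" unfolding K_def using N(3) by auto
    show "local_lag (sheet (fst j) (snd j)) (l, q, p)" if "j \<in> K" for j
      using that p by (intro local_lag_sheet) (auto simp: K_def vertices_def)
    fix i j assume ij: "i \<in> K" "j \<in> K" "i \<noteq> j"
    show "(l, q, p) \<notin> sheet (fst i) (snd i) \<or> (l, q, p) \<notin> sheet (fst j) (snd j)"
    proof (rule ccontr)
      assume "\<not> ?thesis"
      then have m: "p \<in> fst i" "p \<in> fst j" "snd i = snd j" by (auto simp: sheet_def)
      moreover have "fst i \<in> E" "fst j \<in> E" using ij by (auto simp: K_def)
      ultimately have "fst i = fst j" using edges_meet_in_vertex(1) p by metis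
      then show False using ij(3) m(3) by (simp add: prod_eq_iff)
    qed
  qed
  moreover have "open {x::real \<times> (real^'n) \<times> (real^'n). snd (snd x) \<in> N}"
    using open_vimage[OF N(1), of "\<lambda>x::real \<times> (real^'n) \<times> (real^'n). snd (snd x)"]
    by (simp add: vimage_def continuous_on_snd continuous_on_id)
  moreover have "sheets \<inter> {x. snd (snd x) \<in> N} = (\<Union>j\<in>K. sheet (fst j) (snd j)) \<inter> {x. snd (snd x) \<in> N}"
  proof (intro equalityI subsetI)
    fix x assume "x \<in> sheets \<inter> {x. snd (snd x) \<in> N}"
    then obtain S k where S: "S \<in> E" "k < w S" "x \<in> sheet S k" "snd (snd x) \<in> N" by (auto simp: sheets_def)
    then have "snd (snd x) \<in> S \<inter> N" by (auto simp: sheet_def)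
    then have "(S, k) \<in> K" using S by (auto simp: K_def)
    then show "x \<in> (\<Union>j\<in>K. sheet (fst j) (snd j)) \<inter> {x. snd (snd x) \<in> N}" using S by force
  qed (auto simp: sheets_def K_def)
  ultimately show ?thesis using local_lag_cong N(2) by (metis (no_types, lifting) mem_Collect_eq snd_conv)
qed

lemma lattice_inv_sheets: "lattice_inv sheets"
  unfolding lattice_inv_def
proof (intro allI impI)
  fix l q p and m :: "real^'n" assume "integral_vec m" "(l, q, p) \<in> sheets"
  then obtain S k where S: "S \<in> E" "k < w S" "l = real k + 1" "p \<in> S" "q \<bullet> edge_vec S \<in> \<int>"
    unfolding sheets_iff by blast
  have "m \<bullet> edge_vec S \<in> \<int>"
    using integral_vec_inner_Ints[OF \<open>integral_vec m\<close> primitive_vec_integral[OF edge_vec(1)]] edge_domain S(1) by blast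
  then have "(q + m) \<bullet> edge_vec S \<in> \<int>" using S(5) by (simp add: inner_add_left)
  then show "(l, q + m, p) \<in> sheets" using S unfolding sheets_iff by blast
qed

context
  fixes \<rho> :: "real^'n \<Rightarrow> real"
  assumes \<rho>_pos: "\<And>v. v \<in> vertices E \<Longrightarrow> \<rho> v > 0" and \<rho>_le: "\<And>v. v \<in> vertices E \<Longrightarrow> \<rho> v \<le> 1"
    and \<rho>_meet: "\<And>v S. v \<in> vertices E \<Longrightarrow> S \<in> E \<Longrightarrow> S \<inter> cball v (\<rho> v) \<noteq> {} \<Longrightarrow> v \<in> S"
    and \<rho>_ray: "\<And>v S t. v \<in> vertices E \<Longrightarrow> S \<in> E \<Longrightarrow> v \<in> S \<Longrightarrow> t \<ge> 0 \<Longrightarrow>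
       norm (t *\<^sub>R edge_dir v S) \<le> \<rho> v \<Longrightarrow> v + t *\<^sub>R edge_dir v S \<in> S"
begin

text \<open>A vertex v' closer to v would be an end of an edge S that also contains v. Since S
  follows its ray from v up to length \<rho> v, v' would be an interior point of S.\<close>

lemma vertex_distance:
  assumes "v \<in> vertices E" "v' \<in> vertices E" "v \<noteq> v'" shows "dist v v' \<ge> \<rho> v"
proof (rule ccontr)
  assume "\<not> dist v v' \<ge> \<rho> v"
  then have d: "dist v v' < \<rho> v" by simp
  obtain S where S: "S \<in> E" "v' \<in> rel_frontier S" using assms(2) by (auto simp: vertices_def)
  note pr = edge_domain(1,2)[OF S(1)]
  have v'S: "v' \<in> S" using S(2) edge_frontier[OF pr] by blast
  then have "S \<inter> cball v (\<rho> v) \<noteq> {}" using d by force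
  then have vS: "v \<in> S" using \<rho>_meet assms(1) S(1) by blast
  note vf = vertex_frontier[OF assms(1) S(1) vS]
  have nz: "norm (edge_dir v S) > 0" using primitive_vec_nz[OF edge_endpoint(4)[OF pr vf]] by simp
  obtain t where t: "t \<ge> 0" "v' = v + t *\<^sub>R edge_dir v S" using edge_endpoint(3)[OF pr vf v'S] by blast
  have "t \<noteq> 0" using t assms(3) by auto
  then have t0: "t > 0" using t(1) by simp
  have "t * norm (edge_dir v S) < \<rho> v" using d t by (simp add: dist_norm)
  then have "t < \<rho> v / norm (edge_dir v S)" using nz by (simp add: pos_less_divide_eq)
  moreover have "v + s *\<^sub>R edge_dir v S \<in> S" if "0 \<le> s" "s \<le> \<rho> v / norm (edge_dir v S)" for s
    using that nz by (intro \<rho>_ray assms(1) S(1) vS) (simp_all add: pos_le_divide_eq)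
  ultimately have "v' \<in> rel_interior S" unfolding t(2) by (rule edge_interior_dir[OF pr vf t0])
  then show False using S(2) edge_frontier[OF pr] by blast
qed

lemma balls_disjoint:
  assumes "v \<in> vertices E" "v' \<in> vertices E" "norm (p - v) < \<rho> v / 2" "norm (p - v') < \<rho> v' / 2"
  shows "v = v'"
proof (rule ccontr)
  assume "v \<noteq> v'"
  then have "dist v v' \<ge> \<rho> v" "dist v v' \<ge> \<rho> v'"
    using vertex_distance[of v v'] vertex_distance[of v' v] assms(1,2) by (auto simp: dist_commute)
  moreover have "dist v v' \<le> norm (p - v) + norm (p - v')"
    by (metis dist_norm dist_triangle3 dist_commute)
  ultimately show False using assms(3,4) by linarith
qed

text \<open>Two edges with the same direction at v would share a segment, while distinct edges share
  at most one point.\<close>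

lemma edge_dir_inj:
  assumes v: "v \<in> vertices E" shows "inj_on (edge_dir v) {S\<in>E. v \<in> S}"
proof (rule inj_onI; clarify)
  fix S S' assume S: "S \<in> E" "v \<in> S" and S': "S' \<in> E" "v \<in> S'" and eq: "edge_dir v S = edge_dir v S'"
  show "S = S'"
  proof (rule ccontr)
    assume ne: "S \<noteq> S'"
    have nz: "edge_dir v S \<noteq> 0"
      by (rule primitive_vec_nz[OF edge_endpoint(4)[OF edge_domain(1,2)[OF S(1)] vertex_frontier[OF v S]]])
    let ?t = "\<rho> v / norm (edge_dir v S)"
    have t: "?t > 0" "norm (?t *\<^sub>R edge_dir v S) \<le> \<rho> v" using \<rho>_pos[OF v] nz by auto
    have "v + ?t *\<^sub>R edge_dir v S \<in> S" using \<rho>_ray[OF v S, of ?t] t by simp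
    moreover have "v + ?t *\<^sub>R edge_dir v S \<in> S'" using \<rho>_ray[OF v S', of ?t] t eq by simp
    ultimately have "v + ?t *\<^sub>R edge_dir v S = v" using edges_meet_in_vertex(2)[OF S(1) S'(1) S(2) S'(2) ne] by blast
    then show False using t(1) nz by simp
  qed
qed

text \<open>In this ball an edge is its ray from v, and \<open>edge_dir v S\<close> differs from
  \<open>edge_vec S\<close> by a sign only, so the two integrality conditions coincide.\<close>

lemma sheets_near_vertex:
  assumes v: "v \<in> vertices E" and p: "p \<noteq> v" "norm (p - v) \<le> \<rho> v"
  shows "(l, q, p) \<in> sheets \<longleftrightarrow>
    (\<exists>S\<in>{S\<in>E. v \<in> S}. \<exists>k<w S. leg_at (edge_dir v S) 0 (real k + 1) l q (p - v))"
proof -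
  have "(\<exists>k<w S. l = real k + 1 \<and> p \<in> S \<and> q \<bullet> edge_vec S \<in> \<int>) \<longleftrightarrow>
      v \<in> S \<and> (\<exists>k<w S. leg_at (edge_dir v S) 0 (real k + 1) l q (p - v))" if S: "S \<in> E" for S
  proof -
    note pr = edge_domain(1,2)[OF S]
    have pS: "p \<in> S \<longleftrightarrow> v \<in> S \<and> (\<exists>s>0. p - v = s *\<^sub>R edge_dir v S)"
    proof
      assume pS: "p \<in> S"
      have "p \<in> cball v (\<rho> v)" using p(2) by (simp add: dist_norm norm_minus_commute)
      then have vS: "v \<in> S" using \<rho>_meet[OF v S] pS by blast
      obtain t where t: "t \<ge> 0" "p = v + t *\<^sub>R edge_dir v S"
        using edge_endpoint(3)[OF pr vertex_frontier[OF v S vS] pS] by blast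
      then have "t > 0" using p(1) by (cases "t = 0") auto
      then show "v \<in> S \<and> (\<exists>s>0. p - v = s *\<^sub>R edge_dir v S)" using vS t by auto
    next
      assume "v \<in> S \<and> (\<exists>s>0. p - v = s *\<^sub>R edge_dir v S)"
      then obtain s where s: "v \<in> S" "s > 0" "p - v = s *\<^sub>R edge_dir v S" by blast
      then have "v + s *\<^sub>R edge_dir v S \<in> S" using p(2) by (intro \<rho>_ray v S) auto
      then show "p \<in> S" using s(3) by (metis add.commute diff_add_cancel)
    qed
    have "q \<bullet> edge_vec S \<in> \<int> \<longleftrightarrow> q \<bullet> edge_dir v S \<in> \<int>" if "v \<in> S"
      using edge_endpoint(1)[OF pr vertex_frontier[OF v S that]] by auto
    then show ?thesis unfolding leg_at_def using pS by auto
  qed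
  then show ?thesis unfolding sheets_iff by blast
qed

text \<open>Junctions are used within \<rho>/2 of a vertex, where the balls are disjoint, and sheets
  beyond \<rho>/4 of all vertices. On the shells in between both descriptions agree, since there the
  sheets are the legs of the junction.\<close>

lemma local_lag_assembly:
  assumes J: "\<And>v. v \<in> vertices E \<Longrightarrow> lag_set (J v)"
    and legs: "\<And>v l q p. v \<in> vertices E \<Longrightarrow> norm p > \<rho> v / 4 \<Longrightarrow> ((l, q, p) \<in> J v \<longleftrightarrow>
      (\<exists>S\<in>{S\<in>E. v \<in> S}. \<exists>k<w S. leg_at (edge_dir v S) 0 (real k + 1) l q p))"
  defines "Z \<equiv> {(l, q, p). (\<exists>v\<in>vertices E. norm (p - v) < \<rho> v / 2 \<and> (l, q, p - v) \<in> J v) \<or>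
      (\<forall>v\<in>vertices E. norm (p - v) > \<rho> v / 4) \<and> (l, q, p) \<in> sheets}"
  shows "local_lag Z z" "lattice_inv Z"
    and "\<exists>M. \<forall>(l, q, p)\<in>Z. norm p \<le> K \<longrightarrow> \<bar>l\<bar> \<le> M"
    and "(\<forall>v\<in>vertices E. norm (p - v) \<ge> \<rho> v / 2) \<Longrightarrow> (l, q, p) \<in> Z \<longleftrightarrow> (l, q, p) \<in> sheets"
proof -
  have overlap: "(l, q, p - v) \<in> J v \<longleftrightarrow> (l, q, p) \<in> sheets"
    if v: "v \<in> vertices E" and p: "\<rho> v / 4 < norm (p - v)" "norm (p - v) \<le> \<rho> v" for l q p v
  proof -
    have "p \<noteq> v" using p(1) \<rho>_pos[OF v] by auto
    then show ?thesis unfolding legs[OF v p(1)] using sheets_near_vertex[OF v _ p(2)] by blast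
  qed
  have Z_vertex: "(l, q, p) \<in> Z \<longleftrightarrow> (l, q, p - v) \<in> J v" if v: "v \<in> vertices E" "norm (p - v) < \<rho> v / 2" for l q p v
  proof
    assume "(l, q, p) \<in> Z"
    then consider v' where "v' \<in> vertices E" "norm (p - v') < \<rho> v' / 2" "(l, q, p - v') \<in> J v'"
      | "\<forall>v\<in>vertices E. norm (p - v) > \<rho> v / 4" "(l, q, p) \<in> sheets" unfolding Z_def by blast
    then show "(l, q, p - v) \<in> J v"
    proof cases
      case 1
      then show ?thesis using balls_disjoint[OF v(1) _ v(2)] by blast
    next
      case 2
      then show ?thesis using overlap[OF v(1), of p l q] v \<rho>_pos[OF v(1)] by auto
    qed
  qed (use v in \<open>auto simp: Z_def\<close>)
  have Z_far: "(l, q, p) \<in> Z \<longleftrightarrow> (l, q, p) \<in> sheets" if far: "\<forall>v\<in>vertices E. norm (p - v) > \<rho> v / 4" for l q p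
  proof
    assume "(l, q, p) \<in> Z"
    then consider v where "v \<in> vertices E" "norm (p - v) < \<rho> v / 2" "(l, q, p - v) \<in> J v"
      | "(l, q, p) \<in> sheets" unfolding Z_def by blast
    then show "(l, q, p) \<in> sheets"
    proof cases
      case 1
      then show ?thesis using overlap[OF 1(1), of p l q] far \<rho>_pos[OF 1(1)] by auto
    qed
  qed (use far in \<open>auto simp: Z_def\<close>)
  show "(l, q, p) \<in> Z \<longleftrightarrow> (l, q, p) \<in> sheets" if "\<forall>v\<in>vertices E. norm (p - v) \<ge> \<rho> v / 2" for l q p
  proof (rule Z_far, rule ballI)
    fix v assume "v \<in> vertices E"
    then show "norm (p - v) > \<rho> v / 4" using that \<rho>_pos[of v] by force
  qed
  show "local_lag Z z"
  proof -
    obtain l q p where z: "z = (l, q, p)" by (cases z)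
    show ?thesis
    proof (cases "\<exists>v\<in>vertices E. norm (p - v) < \<rho> v / 2")
      case True
      then obtain v where v: "v \<in> vertices E" "norm (p - v) < \<rho> v / 2" by blast
      let ?Jv = "(\<lambda>(l, q, p). (l + 0, 1 *\<^sub>R q + 0, 1 *\<^sub>R p + v)) ` J v"
      have "local_lag (J v) y" for y using J[OF v(1)] unfolding lag_set_def by blast
      then have loc: "local_lag ?Jv z" by (intro local_lag_transform_all) auto
      have mem: "(l, q, p) \<in> ?Jv \<longleftrightarrow> (l, q, p - v) \<in> J v" for l q p by (force simp: image_iff)
      show ?thesis
      proof (rule local_lag_cong[OF loc])
        show "open {x::real \<times> (real^'n) \<times> (real^'n). norm (snd (snd x) - v) < \<rho> v / 2}"
          by (intro open_Collect_less continuous_intros)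
        show "Z \<inter> {x. norm (snd (snd x) - v) < \<rho> v / 2} = ?Jv \<inter> {x. norm (snd (snd x) - v) < \<rho> v / 2}"
          using Z_vertex[OF v(1)] mem by (simp add: set_eq_iff del: image_iff) blast
      qed (use v z in simp)
    next
      case False
      then have far: "norm (p - v) \<ge> \<rho> v / 2" if "v \<in> vertices E" for v using that by force
      have "p \<notin> vertices E" using far[of p] \<rho>_pos[of p] by auto
      then have loc: "local_lag sheets z" unfolding z by (rule local_lag_sheets)
      obtain N where N: "open N" "p \<in> N" "finite {S\<in>E. S \<inter> N \<noteq> {}}" using edges_locally_finite by blast
      then obtain \<eta> where \<eta>: "\<eta> > 0" "ball p \<eta> \<subseteq> N" using open_contains_ball by blast
      define D where "D = vertices E \<inter> N"
      have D: "finite D" unfolding D_def by (rule finite_vertices[OF N(3)])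
      \<comment> \<open>Avoiding the quarter balls of the finitely many vertices in N is enough: a
        vertex v whose quarter ball comes within \<eta>/4 of p has \<rho> v < \<eta>, as p is at
        least \<rho> v / 2 away from it, and so v lies in the ball of radius \<eta> around
        p.\<close>
      define W where "W = {x::real \<times> (real^'n) \<times> (real^'n). norm (snd (snd x) - p) < \<eta> / 4} \<inter>
          (\<Inter>v\<in>D. {x. \<rho> v / 4 < norm (snd (snd x) - v)})"
      have W: "open W" unfolding W_def
        by (intro open_Int open_INT ballI D open_Collect_less continuous_intros)
      have zW: "z \<in> W" using \<eta>(1) far \<rho>_pos by (force simp: W_def z D_def)
      have awayW: "norm (p' - v) > \<rho> v / 4" if x: "(l', q', p') \<in> W" and v: "v \<in> vertices E" for l' q' p' v
      proof (rule ccontr)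
        assume c: "\<not> norm (p' - v) > \<rho> v / 4"
        have p': "norm (p' - p) < \<eta> / 4" using x by (simp add: W_def)
        have tri: "norm (p - v) \<le> norm (p' - p) + norm (p' - v)"
          by (metis dist_norm dist_triangle3 dist_commute)
        have "\<rho> v < \<eta>" using far[OF v] c p' tri by linarith
        then have "norm (p - v) < \<eta>" using c p' tri \<eta>(1) by linarith
        then have "v \<in> D" using \<eta>(2) v by (auto simp: D_def dist_norm subset_iff)
        then have "\<rho> v / 4 < norm (p' - v)" using x by (auto simp: W_def)
        then show False using c by simp
      qed
      show ?thesis
      proof (rule local_lag_cong[OF loc W zW], intro set_eqI)
        fix x show "x \<in> Z \<inter> W \<longleftrightarrow> x \<in> sheets \<inter> W"
          using Z_far awayW by (cases x) blast
      qed
    qed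
  qed
  show "lattice_inv Z"
    unfolding lattice_inv_def
  proof (intro allI impI)
    fix l q p and m :: "real^'n" assume m: "integral_vec m" and "(l, q, p) \<in> Z"
    moreover have "(l, q + m, p - v) \<in> J v" if "v \<in> vertices E" "(l, q, p - v) \<in> J v" for v
      using J[OF that(1)] that(2) m by (auto simp: lag_set_def lattice_inv_def)
    moreover have "(l, q + m, p) \<in> sheets" if "(l, q, p) \<in> sheets"
      using lattice_inv_sheets that m by (auto simp: lattice_inv_def)
    ultimately show "(l, q + m, p) \<in> Z" unfolding Z_def by blast
  qed
  show "\<exists>M. \<forall>(l, q, p)\<in>Z. norm p \<le> K \<longrightarrow> \<bar>l\<bar> \<le> M"
  proof -
    \<comment> \<open>Radii are at most 1, so a junction with a point of norm at most K belongs to a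
      vertex in the ball of radius K + 1.\<close>
    define C where "C = cball (0 :: real^'n) (K + 1)"
    have fE: "finite {S\<in>E. S \<inter> C \<noteq> {}}" unfolding C_def by (intro finite_edges_compact compact_cball)
    have fV: "finite (vertices E \<inter> C)" by (rule finite_vertices[OF fE])
    have "\<exists>M. \<forall>(l, q, p)\<in>J v. \<bar>l\<bar> \<le> M" if "v \<in> vertices E" for v using J[OF that] by (simp add: lag_set_def)
    then obtain m where m: "\<And>v l q p. v \<in> vertices E \<Longrightarrow> (l, q, p) \<in> J v \<Longrightarrow> \<bar>l\<bar> \<le> m v"
      by (metis (mono_tags, lifting) case_prod_conv)
    define M where "M = (\<Sum>v\<in>vertices E \<inter> C. \<bar>m v\<bar>) + (\<Sum>S\<in>{S\<in>E. S \<inter> C \<noteq> {}}. real (w S))"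
    have "\<bar>l\<bar> \<le> M" if "(l, q, p) \<in> Z" "norm p \<le> K" for l q p
      using that(1) unfolding Z_def mem_Collect_eq case_prod_conv
    proof (elim disjE bexE conjE)
      fix v assume v: "v \<in> vertices E" "norm (p - v) < \<rho> v / 2" "(l, q, p - v) \<in> J v"
      have "norm v \<le> norm p + norm (p - v)" using norm_triangle_ineq4[of p "p - v"] by simp
      then have "v \<in> C" using v(2) \<rho>_le[OF v(1)] that(2) by (simp add: C_def)
      then have "\<bar>m v\<bar> \<le> (\<Sum>v\<in>vertices E \<inter> C. \<bar>m v\<bar>)" using fV v(1) by (intro member_le_sum) auto
      moreover have "\<bar>l\<bar> \<le> \<bar>m v\<bar>" using m[OF v(1,3)] by simp
      moreover have "0 \<le> (\<Sum>S\<in>{S\<in>E. S \<inter> C \<noteq> {}}. real (w S))" by (intro sum_nonneg) simp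
      ultimately show "\<bar>l\<bar> \<le> M" unfolding M_def by linarith
    next
      assume "(l, q, p) \<in> sheets"
      then obtain S k where S: "S \<in> E" "k < w S" "l = real k + 1" "p \<in> S" unfolding sheets_iff by blast
      have "p \<in> C" using that(2) by (simp add: C_def)
      then have "S \<in> {S\<in>E. S \<inter> C \<noteq> {}}" using S by blast
      then have "real (w S) \<le> (\<Sum>S\<in>{S\<in>E. S \<inter> C \<noteq> {}}. real (w S))" using fE by (intro member_le_sum) auto
      moreover have "\<bar>l\<bar> \<le> real (w S)" using S by simp
      moreover have "0 \<le> (\<Sum>v\<in>vertices E \<inter> C. \<bar>m v\<bar>)" by (intro sum_nonneg) simp
      ultimately show "\<bar>l\<bar> \<le> M" unfolding M_def by linarith
    qed
    then show ?thesis by blast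
  qed
qed

end

end

section \<open>From the assembled set to the lift\<close>

lemma periodized_conormal_edge:
  fixes S :: "(real^'n::finite) set"
  assumes S: "rational_polyhedral_domain S" "aff_dim S = 1"
  shows "quot (q, p) \<in> periodized_conormal S \<longleftrightarrow> p \<in> S \<and> q \<bullet> edge_vec S \<in> \<int>"
proof
  assume "quot (q, p) \<in> periodized_conormal S"
  then obtain q' where q': "p \<in> S" "\<forall>x\<in>S. \<forall>y\<in>S. q' \<bullet> (x - y) = 0" "integral_vec (q - q')"
    by (auto simp: periodized_conormal_def quot_eq_iff)
  obtain y where y: "y \<in> S" "y \<noteq> p" using edge_not_singleton[OF S, of p] q'(1) by blast
  obtain t where t: "y = p + t *\<^sub>R edge_vec S" using edge_line[OF S q'(1) y(1)] by blast
  have "q' \<bullet> (y - p) = 0" using q' y by blast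
  then have "q' \<bullet> edge_vec S = 0" using t y(2) by auto
  moreover have "(q - q') \<bullet> edge_vec S \<in> \<int>"
    by (rule integral_vec_inner_Ints[OF q'(3) primitive_vec_integral[OF edge_vec(1)[OF S]]])
  ultimately show "p \<in> S \<and> q \<bullet> edge_vec S \<in> \<int>" using q'(1) by (simp add: inner_diff_left)
next
  assume p: "p \<in> S \<and> q \<bullet> edge_vec S \<in> \<int>"
  obtain m where m: "integral_vec m" "m \<bullet> edge_vec S = 1" using primitive_vec_bezout[OF edge_vec(1)[OF S]] .
  \<comment> \<open>Subtracting the integer q \<bullet> u times a Bezout vector of u changes q by a
    lattice vector and makes it annihilate the edge.\<close>
  define q' where "q' = q - (q \<bullet> edge_vec S) *\<^sub>R m"
  have "q' \<bullet> (x - y) = 0" if xy: "x \<in> S" "y \<in> S" for x y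
  proof -
    obtain t where "x = y + t *\<^sub>R edge_vec S" using edge_line[OF S xy(2,1)] by blast
    then show ?thesis using m(2) by (simp add: q'_def inner_diff_left)
  qed
  moreover have "quot (q', p) = quot (q, p)"
    using p m(1) by (simp add: quot_eq_iff q'_def integral_vec_uminus[OF integral_vec_scale])
  ultimately show "quot (q, p) \<in> periodized_conormal S"
    unfolding periodized_conormal_def using p by (intro image_eqI[of _ _ "(q', p)"]) auto
qed

context
  fixes E :: "(real^'n::finite) set set" and w :: "(real^'n) set \<Rightarrow> nat" and V :: "(real^'n) set"
    and Z :: "(real \<times> (real^'n) \<times> (real^'n)) set"
  assumes curve: "tropical_curve E w"
    and vert: "vertices E \<subseteq> V"
    and loc: "\<And>x. local_lag Z x" and inv: "lattice_inv Z"
    and far: "\<And>l q p. p \<notin> closure V \<Longrightarrow> (l, q, p) \<in> Z \<longleftrightarrow> (l, q, p) \<in> sheets E w"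
begin

definition far_sheet :: "(real^'n) set \<Rightarrow> nat \<Rightarrow> (real \<times> (complex^'n) \<times> (real^'n)) set" where
  "far_sheet S k = {x \<in> labelled_quot Z. fst x = real k + 1 \<and> snd (snd x) \<in> S - closure V}"

lemma labelled_quot_far:
  assumes S: "S \<in> E" and p: "p \<in> S - closure V"
  shows "(l, quot (q, p)) \<in> labelled_quot Z \<longleftrightarrow> (\<exists>k<w S. l = real k + 1 \<and> q \<bullet> edge_vec S \<in> \<int>)"
proof -
  have "p \<notin> vertices E" using p vert closure_subset by blast
  then have "S' = S" if "S' \<in> E" "p \<in> S'" for S'
    using edges_meet_in_vertex(1)[OF curve S that(1) _ that(2)] p by blast
  then show ?thesis
    using far[of p l q] p S unfolding labelled_quot_iff[OF loc inv] sheets_iff[OF curve] by blast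
qed

text \<open>Far labels are the integers j + 1, so a distance less than 1 from k + 1 singles out one
  sheet of S; the union of all other edges is closed by local finiteness.\<close>

lemma far_sheet_open:
  assumes S: "S \<in> E" and k: "k < w S"
  shows "openin (top_of_set (labelled_quot Z)) (far_sheet S k)"
proof -
  have clE: "closed (\<Union>(E - {S}))"
  proof -
    have "locally_finite_in euclidean (E - {S})"
      using curve locally_finite_in_subset[of euclidean E "E - {S}"] by (auto simp: tropical_curve_def)
    then have "closedin euclidean (\<Union>(E - {S}))"
    proof (rule closedin_locally_finite_Union[rotated])
      fix S' assume "S' \<in> E - {S}"
      then show "closedin euclidean S'" using edge_closed[OF edge_domain(1,2)[OF curve], of S'] by simp
    qed
    then show ?thesis by (simp only: closed_closedin)
  qed
  define G where "G = {x::real \<times> (complex^'n) \<times> (real^'n). \<bar>fst x - (real k + 1)\<bar> < 1} \<inter>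
      (\<lambda>x. snd (snd x)) -` (- closure V \<inter> - \<Union>(E - {S}))"
  have "open G" unfolding G_def
    by (intro open_Int open_Collect_less open_vimage open_Compl[OF clE] open_Compl[OF closed_closure] continuous_intros)
  moreover have "far_sheet S k = labelled_quot Z \<inter> G"
  proof (intro equalityI subsetI IntI)
    fix x assume x: "x \<in> far_sheet S k"
    then show "x \<in> labelled_quot Z" by (simp add: far_sheet_def)
    have p: "snd (snd x) \<in> S" "snd (snd x) \<notin> closure V" "fst x = real k + 1" using x by (auto simp: far_sheet_def)
    then have "snd (snd x) \<notin> vertices E" using vert closure_subset by blast
    then have "snd (snd x) \<notin> \<Union>(E - {S})" using edges_meet_in_vertex(1)[OF curve S _ p(1)] by blast
    then show "x \<in> G" using p by (simp add: G_def)
  next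
    fix x assume x: "x \<in> labelled_quot Z \<inter> G"
    then obtain l q p where xq: "x = (l, quot (q, p))" "(l, q, p) \<in> Z" by (auto simp: labelled_quot_def)
    have p: "p \<notin> closure V" "p \<notin> \<Union>(E - {S})" "\<bar>l - (real k + 1)\<bar> < 1" using x xq(1) by (auto simp: G_def)
    then obtain S' j where S': "S' \<in> E" "j < w S'" "l = real j + 1" "p \<in> S'"
      using far[OF p(1), of l q] xq(2) unfolding sheets_iff[OF curve] by blast
    then have "S' = S" using p(2) by blast
    moreover have "\<bar>real j - real k\<bar> < 1" using p(3) S'(3) by simp
    then have "j = k" by linarith
    ultimately show "x \<in> far_sheet S k" using x xq S' p(1) by (auto simp: far_sheet_def)
  qed
  ultimately show ?thesis by (auto intro: openin_open_Int)
qed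

lemma far_sheet_homeomorphic:
  assumes S: "S \<in> E" and k: "k < w S"
  shows "homeomorphic_maps (top_of_set (far_sheet S k))
    (top_of_set {z \<in> periodized_conormal S. snd z \<notin> closure V}) snd (\<lambda>z. (real k + 1, z))"
proof -
  note pr = edge_domain(1,2)[OF curve S]
  have mem: "(real k + 1, z) \<in> far_sheet S k \<longleftrightarrow> z \<in> periodized_conormal S \<and> snd z \<notin> closure V" for z
  proof (cases "z \<in> cotorus")
    case True
    then obtain q p where z: "z = quot (q, p)" by (auto simp: cotorus_def)
    show ?thesis
      using labelled_quot_far[OF S, of p "real k + 1" q] k
      by (auto simp: far_sheet_def z periodized_conormal_edge[OF pr])
  next
    case False
    moreover have "z \<notin> periodized_conormal S" using False by (auto simp: periodized_conormal_def cotorus_def)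
    ultimately show ?thesis using labelled_quot_cotorus[OF loc inv, of "(real k + 1, z)"] by (auto simp: far_sheet_def)
  qed
  have lab: "fst x = real k + 1" if "x \<in> far_sheet S k" for x using that by (simp add: far_sheet_def)
  show ?thesis
    unfolding homeomorphic_maps_def
  proof (intro conjI)
    have "snd x \<in> {z \<in> periodized_conormal S. snd z \<notin> closure V}" if "x \<in> far_sheet S k" for x
      using mem[of "snd x"] lab[OF that] that by (metis (mono_tags, lifting) mem_Collect_eq prod.collapse)
    then show "continuous_map (top_of_set (far_sheet S k)) (top_of_set {z \<in> periodized_conormal S. snd z \<notin> closure V}) snd"
      by (simp add: continuous_map_in_subtopology continuous_on_snd continuous_on_id image_subset_iff)
    show "continuous_map (top_of_set {z \<in> periodized_conormal S. snd z \<notin> closure V}) (top_of_set (far_sheet S k)) (\<lambda>z. (real k + 1, z))"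
      using mem by (auto simp: continuous_map_in_subtopology intro!: continuous_on_Pair continuous_on_const continuous_on_id)
  qed (use lab in \<open>auto simp: prod_eq_iff\<close>)
qed

lemma lift_of_label_set:
  assumes bounded: "\<And>K. \<exists>M. \<forall>(l, q, p)\<in>Z. norm p \<le> K \<longrightarrow> \<bar>l\<bar> \<le> M"
    and near: "\<And>l q p. (l, q, p) \<in> Z \<Longrightarrow> p \<in> U \<and> p \<in> \<Union>E \<union> closure V"
  shows "\<exists>(T :: (nat \<times> (complex^'n) \<times> (real^'n)) topology) \<A> f. lagrangian_lift E w U V T \<A> f {}"
proof -
  let ?X = "labelled_quot Z"
  obtain T :: "(nat \<times> (complex^'n) \<times> (real^'n)) topology" and \<A> H where
    H: "homeomorphic_map (top_of_set ?X) T H" and sndH: "\<And>x. x \<in> ?X \<Longrightarrow> snd (H x) = snd x"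
    and man: "smooth_manifold T \<A>" "lagrangian_immersion \<A> snd" and pr: "proper_map T (top_of_set cotorus) snd"
    using realize_manifold[OF loc inv bounded] by blast
  obtain G where HG: "homeomorphic_maps (top_of_set ?X) T H G" using H homeomorphic_map_maps by blast
  have GH: "G (H x) = x" if "x \<in> ?X" for x using HG that by (simp add: homeomorphic_maps_def)
  have topT: "topspace T = H ` ?X" using homeomorphic_imp_surjective_map[OF H] by simp
  have inj: "inj_on H ?X" by (rule inj_on_inverseI[of _ G]) (rule GH)
  have pX: "snd (snd x) \<in> U \<and> snd (snd x) \<in> \<Union>E \<union> closure V" if "x \<in> ?X" for x
  proof -
    obtain l q p where "x = (l, quot (q, p))" "(l, q, p) \<in> Z"
      using \<open>x \<in> ?X\<close> by (auto simp: labelled_quot_def)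
    then show ?thesis using near[of l q p] by simp
  qed
  have "lagrangian_lift E w U V T \<A> snd {}"
    unfolding lagrangian_lift_def
  proof (intro conjI ballI)
    show "singular_lagrangian T \<A> snd {}" using man pr by (simp add: singular_lagrangian_def)
    show "snd ` lag_support T snd {} \<subseteq> U" using pX sndH by (auto simp: lag_support_def topT)
    show "snd (snd y) \<in> \<Union>E \<union> closure V" if "y \<in> topspace T" for y
    proof -
      obtain x where "x \<in> ?X" "y = H x" using \<open>y \<in> topspace T\<close> by (auto simp: topT)
      then show ?thesis using pX[of x] sndH[of x] by simp
    qed
    fix S assume S: "S \<in> E"
    define P where "P = (\<lambda>k. H ` far_sheet S k)"
    have sub: "far_sheet S k \<subseteq> ?X" for k by (auto simp: far_sheet_def)
    show "\<exists>P :: nat \<Rightarrow> _ set. disjoint_family_on P {..<w S} \<and>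
        (\<Union>k<w S. P k) = {x \<in> topspace T. snd (snd x) \<in> S - closure V} \<and>
        (\<forall>k<w S. openin T (P k) \<and> homeomorphic_map (subtopology T (P k))
             (top_of_set {z \<in> periodized_conormal S. snd z \<notin> closure V}) snd)"
    proof (intro exI[of _ P] conjI allI impI)
      show "disjoint_family_on P {..<w S}"
        unfolding disjoint_family_on_def
      proof (intro ballI impI)
        fix j k :: nat assume "j \<noteq> k"
        then have "far_sheet S j \<inter> far_sheet S k = {}" by (auto simp: far_sheet_def)
        then show "P j \<inter> P k = {}"
          unfolding P_def using inj_on_image_Int[OF inj sub sub, of j k] by simp
      qed
      show "(\<Union>k<w S. P k) = {x \<in> topspace T. snd (snd x) \<in> S - closure V}"
      proof (intro equalityI subsetI)
        fix y assume "y \<in> (\<Union>k<w S. P k)"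
        then obtain k x where "x \<in> far_sheet S k" "y = H x" by (auto simp: P_def)
        then show "y \<in> {x \<in> topspace T. snd (snd x) \<in> S - closure V}"
          using sndH by (auto simp: topT far_sheet_def)
      next
        fix y assume y: "y \<in> {x \<in> topspace T. snd (snd x) \<in> S - closure V}"
        then obtain x where x: "x \<in> ?X" "y = H x" by (auto simp: topT)
        then obtain l q p where xq: "x = (l, quot (q, p))" "(l, q, p) \<in> Z" by (auto simp: labelled_quot_def)
        have p: "p \<in> S - closure V" using y x sndH[OF x(1)] by (simp add: xq(1))
        then obtain k where "k < w S" "l = real k + 1" using labelled_quot_far[OF S p, of l q] x(1) xq(1) by blast
        then have "x \<in> far_sheet S k" using x(1) p by (simp add: far_sheet_def xq(1))
        then show "y \<in> (\<Union>k<w S. P k)" using x(2) \<open>k < w S\<close> unfolding P_def by blast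
      qed
      fix k assume k: "k < w S"
      show "openin T (P k)"
        using homeomorphic_imp_open_map[OF H] far_sheet_open[OF S k] unfolding open_map_def P_def by blast
      have "homeomorphic_map (subtopology (top_of_set ?X) (far_sheet S k)) (subtopology T (P k)) H"
        by (rule homeomorphic_map_subtopologies[OF H]) (use sub in \<open>auto simp: P_def topT\<close>)
      then have hS: "homeomorphic_map (top_of_set (far_sheet S k)) (subtopology T (P k)) H"
        using sub[of k] by (simp add: subtopology_subtopology Int_absorb1)
      show "homeomorphic_map (subtopology T (P k)) (top_of_set {z \<in> periodized_conormal S. snd z \<notin> closure V}) snd"
      proof -
        obtain g where g: "homeomorphic_maps (top_of_set (far_sheet S k)) (subtopology T (P k)) H g"
          using hS homeomorphic_map_maps by blast
        have "homeomorphic_map (subtopology T (P k))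
            (top_of_set {z \<in> periodized_conormal S. snd z \<notin> closure V}) (snd \<circ> g)"
          by (rule homeomorphic_maps_imp_map[OF homeomorphic_maps_compose[OF conjI[OF
                homeomorphic_maps_sym[THEN iffD1, OF g] far_sheet_homeomorphic[OF S k]]]])
        moreover have "(snd \<circ> g) y = snd y" if "y \<in> topspace (subtopology T (P k))" for y
        proof -
          obtain x where x: "x \<in> far_sheet S k" "y = H x" using \<open>y \<in> topspace (subtopology T (P k))\<close> by (auto simp: P_def)
          then have "g y = x" using g by (simp add: homeomorphic_maps_def)
          moreover have "x \<in> ?X" using x(1) sub by blast
          ultimately show ?thesis using sndH[of x] x(2) by simp
        qed
        ultimately show ?thesis by (rule homeomorphic_map_eq)
      qed
    qed
  qed simp_all
  then show ?thesis by blast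
qed

end

theorem corollary1p1:
  fixes E :: "(real^'n::finite) set set" and w :: "(real^'n) set \<Rightarrow> nat"
    and U V :: "(real^'n) set"
  assumes "tropical_curve E w"
    and "\<forall>v\<in>vertices E. valence E v \<le> 4"
    and "open U" and "\<Union>E \<subseteq> U"
    and "open V" and "vertices E \<subseteq> V"
  shows "\<exists>(T :: (nat \<times> (complex^'n) \<times> (real^'n)) topology) \<A> f \<Sigma>.
           lagrangian_lift E w U V T \<A> f \<Sigma> \<and>
           discrete \<Sigma> \<and>
           (\<forall>z\<in>\<Sigma>. isolated_conical_point (lag_support T f \<Sigma>) z \<and>
              snd z \<in> vertices E \<and> valence E (snd z) = 4)"
proof -
  note curve = assms(1)
  have vU: "v \<in> U \<inter> V" if v: "v \<in> vertices E" for v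
  proof -
    obtain S where S: "S \<in> E" "v \<in> rel_frontier S" using v by (auto simp: vertices_def)
    then have "v \<in> S" using edge_frontier[OF edge_domain(1,2)[OF curve]] by blast
    then show ?thesis using S(1) v assms(4,6) by blast
  qed
  \<comment> \<open>The ball lies in U, so that the junction stays near the curve, and in V, so that
    outside \<open>closure V\<close> only sheets are left.\<close>
  have "\<forall>v\<in>vertices E. \<exists>\<rho>>0. \<rho> \<le> 1 \<and> cball v \<rho> \<subseteq> U \<inter> V \<and> (\<forall>S\<in>E. S \<inter> cball v \<rho> \<noteq> {} \<longrightarrow> v \<in> S) \<and>
    (\<forall>S\<in>E. v \<in> S \<longrightarrow> (\<forall>t\<ge>0. norm (t *\<^sub>R edge_dir v S) \<le> \<rho> \<longrightarrow> v + t *\<^sub>R edge_dir v S \<in> S))"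
    by (intro ballI vertex_radius[OF curve] open_Int assms vU)
  then obtain \<rho> where \<rho>: "\<forall>v\<in>vertices E. \<rho> v > 0 \<and> \<rho> v \<le> 1 \<and> cball v (\<rho> v) \<subseteq> U \<inter> V \<and>
      (\<forall>S\<in>E. S \<inter> cball v (\<rho> v) \<noteq> {} \<longrightarrow> v \<in> S) \<and>
      (\<forall>S\<in>E. v \<in> S \<longrightarrow> (\<forall>t\<ge>0. norm (t *\<^sub>R edge_dir v S) \<le> \<rho> v \<longrightarrow> v + t *\<^sub>R edge_dir v S \<in> S))"
    unfolding bchoice_iff by blast
  have \<rho>_pos: "\<rho> v > 0" and \<rho>_le: "\<rho> v \<le> 1" and \<rho>_sub: "cball v (\<rho> v) \<subseteq> U \<inter> V" if "v \<in> vertices E" for v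
    using \<rho> that by blast+
  have \<rho>_meet: "v \<in> S" if "v \<in> vertices E" "S \<in> E" "S \<inter> cball v (\<rho> v) \<noteq> {}" for v S
    using \<rho> that by blast
  have \<rho>_ray: "v + t *\<^sub>R edge_dir v S \<in> S"
    if "v \<in> vertices E" "S \<in> E" "v \<in> S" "t \<ge> 0" "norm (t *\<^sub>R edge_dir v S) \<le> \<rho> v" for v S t
    using \<rho> that by blast
  have "\<forall>v\<in>vertices E. \<exists>J. lag_set J \<and> (\<forall>l q p. norm p > \<rho> v / 4 \<longrightarrow> ((l, q, p) \<in> J \<longleftrightarrow>
      (\<exists>S\<in>{S\<in>E. v \<in> S}. \<exists>k<w S. leg_at (edge_dir v S) 0 (real k + 1) l q p)))"
  proof
    fix v assume v: "v \<in> vertices E"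
    show "\<exists>J. lag_set J \<and> (\<forall>l q p. norm p > \<rho> v / 4 \<longrightarrow> ((l, q, p) \<in> J \<longleftrightarrow>
      (\<exists>S\<in>{S\<in>E. v \<in> S}. \<exists>k<w S. leg_at (edge_dir v S) 0 (real k + 1) l q p)))"
    proof (rule junction_exists)
      show "finite {S\<in>E. v \<in> S}" using finite_edges_compact[OF curve, of "{v}"] by simp
      show "card {S\<in>E. v \<in> S} \<le> 4" using assms(2) v by (simp add: valence_def)
      show "primitive_vec (edge_dir v S)" if "S \<in> {S\<in>E. v \<in> S}" for S
        using that edge_endpoint(4)[OF edge_domain(1,2)[OF curve] vertex_frontier[OF curve v]] by blast
      show "inj_on (edge_dir v) {S\<in>E. v \<in> S}"
        by (rule edge_dir_inj[OF curve, of \<rho>]) (use \<rho>_pos \<rho>_le \<rho>_meet \<rho>_ray v in auto)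
      show "w S > 0" if "S \<in> {S\<in>E. v \<in> S}" for S using that edge_domain(3)[OF curve] by blast
      show "(\<Sum>S\<in>{S\<in>E. v \<in> S}. real (w S) *\<^sub>R edge_dir v S) = 0"
        using curve v by (auto simp: tropical_curve_def)
      show "\<rho> v / 4 > 0" using \<rho>_pos[OF v] by simp
    qed
  qed
  then obtain J where "\<forall>v\<in>vertices E. lag_set (J v) \<and> (\<forall>l q p. norm p > \<rho> v / 4 \<longrightarrow> ((l, q, p) \<in> J v \<longleftrightarrow>
      (\<exists>S\<in>{S\<in>E. v \<in> S}. \<exists>k<w S. leg_at (edge_dir v S) 0 (real k + 1) l q p)))"
    unfolding bchoice_iff by blast
  then have J: "lag_set (J v)" "norm p > \<rho> v / 4 \<Longrightarrow> ((l, q, p) \<in> J v \<longleftrightarrow>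
      (\<exists>S\<in>{S\<in>E. v \<in> S}. \<exists>k<w S. leg_at (edge_dir v S) 0 (real k + 1) l q p))"
    if "v \<in> vertices E" for v l q p using that by blast+
  define Z where "Z = {(l, q, p). (\<exists>v\<in>vertices E. norm (p - v) < \<rho> v / 2 \<and> (l, q, p - v) \<in> J v) \<or>
      (\<forall>v\<in>vertices E. norm (p - v) > \<rho> v / 4) \<and> (l, q, p) \<in> sheets E w}"
  note Z0 = local_lag_assembly[OF curve, where \<rho> = \<rho> and J = J, folded Z_def]
  have Z: "local_lag Z z" "lattice_inv Z" "\<exists>M. \<forall>(l, q, p)\<in>Z. norm p \<le> K \<longrightarrow> \<bar>l\<bar> \<le> M" for z K
    by (rule Z0; fact \<rho>_pos \<rho>_le \<rho>_meet \<rho>_ray J)+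
  have Z_sheets: "(l, q, p) \<in> Z \<longleftrightarrow> (l, q, p) \<in> sheets E w"
    if p: "\<forall>v\<in>vertices E. norm (p - v) \<ge> \<rho> v / 2" for l q p
    by (rule Z0(4); fact \<rho>_pos \<rho>_le \<rho>_meet \<rho>_ray J p)
  have "\<exists>(T :: (nat \<times> (complex^'n) \<times> (real^'n)) topology) \<A> f. lagrangian_lift E w U V T \<A> f {}"
  proof (rule lift_of_label_set[OF curve assms(6) Z(1,2) _ Z(3)])
    show "(l, q, p) \<in> Z \<longleftrightarrow> (l, q, p) \<in> sheets E w" if p: "p \<notin> closure V" for l q p
    proof (rule Z_sheets, rule ballI, rule ccontr)
      fix v assume v: "v \<in> vertices E" and "\<not> norm (p - v) \<ge> \<rho> v / 2"
      then have "p \<in> cball v (\<rho> v)" using \<rho>_pos[OF v] by (simp add: dist_norm norm_minus_commute)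
      then show False using \<rho>_sub[OF v] p closure_subset by blast
    qed
    fix l q p assume "(l, q, p) \<in> Z"
    then consider v where "v \<in> vertices E" "norm (p - v) < \<rho> v / 2"
      | "(l, q, p) \<in> sheets E w" unfolding Z_def by blast
    then show "p \<in> U \<and> p \<in> \<Union>E \<union> closure V"
    proof cases
      case 1
      then have "p \<in> cball v (\<rho> v)" using \<rho>_pos[of v] by (simp add: dist_norm norm_minus_commute)
      then show ?thesis using \<rho>_sub[OF 1(1)] closure_subset by blast
    next
      case 2
      then show ?thesis using assms(4) unfolding sheets_iff[OF curve] by blast
    qed
  qed
  then obtain T :: "(nat \<times> (complex^'n) \<times> (real^'n)) topology" and \<A> f
    where "lagrangian_lift E w U V T \<A> f {}" by blast
  moreover have "discrete ({} :: ((complex^'n) \<times> (real^'n)) set)" by simp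
  ultimately show ?thesis by blast
qed

end
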